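(* Let $X=\mathbb R^d$ and let $\kappa\colon\mathbb R^d\to(0,\infty)$ be bounded and continuous with $\sup_{x\in\mathbb R^d}\sup_{|y|\le1}\frac{\kappa(x)}{\kappa(x-y)}<\infty$. Let $(S(t))_{t\ge0}$ and $(T(t))_{t\ge0}$ be two convex monotone semigroups on $C_\kappa$ with generators $A$ and $B$, respectively. Assume that for every $f\in\mathcal L_T\cap\mathrm{Lip}_b$ and every $\varepsilon>0$ there exist $\delta,t_0>0$ with $$T(t)(\tau_xf)\le\tau_xT(t)f+\frac{\varepsilon t}{\kappa}\quad\text{for all }t\in[0,t_0]\text{ and }x\in\mathbb R^d\text{ with }|x|\le\delta,$$ and that $T(t)\colon\mathrm{Lip}_b\to\mathrm{Lip}_b$ for all $t\ge0$. Furthermore, suppose that $C_b^\infty\subset D(A)\cap D(B)$ and $Af\le Bf$ for all $f\in C_b^\infty$. Then $S(t)f\le T(t)f$ for all $t\ge0$ and $f\in C_\kappa$.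
   Context: $\|f\|_\kappa:=\sup_{x}|f(x)|\kappa(x)$, $f^+=\max\{f,0\}$; functions are ordered pointwise. $C_\kappa$ is the space of continuous $f\colon\mathbb R^d\to\mathbb R$ with $\|f\|_\kappa<\infty$. Convergence $f_n\to f$ in $C_\kappa$ (mixed topology) means $\sup_n\|f_n\|_\kappa<\infty$ and $f_n\to f$ uniformly on every compact set; limits as $h\downarrow0$ are along all sequences $h_n>0$, $h_n\to0$. $\mathrm{Lip}_b$ is the space of bounded Lipschitz continuous functions $\mathbb R^d\to\mathbb R$; $C_b^\infty$ is the space of bounded infinitely differentiable functions $\mathbb R^d\to\mathbb R$ all of whose partial derivatives of any order are bounded. Shift: $(\tau_xf)(y):=f(x+y)$. A convex monotone semigroup on $C_\kappa$ is a family of operators $S(t)\colon C_\kappa\to C_\kappa$, $t\ge0$, such that: (S1) each $S(t)$ is convex and monotone, and $S(t)f_n\downarrow0$ pointwise whenever $(f_n)\subset C_\kappa$ decreases pointwise to $0$; (S2) $S(0)f=f$ and $S(s+t)f=S(s)S(t)f$; (S3) $\sup_{t\in[0,T]}\|S(t)\frac r\kappa\|_\kappa<\infty$ for all $r,T\ge0$; (S4) for all $t\ge0$, $f\in C_\kappa$: $\limsup_n(S(s_n)f)(x_n)\le(S(t)f)(x)$ for all $x\in\mathbb R^d$ and all sequences $0\le s_n\to t$, $x_n\to x$. The Lipschitz set $\mathcal L_T$ is the set of $f\in C_\kappa$ with $\limsup_{h\downarrow0}\|\frac{T(h)f-f}{h}\|_\kappa<\infty$. The generator of $(S(t))$ is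 $Af:=\lim_{h\downarrow0}\frac{S(h)f-f}{h}\in C_\kappa$ (mixed topology), with domain $D(A)$ the set of $f\in C_\kappa$ for which this limit exists; $B$ is defined in the same way from $(T(t))$. *)

theory Defs
  imports "HOL-Analysis.Analysis"
begin

type_synonym 'n fn = "real ^ 'n \<Rightarrow> real"

(* The weighted supremum norm takes values in ennreal, so that finiteness is a genuine
   condition: a supremum of an unbounded set of reals would be a junk value. *)
definition wnorm :: "'n fn \<Rightarrow> 'n::finite fn \<Rightarrow> ennreal" where
  "wnorm \<kappa> f = (SUP x. ennreal (\<bar>f x\<bar> * \<kappa> x))"

definition C_weighted :: "'n fn \<Rightarrow> ('n::finite fn) set" where
  "C_weighted \<kappa> = {f. continuous_on UNIV f \<and> wnorm \<kappa> f < \<infinity>}"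

definition mixed_limit :: "'n fn \<Rightarrow> (nat \<Rightarrow> 'n fn) \<Rightarrow> 'n::finite fn \<Rightarrow> bool" where
  "mixed_limit \<kappa> f g \<longleftrightarrow>
     (SUP n. wnorm \<kappa> (f n)) < \<infinity> \<and>
     (\<forall>K. compact K \<longrightarrow> uniform_limit K f g sequentially)"

definition decreases_to_zero :: "(nat \<Rightarrow> 'n::finite fn) \<Rightarrow> bool" where
  "decreases_to_zero f \<longleftrightarrow> (\<forall>x. decseq (\<lambda>n. f n x) \<and> (\<lambda>n. f n x) \<longlonglongrightarrow> 0)"

definition Lip_b :: "('n::finite fn) set" where
  "Lip_b = {f. bounded (range f) \<and> (\<exists>L. L-lipschitz_on UNIV f)}"

definition partial_derivative :: "'n \<Rightarrow> 'n fn \<Rightarrow> 'n::finite fn" where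
  "partial_derivative i f = (\<lambda>x. frechet_derivative f (at x) (axis i 1))"

fun iterated_partial :: "'n list \<Rightarrow> 'n fn \<Rightarrow> 'n::finite fn" where
  "iterated_partial [] f = f"
| "iterated_partial (i # is) f = partial_derivative i (iterated_partial is f)"

(* frechet_derivative is meaningful only where the function is differentiable. Demanding this
   of every iterated partial derivative makes all of them exist and be continuous, which is
   infinite differentiability. The empty list gives boundedness of f itself. *)
definition Cb_infinity :: "('n::finite fn) set" where
  "Cb_infinity = {f. \<forall>is. iterated_partial is f differentiable_on UNIV \<and>
                          bounded (range (iterated_partial is f))}"

definition shift :: "real ^ 'n \<Rightarrow> 'n fn \<Rightarrow> 'n::finite fn" where
  "shift x f = (\<lambda>y. f (x + y))"

(* Operators are total functions; only their values at times t \<ge> 0 and on the weighted space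
   are constrained. *)
locale convex_monotone_semigroup =
  fixes \<kappa> :: "'n::finite fn" and S :: "real \<Rightarrow> 'n fn \<Rightarrow> 'n fn"
  assumes maps_into:
      "\<And>t f. 0 \<le> t \<Longrightarrow> f \<in> C_weighted \<kappa> \<Longrightarrow> S t f \<in> C_weighted \<kappa>"
    and convex:
      "\<And>t f g c. 0 \<le> t \<Longrightarrow> f \<in> C_weighted \<kappa> \<Longrightarrow> g \<in> C_weighted \<kappa> \<Longrightarrow> 0 \<le> c \<Longrightarrow> c \<le> 1 \<Longrightarrow>
         S t (\<lambda>x. c * f x + (1 - c) * g x) \<le> (\<lambda>x. c * S t f x + (1 - c) * S t g x)"
    and monotone:
      "\<And>t f g. 0 \<le> t \<Longrightarrow> f \<in> C_weighted \<kappa> \<Longrightarrow> g \<in> C_weighted \<kappa> \<Longrightarrow> f \<le> g \<Longrightarrow> S t f \<le> S t g"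
    and continuous_from_above:
      "\<And>t f. 0 \<le> t \<Longrightarrow> (\<And>n. f n \<in> C_weighted \<kappa>) \<Longrightarrow> decreases_to_zero f \<Longrightarrow>
         decreases_to_zero (\<lambda>n. S t (f n))"
    and at_zero:
      "\<And>f. f \<in> C_weighted \<kappa> \<Longrightarrow> S 0 f = f"
    and semigroup:
      "\<And>s t f. 0 \<le> s \<Longrightarrow> 0 \<le> t \<Longrightarrow> f \<in> C_weighted \<kappa> \<Longrightarrow> S (s + t) f = S s (S t f)"
    and locally_bounded:
      "\<And>r T. 0 \<le> r \<Longrightarrow> 0 \<le> T \<Longrightarrow> (SUP t\<in>{0..T}. wnorm \<kappa> (S t (\<lambda>x. r / \<kappa> x))) < \<infinity>"
    and upper_semicontinuous:
      "\<And>t f x s y. 0 \<le> t \<Longrightarrow> f \<in> C_weighted \<kappa> \<Longrightarrow> (\<And>n. 0 \<le> s n) \<Longrightarrow> s \<longlonglongrightarrow> t \<Longrightarrow> y \<longlonglongrightarrow> x \<Longrightarrow>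
         limsup (\<lambda>n. ereal (S (s n) f (y n))) \<le> ereal (S t f x)"

definition Lipschitz_set :: "'n fn \<Rightarrow> (real \<Rightarrow> 'n fn \<Rightarrow> 'n fn) \<Rightarrow> ('n::finite fn) set" where
  "Lipschitz_set \<kappa> T =
     {f \<in> C_weighted \<kappa>. Limsup (at_right 0) (\<lambda>h. wnorm \<kappa> (\<lambda>x. (T h f x - f x) / h)) < \<infinity>}"

definition is_generator_limit ::
  "'n fn \<Rightarrow> (real \<Rightarrow> 'n fn \<Rightarrow> 'n fn) \<Rightarrow> 'n fn \<Rightarrow> 'n::finite fn \<Rightarrow> bool" where
  "is_generator_limit \<kappa> S f g \<longleftrightarrow>
     g \<in> C_weighted \<kappa> \<and>
     (\<forall>h. (\<forall>n. 0 < h n) \<longrightarrow> h \<longlonglongrightarrow> 0 \<longrightarrow>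
        mixed_limit \<kappa> (\<lambda>n x. (S (h n) f x - f x) / h n) g)"

definition generator_domain ::
  "'n fn \<Rightarrow> (real \<Rightarrow> 'n fn \<Rightarrow> 'n fn) \<Rightarrow> ('n::finite fn) set" where
  "generator_domain \<kappa> S = {f \<in> C_weighted \<kappa>. \<exists>g. is_generator_limit \<kappa> S f g}"

definition generator ::
  "'n fn \<Rightarrow> (real \<Rightarrow> 'n fn \<Rightarrow> 'n fn) \<Rightarrow> 'n fn \<Rightarrow> 'n::finite fn" where
  "generator \<kappa> S f = (THE g. is_generator_limit \<kappa> S f g)"

lemma mixed_limit_unique:
  fixes g g' :: "'n::finite fn"
  assumes "mixed_limit \<kappa> f g" "mixed_limit \<kappa> f g'"
  shows "g = g'"
proof
  fix x :: "real ^ 'n"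
  have "compact {x}"
    by simp
  then have "uniform_limit {x} f g sequentially" "uniform_limit {x} f g' sequentially"
    using assms unfolding mixed_limit_def by blast+
  then have "(\<lambda>n. f n x) \<longlonglongrightarrow> g x" "(\<lambda>n. f n x) \<longlonglongrightarrow> g' x"
    by (simp_all add: uniform_limit_singleton)
  then show "g x = g' x"
    by (rule LIMSEQ_unique)
qed

lemma generator_limit_sequence:
  assumes "is_generator_limit \<kappa> S f g" "\<And>n. 0 < h n" "h \<longlonglongrightarrow> 0"
  shows "mixed_limit \<kappa> (\<lambda>n x. (S (h n) f x - f x) / h n) g"
proof -
  have "(\<forall>n. 0 < h n) \<longrightarrow> h \<longlonglongrightarrow> 0 \<longrightarrow> mixed_limit \<kappa> (\<lambda>n x. (S (h n) f x - f x) / h n) g"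
    by (rule assms(1)[unfolded is_generator_limit_def, THEN conjunct2, THEN spec])
  with assms(2,3) show ?thesis
    by simp
qed

lemma generator_eqI:
  assumes "is_generator_limit \<kappa> S f g"
  shows "generator \<kappa> S f = g"
  unfolding generator_def
proof (rule the_equality)
  show "is_generator_limit \<kappa> S f g"
    by (fact assms)
next
  fix g'
  assume g': "is_generator_limit \<kappa> S f g'"
  have pos: "\<And>n. 0 < inverse (real (Suc n))"
    by simp
  show "g' = g"
    by (rule mixed_limit_unique
        [OF generator_limit_sequence[OF g' pos LIMSEQ_inverse_real_of_nat]
            generator_limit_sequence[OF assms pos LIMSEQ_inverse_real_of_nat]])
qed

end

theory Submission
  imports Defs
begin

text \<open>
Let \<open>f\<close> be bounded, Lipschitz continuous and in the Lipschitz set of \<open>T\<close>. The curve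
\<open>s \<mapsto> S (t - s) (T s f)\<close> joins \<open>S t f\<close> to \<open>T t f\<close>. If all \<open>T s f\<close> were smooth, the
inequality between the generators would make this curve nondecreasing, which is the claim. But
\<open>T s f\<close> is only Lipschitz, so it is mollified in space with a bump of small support, and the
curve \<open>\<phi> s = S (t - s) (mollify c (T s f)) x\<close> is studied instead. A mollified function is an
average of shifts, so convexity of \<open>T h\<close> (a Jensen inequality, \<open>semigroup_mollify_le\<close>) and the
almost translation invariance give
\<open>T h (mollify c (T s f)) \<le> mollify c (T (s + h) f) + \<epsilon> h / \<kappa>\<close>, while the generators are ordered
on the smooth function \<open>mollify c (T s f)\<close>. Together these yield
\<open>\<phi> s \<le> \<phi> (s + h) + O(\<epsilon> h) + o(h)\<close> (\<open>interpolation_derivative\<close>).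

The obstacle is that the support radius that the almost translation invariance tolerates depends
on \<open>s\<close>, whereas the bump must stay the same along the curve. Let \<open>good \<epsilon> n\<close> be the set of those
\<open>s\<close> for which radius and time horizon \<open>1 / (n + 1)\<close> suffice. These sets are closed, since the
condition involves only quantities that are Lipschitz in \<open>s\<close>, and they increase to \<open>[0, t]\<close>. Hence
their complements have small measure. If \<open>s\<close> is good, then the generator at
\<open>mollify c (T s f)\<close> is at most a multiple of \<open>1 / \<kappa>\<close>, with a factor that depends neither on the
bump nor on \<open>s\<close>; so \<open>\<phi> s \<le> \<phi> u + B (u - s)\<close> for all later \<open>u\<close> (\<open>interpolation_crude\<close>), in
particular across a gap of the good set. A real induction along the closed good set
(\<open>growth_on_closed_set\<close>) adds up both estimates to
\<open>\<phi> 0 \<le> \<phi> t + O(\<epsilon>) + B \<sqdot> |[0, t] - good \<epsilon> n|\<close>. Now \<open>n\<close> is chosen for \<open>\<epsilon>\<close>, then the support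
for \<open>n\<close>, and \<open>\<epsilon>\<close> tends to zero.

The remainders \<open>o(h)\<close> are small only in the mixed topology: bounded in the weighted norm and small
on compact sets. That \<open>S t\<close> keeps them small, uniformly for \<open>t\<close> in compact intervals, is a Dini
argument: continuity from above gives monotone convergence to zero for every fixed \<open>t\<close>, and the
values are upper semicontinuous in \<open>t\<close> (\<open>decreasing_uniformly_small\<close>). Convexity transfers this
from perturbations of zero to perturbations of an arbitrary function (\<open>mixed_perturbation\<close>). The
same continuity extends the comparison from smooth functions to all of \<open>C_weighted \<kappa>\<close>.
\<close>

section \<open>A space of smooth bumps closed under partial derivatives\<close>

text \<open>The functions \<open>t\<^sup>-\<^sup>k exp (- 1 / t)\<close>, extended by zero to \<open>t \<le> 0\<close>. With the parameter
\<open>k\<close> the derivatives of \<open>exp (- 1 / t)\<close> are linear combinations of members of the family.\<close>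

definition flat :: "nat \<Rightarrow> real \<Rightarrow> real" where
  "flat k t = (if 0 < t then (1 / t) ^ k * exp (- (1 / t)) else 0)"

lemma flat_nonneg: "0 \<le> flat k t"
  by (simp add: flat_def)

lemma flat_pos: "0 < t \<Longrightarrow> 0 < flat k t"
  by (simp add: flat_def)

lemma flat_eq_0: "t \<le> 0 \<Longrightarrow> flat k t = 0"
  by (simp add: flat_def)

lemma flat_tendsto_0: "(flat k \<longlongrightarrow> 0) (at 0)"
proof -
  have "((\<lambda>t::real. inverse t ^ k / exp (inverse t)) \<longlongrightarrow> 0) (at_right 0)"
    by (rule filterlim_compose[OF tendsto_power_div_exp_0 filterlim_inverse_at_top_right])
  moreover have "\<forall>\<^sub>F t::real in at_right 0. inverse t ^ k / exp (inverse t) = flat k t"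
    unfolding eventually_at_filter
    by (auto simp: flat_def exp_minus inverse_eq_divide)
  ultimately have right: "(flat k \<longlongrightarrow> 0) (at_right 0)"
    by (rule Lim_transform_eventually)
  have "\<forall>\<^sub>F t::real in at_left 0. 0 = flat k t"
    unfolding eventually_at_filter by (auto simp: flat_def)
  then have "(flat k \<longlongrightarrow> 0) (at_left 0)"
    by (rule Lim_transform_eventually[OF tendsto_const])
  with right show ?thesis
    using filterlim_split_at by blast
qed

lemma flat_has_derivative:
  "(flat k has_real_derivative flat (k + 2) t - real k * flat (Suc k) t) (at t)"
proof -
  consider "0 < t" | "t < 0" | "t = 0"
    by linarith
  then show ?thesis
  proof cases
    case 1
    have "((\<lambda>t. (1 / t) ^ k * exp (- (1 / t))) has_real_derivative
        flat (k + 2) t - real k * flat (Suc k) t) (at t)"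
    proof (rule DERIV_cong)
      have chain: "((\<lambda>t. u t ^ k * exp (- u t)) has_real_derivative
          real k * (d * u t ^ (k - 1)) * exp (- u t) - u t ^ k * (exp (- u t) * d)) (at t)"
        if "(u has_real_derivative d) (at t)" for u :: "real \<Rightarrow> real" and d
        using that by (auto intro!: derivative_eq_intros)
      have "((\<lambda>t. (1 / t)) has_real_derivative - (1 / t)\<^sup>2) (at t)"
        using 1 by (auto intro!: derivative_eq_intros simp: power2_eq_square field_simps)
      from chain[OF this] show "((\<lambda>t. (1 / t) ^ k * exp (- (1 / t))) has_real_derivative
          real k * (- (1 / t)\<^sup>2 * (1 / t) ^ (k - 1)) * exp (- (1 / t)) - (1 / t) ^ k * (exp (- (1 / t)) * - (1 / t)\<^sup>2)) (at t)" .
      show "real k * (- (1 / t)\<^sup>2 * (1 / t) ^ (k - 1)) * exp (- (1 / t)) - (1 / t) ^ k * (exp (- (1 / t)) * - (1 / t)\<^sup>2)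
          = flat (k + 2) t - real k * flat (Suc k) t"
        using 1 by (cases k) (simp_all add: flat_def power2_eq_square)
    qed
    then show ?thesis
      by (rule has_field_derivative_transform_within_open[where S = "{0<..}"])
        (use 1 in \<open>auto simp: flat_def\<close>)
  next
    case 2
    have "((\<lambda>t. 0) has_real_derivative flat (k + 2) t - real k * flat (Suc k) t) (at t)"
      using 2 by (simp add: flat_def)
    then show ?thesis
      by (rule has_field_derivative_transform_within_open[where S = "{..<0}"])
        (use 2 in \<open>auto simp: flat_def\<close>)
  next
    case 3
    have "flat k t / t = flat (Suc k) t" for t
      by (simp add: flat_def)
    then show ?thesis
      using flat_tendsto_0[of "Suc k"] 3
      by (simp add: has_field_derivative_iff flat_eq_0)
  qed
qed

text \<open>Smoothness of a bump could be shown by computing its derivatives of all orders. It is simpler to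
have a space of functions that contains a bump and is closed under partial derivatives. The chain
rule applied to \<open>flat k (r - y \<bullet> y)\<close> only produces coordinate factors, sums and scalars, so these
are the closure rules. Members vanish outside the ball of radius \<open>\<surd>r\<close>.\<close>

inductive bump_like :: "real \<Rightarrow> (real ^ 'n::finite \<Rightarrow> real) \<Rightarrow> bool" for r where
  base: "bump_like r (\<lambda>y. flat k (r - y \<bullet> y))"
| scale: "bump_like r g \<Longrightarrow> bump_like r (\<lambda>y. a * g y)"
| coord: "bump_like r g \<Longrightarrow> bump_like r (\<lambda>y. y $ i * g y)"
| add: "bump_like r g \<Longrightarrow> bump_like r h \<Longrightarrow> bump_like r (\<lambda>y. g y + h y)"

lemma bump_like_support: "bump_like r g \<Longrightarrow> r \<le> y \<bullet> y \<Longrightarrow> g y = 0"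
  by (induction rule: bump_like.induct) (auto simp: flat_eq_0)

lemma bump_like_derivative:
  fixes g :: "real ^ 'n::finite \<Rightarrow> real"
  assumes "bump_like r g"
  shows "\<exists>D. (\<forall>i. bump_like r (D i)) \<and> (\<forall>y. (g has_derivative (\<lambda>v. \<Sum>i\<in>UNIV. v $ i * D i y)) (at y))"
  using assms
proof induction
  case (base k)
  let ?D = "\<lambda>i y :: real^'n. y $ i * (- 2 * (flat (k + 2) (r - y \<bullet> y) + (- real k) * flat (Suc k) (r - y \<bullet> y)))"
  have "bump_like r (?D i)" for i
    by (intro bump_like.intros)
  moreover have "((\<lambda>y. flat k (r - y \<bullet> y)) has_derivative (\<lambda>v. \<Sum>i\<in>UNIV. v $ i * ?D i y)) (at y)" for y :: "real^'n"
  proof -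
    have inner: "((\<lambda>y. r - y \<bullet> y) has_derivative (\<lambda>v. - 2 * (y \<bullet> v))) (at y)"
      by (auto intro!: derivative_eq_intros simp: inner_commute)
    have "((\<lambda>y. flat k (r - y \<bullet> y)) has_derivative
        (\<lambda>v. (flat (k + 2) (r - y \<bullet> y) - real k * flat (Suc k) (r - y \<bullet> y)) * (- 2 * (y \<bullet> v)))) (at y)"
      using has_derivative_compose[OF inner flat_has_derivative[unfolded has_field_derivative_def]] by simp
    also have "(\<lambda>v. (flat (k + 2) (r - y \<bullet> y) - real k * flat (Suc k) (r - y \<bullet> y)) * (- 2 * (y \<bullet> v))) =
        (\<lambda>v. \<Sum>i\<in>UNIV. v $ i * ?D i y)"
      by (rule ext, simp only: inner_vec_def[of y] sum_distrib_left, intro sum.cong refl)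
        (simp add: algebra_simps)
    finally show ?thesis .
  qed
  ultimately show ?case
    by (intro exI[of _ ?D] conjI allI)
next
  case (scale g a)
  then obtain D where D: "\<And>i. bump_like r (D i)"
      "\<And>y. (g has_derivative (\<lambda>v. \<Sum>i\<in>UNIV. v $ i * D i y)) (at y)"
    by blast
  have "((\<lambda>y. a * g y) has_derivative (\<lambda>v. \<Sum>i\<in>UNIV. v $ i * (a * D i y))) (at y)" for y
    by (rule derivative_eq_intros D refl)+ (simp add: sum_distrib_left algebra_simps)
  then show ?case
    by (intro exI[of _ "\<lambda>i y. a * D i y"]) (auto intro!: bump_like.intros D)
next
  case (coord g j)
  then obtain D where D: "\<And>i. bump_like r (D i)"
      "\<And>y. (g has_derivative (\<lambda>v. \<Sum>i\<in>UNIV. v $ i * D i y)) (at y)"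
    by blast
  let ?E = "\<lambda>i y. y $ j * D i y + (if i = j then 1 else 0) * g y"
  have "((\<lambda>y. y $ j * g y) has_derivative (\<lambda>v. \<Sum>i\<in>UNIV. v $ i * ?E i y)) (at y)" for y
  proof -
    have "(\<Sum>i\<in>UNIV. v $ i * ((if i = j then 1 else 0) * g y)) = v $ j * g y" for v :: "real ^ 'n"
      by (simp add: if_distrib if_distribR cong: if_cong)
    then have "(\<Sum>i\<in>UNIV. v $ i * ?E i y) = y $ j * (\<Sum>i\<in>UNIV. v $ i * D i y) + v $ j * g y" for v
      by (simp only: distrib_left sum.distrib) (simp add: sum_distrib_left mult_ac)
    moreover have "((\<lambda>y. y $ j * g y) has_derivative
        (\<lambda>v. y $ j * (\<Sum>i\<in>UNIV. v $ i * D i y) + v $ j * g y)) (at y)"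
      by (intro has_derivative_mult D bounded_linear_imp_has_derivative bounded_linear_vec_nth)
    ultimately show ?thesis
      by simp
  qed
  then show ?case
    by (intro exI[of _ ?E]) (auto intro!: bump_like.intros D coord.hyps)
next
  case (add g h)
  then obtain D where D: "\<And>i. bump_like r (D i)"
      "\<And>y. (g has_derivative (\<lambda>v. \<Sum>i\<in>UNIV. v $ i * D i y)) (at y)"
    by blast
  from add obtain E where E: "\<And>i. bump_like r (E i)"
      "\<And>y. (h has_derivative (\<lambda>v. \<Sum>i\<in>UNIV. v $ i * E i y)) (at y)"
    by blast
  have "((\<lambda>y. g y + h y) has_derivative (\<lambda>v. \<Sum>i\<in>UNIV. v $ i * (D i y + E i y))) (at y)" for y
    by (rule derivative_eq_intros D E refl)+ (simp add: algebra_simps sum.distrib)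
  then show ?case
    by (intro exI[of _ "\<lambda>i y. D i y + E i y"]) (auto intro!: bump_like.intros D E)
qed

lemma bump_like_continuous:
  assumes "bump_like r g"
  shows "continuous_on A g"
proof -
  obtain D where "\<And>y. (g has_derivative (\<lambda>v. \<Sum>i\<in>UNIV. v $ i * D i y)) (at y)"
    using bump_like_derivative[OF assms] by blast
  then show ?thesis
    by (intro continuous_at_imp_continuous_on ballI has_derivative_continuous)
qed

section \<open>Mollification\<close>

abbreviation cube :: "real \<Rightarrow> (real ^ 'n::finite) set" where
  "cube c \<equiv> cbox (vec (- c)) (vec c)"

text \<open>An integral over a fixed cube: for a kernel that vanishes off the cube it is the convolution with
the reflected kernel, and it can be split along tagged divisions of the cube.\<close>

definition smear :: "(real ^ 'n \<Rightarrow> real) \<Rightarrow> real \<Rightarrow> (real ^ 'n \<Rightarrow> real) \<Rightarrow> real ^ 'n::finite \<Rightarrow> real" where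
  "smear k c f x = integral (cube c) (\<lambda>y. k y * f (x + y))"

lemma mem_cube: "y \<in> cube c \<longleftrightarrow> (\<forall>i. \<bar>y $ i\<bar> \<le> c)"
  unfolding mem_box_cart vec_component abs_le_iff by (metis minus_le_iff)

lemma norm_cube:
  fixes y :: "real ^ 'n::finite"
  assumes "y \<in> cube c"
  shows "norm y \<le> real CARD('n) * c"
proof -
  have "norm y \<le> (\<Sum>i\<in>UNIV. \<bar>y $ i\<bar>)"
    by (rule norm_le_l1_cart)
  also have "\<dots> \<le> real CARD('n) * c"
    by (rule sum_bounded_above) (use assms in \<open>simp add: mem_cube\<close>)
  finally show ?thesis .
qed

lemma bump_like_0_outside_cube: 
  assumes "bump_like (c\<^sup>2) g" "0 < c" "\<bar>y $ i\<bar> \<ge> c"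
  shows "g y = 0"
proof -
  have "c \<le> norm y"
    using component_le_norm_cart[of y i] assms by linarith
  then have "c\<^sup>2 \<le> y \<bullet> y"
    using assms(2) by (metis power_mono power2_norm_eq_inner order_less_imp_le)
  with assms(1) show ?thesis
    by (rule bump_like_support)
qed

text \<open>Moves the translation from \<open>f\<close>, which is merely continuous, to the smooth kernel. The domain of
integration on the right depends only on \<open>x0\<close>, as differentiation under the integral sign needs.\<close>

lemma smear_as_convolution:
  fixes x x0 :: "real ^ 'n::finite"
  assumes g: "bump_like (c\<^sup>2) g" and "0 < c" and f: "continuous_on UNIV f" and "norm (x - x0) \<le> 1"
  shows "smear g c f x = integral (cbox (x0 - vec (c + 1)) (x0 + vec (c + 1))) (\<lambda>z. g (z - x) * f z)"
proof -
  let ?G = "\<lambda>z. g (z - x) * f z"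
  have cg: "continuous_on A g" for A
    using bump_like_continuous[OF g] .
  have cont: "continuous_on A ?G" for A
    by (intro continuous_intros continuous_on_compose2[OF cg[of UNIV]] continuous_on_subset[OF f]) auto
  have "smear g c f x = integral (cube c) (?G \<circ> (+) x)"
    by (simp add: smear_def o_def)
  also have "\<dots> = integral (cbox (vec (- c) + x) (vec c + x)) ?G"
    by (rule integral_shift_cbox_plus)
  also have "\<dots> = integral (cbox (x0 - vec (c + 1)) (x0 + vec (c + 1))) ?G"
  proof -
    have "?G integrable_on (cbox (vec (- c) + x) (vec c + x))"
      using cont integrable_continuous by blast
    then have "(?G has_integral (integral (cbox (vec (- c) + x) (vec c + x)) ?G)) (cbox (vec (- c) + x) (vec c + x))"
      by blast
    then have "(?G has_integral (integral (cbox (vec (- c) + x) (vec c + x)) ?G))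
        (cbox (x0 - vec (c + 1)) (x0 + vec (c + 1)))"
    proof (rule has_integral_on_superset)
      fix z assume "z \<notin> cbox (vec (- c) + x) (vec c + x)"
      then obtain i where "\<not> (vec (- c) + x) $ i \<le> z $ i \<or> \<not> z $ i \<le> (vec c + x) $ i"
        unfolding mem_box_cart by blast
      then have "c \<le> \<bar>(z - x) $ i\<bar>"
        by auto
      then show "?G z = 0"
        using bump_like_0_outside_cube[OF g \<open>0 < c\<close>, of "z - x"] by simp
    next
      show "cbox (vec (- c) + x) (vec c + x) \<subseteq> cbox (x0 - vec (c + 1)) (x0 + vec (c + 1))"
      proof
        fix z assume z: "z \<in> cbox (vec (- c) + x) (vec c + x)"
        have "(x0 - vec (c + 1)) $ i \<le> z $ i \<and> z $ i \<le> (x0 + vec (c + 1)) $ i" for i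
        proof -
          have "\<bar>x $ i - x0 $ i\<bar> \<le> 1"
            using component_le_norm_cart[of "x - x0" i] assms(4) by simp
          moreover have "(vec (- c) + x) $ i \<le> z $ i \<and> z $ i \<le> (vec c + x) $ i"
            using z unfolding mem_box_cart by blast
          ultimately show ?thesis
            by (simp add: abs_le_iff)
        qed
        then show "z \<in> cbox (x0 - vec (c + 1)) (x0 + vec (c + 1))"
          unfolding mem_box_cart by blast
      qed
    qed
    then show ?thesis
      by (simp add: integral_unique)
  qed
  finally show ?thesis .
qed

text \<open>Differentiation hits the kernel, and the reflection contributes the sign.\<close>

lemma smear_has_derivative:
  fixes f g :: "real ^ 'n::finite \<Rightarrow> real"
  assumes g: "bump_like (c\<^sup>2) g" and c: "0 < c" and f: "continuous_on UNIV f"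
    and D: "\<And>i. bump_like (c\<^sup>2) (D i)"
      "\<And>y. (g has_derivative (\<lambda>v. \<Sum>i\<in>UNIV. v $ i * D i y)) (at y)"
  shows "(smear g c f has_derivative (\<lambda>v. \<Sum>i\<in>UNIV. v $ i * smear (\<lambda>y. - 1 * D i y) c f x0)) (at x0)"
proof -
  let ?R = "cbox (x0 - vec (c + 1)) (x0 + vec (c + 1))"
  let ?U = "cball x0 1"
  define fx where "fx = (\<lambda>x z. blinfun_inner_left (f z *\<^sub>R (\<chi> i. - 1 * D i (z - x))))"
  have cD: "continuous_on A (D i)" for A i
    using bump_like_continuous[OF D(1)] .
  have cg: "continuous_on A g" for A
    using bump_like_continuous[OF g] .
  have fx_apply: "blinfun_apply (fx x z) v = (\<Sum>i\<in>UNIV. v $ i * (- 1 * D i (z - x) * f z))" for x z v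
    unfolding fx_def blinfun_inner_left.rep_eq inner_vec_def by (intro sum.cong refl) simp
  \<comment> \<open>Near \<open>x0\<close> the derivative of the integrand is a bounded linear map that is jointly continuous.\<close>
  have "((\<lambda>x. integral ?R (\<lambda>z. g (z - x) * f z)) has_derivative integral ?R (fx x0)) (at x0 within ?U)"
  proof (rule leibniz_rule)
    fix x z
    have "((\<lambda>x. g (z - x)) has_derivative (\<lambda>v. \<Sum>i\<in>UNIV. (- v) $ i * D i (z - x))) (at x within ?U)"
    proof -
      have "((\<lambda>x. z - x) has_derivative (\<lambda>v. - v)) (at x within ?U)"
        by (auto intro!: derivative_eq_intros)
      from has_derivative_compose[OF this D(2)] show ?thesis .
    qed
    from has_derivative_mult_left[OF this, of "f z"]
    have "((\<lambda>x. g (z - x) * f z) has_derivative (\<lambda>v. (\<Sum>i\<in>UNIV. (- v) $ i * D i (z - x)) * f z)) (at x within ?U)" .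
    moreover have "(\<lambda>v. (\<Sum>i\<in>UNIV. (- v) $ i * D i (z - x)) * f z) = blinfun_apply (fx x z)"
      by (rule ext) (simp add: fx_apply sum_distrib_right mult.assoc)
    ultimately show "((\<lambda>x. g (z - x) * f z) has_derivative blinfun_apply (fx x z)) (at x within ?U)"
      by (simp only:)
  next
    show "(\<lambda>z. g (z - x) * f z) integrable_on ?R" for x
      by (intro integrable_continuous continuous_intros continuous_on_compose2[OF cg[of UNIV]] continuous_on_subset[OF f]) auto
  next
    have "continuous_on (?U \<times> ?R) (\<lambda>p. fx (fst p) (snd p))"
      unfolding fx_def
      by (intro bounded_linear.continuous_on[OF bounded_linear_blinfun_inner_left] continuous_intros
          continuous_on_compose2[OF f] continuous_on_compose2[OF cD[of UNIV]]) auto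
    then show "continuous_on (?U \<times> ?R) (\<lambda>(x, t). fx x t)"
      by (simp add: case_prod_unfold)
  qed auto
  moreover have "at x0 within ?U = at x0"
    by (rule at_within_interior) auto
  ultimately have "((\<lambda>x. integral ?R (\<lambda>z. g (z - x) * f z)) has_derivative integral ?R (fx x0)) (at x0)"
    by simp
  then have "(smear g c f has_derivative integral ?R (fx x0)) (at x0)"
  proof (rule has_derivative_transform_within[of _ _ _ _ 1])
    fix x' assume "dist x' x0 < 1"
    then show "integral ?R (\<lambda>z. g (z - x') * f z) = smear g c f x'"
      using smear_as_convolution[OF g c f, of x' x0] by (simp add: dist_norm)
  qed auto
  moreover have "blinfun_apply (integral ?R (fx x0)) v = (\<Sum>i\<in>UNIV. v $ i * smear (\<lambda>y. - 1 * D i y) c f x0)" for v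
  proof -
    have "continuous_on ?R (fx x0)"
      unfolding fx_def
      by (intro bounded_linear.continuous_on[OF bounded_linear_blinfun_inner_left] continuous_intros
          continuous_on_compose2[OF f] continuous_on_compose2[OF cD[of UNIV]]) auto
    then have "fx x0 integrable_on ?R"
      by (rule integrable_continuous)
    then have "blinfun_apply (integral ?R (fx x0)) v = integral ?R (\<lambda>z. \<Sum>i\<in>UNIV. v $ i * (- 1 * D i (z - x0) * f z))"
      by (simp only: blinfun_apply_integral fx_apply)
    also have "\<dots> = (\<Sum>i\<in>UNIV. integral ?R (\<lambda>z. v $ i * (- 1 * D i (z - x0) * f z)))"
      by (intro integral_sum integrable_continuous continuous_intros continuous_on_compose2[OF cD[of UNIV]]
          continuous_on_subset[OF f]) auto
    also have "\<dots> = (\<Sum>i\<in>UNIV. v $ i * integral ?R (\<lambda>z. - 1 * D i (z - x0) * f z))"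
      by (simp only: integral_mult_right)
    also have "\<dots> = (\<Sum>i\<in>UNIV. v $ i * smear (\<lambda>y. - 1 * D i y) c f x0)"
      by (intro sum.cong refl arg_cong2[where f = "(*)"]
          smear_as_convolution[OF bump_like.scale[OF D(1)] c f, symmetric]) simp
    finally show ?thesis .
  qed
  then have "blinfun_apply (integral ?R (fx x0)) = (\<lambda>v. \<Sum>i\<in>UNIV. v $ i * smear (\<lambda>y. - 1 * D i y) c f x0)"
    by (rule ext)
  ultimately show ?thesis
    by (simp only:)
qed

lemma iterated_partial_smear:
  fixes f g :: "real ^ 'n::finite \<Rightarrow> real"
  assumes c: "0 < c" and f: "continuous_on UNIV f" and g: "bump_like (c\<^sup>2) g"
  shows "\<exists>h. bump_like (c\<^sup>2) h \<and> iterated_partial is (smear g c f) = smear h c f"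
proof (induction "is")
  case Nil
  then show ?case using g by auto
next
  case (Cons i "is")
  then obtain h where h: "bump_like (c\<^sup>2) h" "iterated_partial is (smear g c f) = smear h c f"
    by blast
  obtain D where D: "\<And>i. bump_like (c\<^sup>2) (D i)"
      "\<And>y. (h has_derivative (\<lambda>v. \<Sum>i\<in>UNIV. v $ i * D i y)) (at y)"
    using bump_like_derivative[OF h(1)] by blast
  have "partial_derivative i (smear h c f) x = smear (\<lambda>y. - 1 * D i y) c f x" for x
  proof -
    have "frechet_derivative (smear h c f) (at x) = (\<lambda>v. \<Sum>i\<in>UNIV. v $ i * smear (\<lambda>y. - 1 * D i y) c f x)"
      by (rule frechet_derivative_at[OF smear_has_derivative[OF h(1) c f D], symmetric])
    then show ?thesis
      by (simp add: partial_derivative_def axis_def if_distrib if_distribR cong: if_cong)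
  qed
  then have "iterated_partial (i # is) (smear g c f) = smear (\<lambda>y. - 1 * D i y) c f"
    by (simp add: h(2) ext)
  with bump_like.scale[OF D(1)] show ?case
    by blast
qed

lemma smear_in_Cb_infinity:
  fixes f g :: "real ^ 'n::finite \<Rightarrow> real"
  assumes c: "0 < c" and f: "continuous_on UNIV f" "bounded (range f)" and g: "bump_like (c\<^sup>2) g"
  shows "smear g c f \<in> Cb_infinity"
  unfolding Cb_infinity_def mem_Collect_eq
proof (intro allI conjI)
  fix "is" :: "'n list"
  obtain h where h: "bump_like (c\<^sup>2) h" "iterated_partial is (smear g c f) = smear h c f"
    using iterated_partial_smear[OF c f(1) g] by blast
  obtain D where D: "\<And>i. bump_like (c\<^sup>2) (D i)"
      "\<And>y. (h has_derivative (\<lambda>v. \<Sum>i\<in>UNIV. v $ i * D i y)) (at y)"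
    using bump_like_derivative[OF h(1)] by blast
  show "iterated_partial is (smear g c f) differentiable_on UNIV"
    unfolding h(2) differentiable_on_def using smear_has_derivative[OF h(1) c f(1) D]
    by (auto simp: differentiable_def)
  obtain B where B: "\<And>x. \<bar>f x\<bar> \<le> B"
    using f(2) by (auto simp: bounded_iff)
  have ch: "continuous_on A h" for A
    by (rule bump_like_continuous[OF h(1)])
  have "\<bar>smear h c f x\<bar> \<le> integral (cube c) (\<lambda>y. \<bar>h y\<bar> * B)" for x
    unfolding smear_def real_norm_def[symmetric]
  proof (rule integral_norm_bound_integral)
    show "(\<lambda>y. h y * f (x + y)) integrable_on cube c"
      by (intro integrable_continuous continuous_intros ch continuous_on_compose2[OF f(1)]) auto
    show "(\<lambda>y. norm (h y) * B) integrable_on cube c"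
      by (intro integrable_continuous continuous_intros ch)
    show "norm (h y * f (x + y)) \<le> norm (h y) * B" for y
      using B by (simp add: abs_mult mult_left_mono)
  qed
  then show "bounded (range (iterated_partial is (smear g c f)))"
    unfolding h(2) by (intro boundedI[where B = "integral (cube c) (\<lambda>y. \<bar>h y\<bar> * B)"]) auto
qed

definition bump :: "real \<Rightarrow> real ^ 'n::finite \<Rightarrow> real" where
  "bump c y = inverse (integral (cube c) (\<lambda>y :: real ^ 'n. flat 0 (c\<^sup>2 - y \<bullet> y))) * flat 0 (c\<^sup>2 - y \<bullet> y)"

abbreviation mollify :: "real \<Rightarrow> (real ^ 'n \<Rightarrow> real) \<Rightarrow> real ^ 'n::finite \<Rightarrow> real" where
  "mollify c \<equiv> smear (bump c) c"

lemma bump_like_bump: "bump_like (c\<^sup>2) (bump c)"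
  unfolding bump_def[abs_def] by (intro bump_like.intros)

lemma continuous_bump: "continuous_on A (bump c)"
  by (rule bump_like_continuous[OF bump_like_bump])

lemma unnormalised_bump_integral_pos:
  assumes "0 < c"
  shows "0 < integral (cube c) (\<lambda>y :: real ^ 'n::finite. flat 0 (c\<^sup>2 - y \<bullet> y))"
proof (rule ccontr)
  let ?g = "\<lambda>y :: real ^ 'n. flat 0 (c\<^sup>2 - y \<bullet> y)"
  assume "\<not> 0 < integral (cube c) ?g"
  moreover have cont: "continuous_on (cube c) ?g"
    by (rule bump_like_continuous[OF bump_like.base])
  then have int: "?g integrable_on cube c"
    by (rule integrable_continuous)
  moreover have "0 \<le> integral (cube c) ?g"
    using int by (rule integral_nonneg) (simp add: flat_nonneg)
  ultimately have "integral (cube c) ?g = 0"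
    by linarith
  with int have "(?g has_integral 0) (cube c)"
    by (simp add: has_integral_iff)
  moreover have "(0 :: real ^ 'n) \<in> cube c" "box (vec (- c)) (vec c :: real ^ 'n) \<noteq> {}"
    using assms by (auto simp: mem_box_cart interval_ne_empty_cart)
  ultimately have "?g 0 = 0"
    by (intro has_integral_0_cbox_imp_0[OF cont]) (auto simp: flat_nonneg)
  then show False
    using assms flat_pos[of "c\<^sup>2" 0] by simp
qed

lemma bump_nonneg:
  fixes y :: "real ^ 'n::finite"
  assumes "0 < c"
  shows "0 \<le> bump c y"
  unfolding bump_def using unnormalised_bump_integral_pos[OF assms, where 'n = 'n]
  by (simp add: flat_nonneg)

lemma integral_bump:
  assumes "0 < c"
  shows "integral (cube c) (bump c :: real ^ 'n::finite \<Rightarrow> real) = 1"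
  using unnormalised_bump_integral_pos[OF assms, where 'n = 'n]
  unfolding bump_def[abs_def] integral_mult_right by simp

lemma mollify_integrable:
  fixes f :: "real ^ 'n::finite \<Rightarrow> real"
  assumes "continuous_on UNIV f"
  shows "(\<lambda>y. bump c y * f (x + y)) integrable_on cbox a b"
  by (intro integrable_continuous continuous_intros continuous_bump continuous_on_compose2[OF assms]) auto

lemma mollify_in_Cb_infinity:
  assumes "0 < c" "continuous_on UNIV f" "bounded (range f)"
  shows "mollify c f \<in> Cb_infinity"
  using assms by (intro smear_in_Cb_infinity bump_like_bump)

lemma mollify_const: "0 < c \<Longrightarrow> mollify c (\<lambda>_. a) x = a"
  by (simp add: smear_def integral_bump)

lemma mollify_le_add:
  fixes f g :: "real ^ 'n::finite \<Rightarrow> real"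
  assumes c: "0 < c" and f: "continuous_on UNIV f" and g: "continuous_on UNIV g"
    and le: "\<And>y. y \<in> cube c \<Longrightarrow> f (x + y) \<le> g (x + y) + a"
  shows "mollify c f x \<le> mollify c g x + a"
proof -
  have "mollify c f x \<le> integral (cube c) (\<lambda>y. bump c y * g (x + y) + bump c y * a)"
    unfolding smear_def
  proof (rule integral_le)
    show "(\<lambda>y. bump c y * g (x + y) + bump c y * a) integrable_on cube c"
      by (intro integrable_add mollify_integrable[OF g] integrable_continuous continuous_intros continuous_bump)
    fix y :: "real ^ 'n" assume "y \<in> cube c"
    from mult_left_mono[OF le[OF this] bump_nonneg[OF c, of y]]
    show "bump c y * f (x + y) \<le> bump c y * g (x + y) + bump c y * a"
      by (simp add: distrib_left)
  qed (rule mollify_integrable[OF f])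
  also have "\<dots> = mollify c g x + integral (cube c) (\<lambda>y :: real ^ 'n. bump c y * a)"
    unfolding smear_def
    by (intro integral_add mollify_integrable[OF g] integrable_continuous continuous_intros continuous_bump)
  also have "integral (cube c) (\<lambda>y :: real ^ 'n. bump c y * a) = a"
    using mollify_const[OF c, of a x] by (simp add: smear_def)
  finally show ?thesis .
qed

lemma mollify_diff_le:
  fixes f g :: "real ^ 'n::finite \<Rightarrow> real"
  assumes "0 < c" "continuous_on UNIV f" "continuous_on UNIV g"
    and "\<And>y. y \<in> cube c \<Longrightarrow> \<bar>f (x + y) - g (x + y)\<bar> \<le> a"
  shows "\<bar>mollify c f x - mollify c g x\<bar> \<le> a"
proof -
  have "f (x + y) \<le> g (x + y) + a" "g (x + y) \<le> f (x + y) + a" if "y \<in> cube c" for y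
    using assms(4)[OF that] by (auto simp: abs_le_iff)
  from mollify_le_add[of c f g x a, OF assms(1-3) this(1)] mollify_le_add[of c g f x a, OF assms(1,3,2) this(2)]
  show ?thesis
    by (simp add: abs_le_iff)
qed

lemma mollify_near_const:
  fixes f :: "real ^ 'n::finite \<Rightarrow> real"
  assumes "0 < c" "continuous_on UNIV f" "\<And>y. y \<in> cube c \<Longrightarrow> \<bar>f (x + y) - b\<bar> \<le> a"
  shows "\<bar>mollify c f x - b\<bar> \<le> a"
  using mollify_diff_le[of c f "\<lambda>_. b" x a] assms by (simp add: mollify_const)

text \<open>A mollified function is a uniform limit of convex combinations of shifts: the cells of a fine
tagged division, weighted with their mass under the bump, serve all Lipschitz functions at once.
This lets the finite Jensen inequality of a convex operator pass to mollification.\<close>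

lemma mollify_convex_combination:
  assumes c: "0 < c" and e: "0 < e"
  obtains I :: "((real ^ 'n::finite) \<times> (real ^ 'n) set) set" and a
  where "finite I" "\<And>i. i \<in> I \<Longrightarrow> 0 \<le> a i" "sum a I = 1" "\<And>i. i \<in> I \<Longrightarrow> fst i \<in> cube c"
    "\<And>L f x. L-lipschitz_on UNIV f \<Longrightarrow> \<bar>mollify c f x - (\<Sum>i\<in>I. a i * f (x + fst i))\<bar> \<le> L * e"
proof -
  have "gauge (\<lambda>x :: real ^ 'n. ball x e)"
    using e by (rule gauge_ball)
  then obtain p where p: "p tagged_division_of (cube c :: (real ^ 'n) set)" "(\<lambda>x. ball x e) fine p"
    using fine_division_exists[of "\<lambda>x. ball x e"] by metis
  define a where "a = (\<lambda>i :: (real ^ 'n) \<times> (real ^ 'n) set. integral (snd i) (bump c))"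
  have int: "(\<lambda>y. bump c y) integrable_on cbox s t" for s t :: "real ^ 'n"
    by (intro integrable_continuous continuous_bump)
  show ?thesis
  proof
    show fin: "finite p"
      using p(1) by (rule tagged_division_ofD(1))
    show a_nonneg: "0 \<le> a i" if "i \<in> p" for i
    proof -
      obtain s t where "snd i = cbox s t"
        using tagged_division_ofD(4)[OF p(1), of "fst i" "snd i"] \<open>i \<in> p\<close> by auto
      then show ?thesis
        unfolding a_def using int by (simp add: integral_nonneg bump_nonneg[OF c])
    qed
    show a_sum: "sum a p = 1"
      using integral_combine_tagged_division_topdown[OF int p(1)] integral_bump[OF c, where 'n = 'n]
      by (simp add: a_def case_prod_unfold)
    show "fst i \<in> cube c" if "i \<in> p" for i
      using tagged_division_ofD(2,3)[OF p(1), of "fst i" "snd i"] that by auto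
    fix L and f :: "real ^ 'n \<Rightarrow> real" and x
    assume lip: "L-lipschitz_on UNIV f"
    then have f: "continuous_on UNIV f"
      by (rule lipschitz_on_continuous_on)
    have cell: "\<bar>integral (snd i) (\<lambda>y. bump c y * f (x + y)) - a i * f (x + fst i)\<bar> \<le> L * e * a i"
      if i: "i \<in> p" for i
    proof -
      obtain s t where st: "snd i = cbox s t"
        using tagged_division_ofD(4)[OF p(1), of "fst i" "snd i"] i by auto
      have "integral (snd i) (\<lambda>y. bump c y * f (x + y)) - a i * f (x + fst i) =
          integral (snd i) (\<lambda>y. bump c y * f (x + y)) - integral (snd i) (\<lambda>y. bump c y * f (x + fst i))"
        by (simp add: a_def)
      also have "\<dots> = integral (snd i) (\<lambda>y. bump c y * f (x + y) - bump c y * f (x + fst i))"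
        unfolding st by (intro integral_diff[symmetric] mollify_integrable[OF f] integrable_on_mult_left int)
      finally have eq: "integral (snd i) (\<lambda>y. bump c y * f (x + y)) - a i * f (x + fst i) =
          integral (snd i) (\<lambda>y. bump c y * f (x + y) - bump c y * f (x + fst i))" .
      have "norm (integral (snd i) (\<lambda>y. bump c y * f (x + y) - bump c y * f (x + fst i)))
          \<le> integral (snd i) (\<lambda>y. bump c y * (L * e))"
      proof (rule integral_norm_bound_integral)
        show "(\<lambda>y. bump c y * f (x + y) - bump c y * f (x + fst i)) integrable_on snd i"
          unfolding st by (intro integrable_diff mollify_integrable[OF f] integrable_on_mult_left int)
        show "(\<lambda>y. bump c y * (L * e)) integrable_on snd i"
          unfolding st by (intro integrable_on_mult_left int)
        fix y assume "y \<in> snd i"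
        then have "dist (fst i) y < e"
          using fineD[OF p(2), of "fst i" "snd i"] i by auto
        then have "L * dist (x + y) (x + fst i) \<le> L * e"
          using lipschitz_on_nonneg[OF lip] by (intro mult_left_mono) (auto simp: dist_commute)
        then have "\<bar>f (x + y) - f (x + fst i)\<bar> \<le> L * e"
          using lipschitz_onD[OF lip, of "x + y" "x + fst i"] by (simp add: dist_real_def)
        then show "norm (bump c y * f (x + y) - bump c y * f (x + fst i)) \<le> bump c y * (L * e)"
          using bump_nonneg[OF c, of y]
          by (simp add: abs_mult mult_left_mono flip: right_diff_distrib)
      qed
      then show ?thesis
        unfolding eq by (simp add: a_def mult_ac)
    qed
    have "mollify c f x = (\<Sum>i\<in>p. integral (snd i) (\<lambda>y. bump c y * f (x + y)))"
      unfolding smear_def using integral_combine_tagged_division_topdown[OF mollify_integrable[OF f] p(1)]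
      by (simp add: case_prod_unfold)
    then have "\<bar>mollify c f x - (\<Sum>i\<in>p. a i * f (x + fst i))\<bar>
        = \<bar>\<Sum>i\<in>p. integral (snd i) (\<lambda>y. bump c y * f (x + y)) - a i * f (x + fst i)\<bar>"
      by (simp add: sum_subtractf)
    also have "\<dots> \<le> (\<Sum>i\<in>p. L * e * a i)"
      by (rule order_trans[OF sum_abs sum_mono[OF cell]])
    also have "\<dots> = L * e"
      by (simp add: a_sum flip: sum_distrib_left)
    finally show "\<bar>mollify c f x - (\<Sum>i\<in>p. a i * f (x + fst i))\<bar> \<le> L * e" .
  qed
qed

lemma Cb_infinity_subset_Lip_b: "Cb_infinity \<subseteq> Lip_b"
proof
  fix f :: "'n::finite fn"
  assume f: "f \<in> Cb_infinity"
  have "bounded (range (iterated_partial [] f))" "iterated_partial [] f differentiable_on UNIV"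
    using f unfolding Cb_infinity_def by blast+
  then have bnd: "bounded (range f)" and diff: "f differentiable (at x)" for x
    by (auto simp: differentiable_on_def)
  have "\<exists>B. \<forall>x. \<bar>frechet_derivative f (at x) (axis i 1)\<bar> \<le> B" for i
  proof -
    have "bounded (range (iterated_partial [i] f))"
      using f unfolding Cb_infinity_def by blast
    then show ?thesis
      by (auto simp: bounded_iff partial_derivative_def)
  qed
  then obtain B where B: "\<And>i x. \<bar>frechet_derivative f (at x) (axis i 1)\<bar> \<le> B i"
    by metis
  have "(\<Sum>i\<in>UNIV. B i)-lipschitz_on UNIV f"
  proof (rule bounded_derivative_imp_lipschitz)
    show deriv: "(f has_derivative frechet_derivative f (at x)) (at x within UNIV)" for x
      using diff[of x] by (simp add: frechet_derivative_works[symmetric])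
    have "0 \<le> B i" for i
      using B[of 0 i] by linarith
    then show "0 \<le> (\<Sum>i\<in>UNIV. B i)"
      by (rule sum_nonneg)
    show "onorm (frechet_derivative f (at x)) \<le> (\<Sum>i\<in>UNIV. B i)" for x
    proof (rule onorm_le)
      fix v :: "real ^ 'n"
      let ?d = "frechet_derivative f (at x)"
      have lin: "linear ?d"
        using deriv[of x] by (rule has_derivative_linear)
      have "?d v = ?d (\<Sum>i\<in>UNIV. v $ i *\<^sub>R axis i 1)"
        by (simp add: basis_expansion flip: scalar_mult_eq_scaleR)
      also have "\<dots> = (\<Sum>i\<in>UNIV. v $ i * ?d (axis i 1))"
        by (simp add: linear_sum[OF lin] linear_scale[OF lin])
      finally have "\<bar>?d v\<bar> \<le> (\<Sum>i\<in>UNIV. \<bar>v $ i\<bar> * \<bar>?d (axis i 1)\<bar>)"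
        by (simp add: order_trans[OF sum_abs] abs_mult)
      also have "\<dots> \<le> (\<Sum>i\<in>UNIV. norm v * B i)"
        by (intro sum_mono mult_mono component_le_norm_cart B) auto
      finally show "norm (?d v) \<le> (\<Sum>i\<in>UNIV. B i) * norm v"
        by (simp add: sum_distrib_left mult.commute)
    qed
  qed auto
  with bnd show "f \<in> Lip_b"
    unfolding Lip_b_def by blast
qed

section \<open>The weighted space and null sequences of the mixed topology\<close>

locale weight =
  fixes \<kappa> :: "'n::finite fn"
  assumes weight_pos: "0 < \<kappa> x"
    and weight_bounded: "bounded (range \<kappa>)"
    and weight_continuous: "continuous_on UNIV \<kappa>"
begin

lemma wnorm_le_iff: "0 \<le> C \<Longrightarrow> wnorm \<kappa> f \<le> ennreal C \<longleftrightarrow> (\<forall>x. \<bar>f x\<bar> \<le> C / \<kappa> x)"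
  unfolding wnorm_def SUP_le_iff by (simp add: ennreal_le_iff pos_le_divide_eq weight_pos)

lemma C_weightedI:
  assumes "continuous_on UNIV f" "\<And>x. \<bar>f x\<bar> \<le> C / \<kappa> x"
  shows "f \<in> C_weighted \<kappa>"
proof -
  have "0 \<le> C / \<kappa> 0"
    using assms(2)[of 0] by linarith
  then have "0 \<le> C"
    using weight_pos[of 0] by (simp add: zero_le_divide_iff not_le)
  then have "wnorm \<kappa> f \<le> ennreal C"
    using assms(2) by (simp add: wnorm_le_iff)
  also have "ennreal C < \<infinity>"
    by simp
  finally show ?thesis
    using assms(1) by (simp add: C_weighted_def)
qed

lemma C_weighted_bound:
  assumes "f \<in> C_weighted \<kappa>"
  shows "\<exists>C\<ge>0. \<forall>x. \<bar>f x\<bar> \<le> C / \<kappa> x"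
proof -
  have "wnorm \<kappa> f < \<infinity>"
    using assms by (simp add: C_weighted_def)
  then obtain C where "0 \<le> C" "wnorm \<kappa> f = ennreal C"
    by (cases "wnorm \<kappa> f") auto
  then show ?thesis
    using wnorm_le_iff[of C f] by auto
qed

lemma C_weighted_continuous: "f \<in> C_weighted \<kappa> \<Longrightarrow> continuous_on UNIV f"
  by (simp add: C_weighted_def)

lemma C_weighted_add:
  assumes "f \<in> C_weighted \<kappa>" "g \<in> C_weighted \<kappa>"
  shows "(\<lambda>x. f x + g x) \<in> C_weighted \<kappa>"
proof -
  obtain C D where C: "\<And>x. \<bar>f x\<bar> \<le> C / \<kappa> x" and D: "\<And>x. \<bar>g x\<bar> \<le> D / \<kappa> x"
    using C_weighted_bound[OF assms(1)] C_weighted_bound[OF assms(2)] by blast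
  show ?thesis
  proof (rule C_weightedI)
    show "continuous_on UNIV (\<lambda>x. f x + g x)"
      using assms by (intro continuous_on_add C_weighted_continuous)
    show "\<bar>f x + g x\<bar> \<le> (C + D) / \<kappa> x" for x
      using C[of x] D[of x] abs_triangle_ineq[of "f x" "g x"] by (simp add: add_divide_distrib)
  qed
qed

lemma C_weighted_scale:
  assumes "f \<in> C_weighted \<kappa>"
  shows "(\<lambda>x. a * f x) \<in> C_weighted \<kappa>"
proof -
  obtain C where C: "\<And>x. \<bar>f x\<bar> \<le> C / \<kappa> x"
    using C_weighted_bound[OF assms] by blast
  show ?thesis
  proof (rule C_weightedI)
    show "continuous_on UNIV (\<lambda>x. a * f x)"
      using assms by (intro continuous_on_mult_left C_weighted_continuous)
    show "\<bar>a * f x\<bar> \<le> \<bar>a\<bar> * C / \<kappa> x" for x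
      using mult_left_mono[OF C[of x], of "\<bar>a\<bar>"] by (simp add: abs_mult)
  qed
qed

lemma C_weighted_abs:
  assumes "f \<in> C_weighted \<kappa>"
  shows "(\<lambda>x. \<bar>f x\<bar>) \<in> C_weighted \<kappa>"
proof -
  obtain C where C: "\<And>x. \<bar>f x\<bar> \<le> C / \<kappa> x"
    using C_weighted_bound[OF assms] by blast
  show ?thesis
  proof (rule C_weightedI)
    show "continuous_on UNIV (\<lambda>x. \<bar>f x\<bar>)"
      by (rule continuous_on_rabs[OF C_weighted_continuous[OF assms]])
    show "\<bar>\<bar>f x\<bar>\<bar> \<le> C / \<kappa> x" for x
      using C[of x] by simp
  qed
qed

lemma C_weighted_inverse_weight: "(\<lambda>x. a / \<kappa> x) \<in> C_weighted \<kappa>"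
proof (rule C_weightedI)
  show "continuous_on UNIV (\<lambda>x. a / \<kappa> x)"
    by (intro continuous_on_divide continuous_on_const weight_continuous ballI)
      (rule weight_pos[THEN less_imp_neq, symmetric])
  show "\<bar>a / \<kappa> x\<bar> \<le> \<bar>a\<bar> / \<kappa> x" for x
    using weight_pos[of x] by simp
qed

lemma weight_bound: "\<exists>K>0. \<forall>a\<ge>0. \<forall>x. a \<le> a * K / \<kappa> x"
proof -
  obtain K where K: "\<And>x. \<bar>\<kappa> x\<bar> \<le> K"
    using weight_bounded by (auto simp: bounded_iff)
  have "0 < K"
    using K[of 0] weight_pos[of 0] by simp
  moreover have "a \<le> a * K / \<kappa> x" if "a \<ge> 0" for a x
    using K[of x] weight_pos[of x] that by (simp add: pos_le_divide_eq mult_left_mono)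
  ultimately show ?thesis
    by (intro exI[of _ K] conjI allI impI)
qed

lemma bounded_in_C_weighted:
  assumes "continuous_on UNIV f" "bounded (range f)"
  shows "f \<in> C_weighted \<kappa>"
proof -
  obtain B where B: "\<And>x. \<bar>f x\<bar> \<le> B"
    using assms(2) by (auto simp: bounded_iff)
  have "0 \<le> B"
    using B[of 0] by linarith
  obtain K where K: "\<And>a x. 0 \<le> a \<Longrightarrow> a \<le> a * K / \<kappa> x"
    using weight_bound by blast
  show ?thesis
  proof (rule C_weightedI[OF assms(1)])
    show "\<bar>f x\<bar> \<le> B * K / \<kappa> x" for x
      using B[of x] K[OF \<open>0 \<le> B\<close>, of x] by linarith
  qed
qed

lemma Lip_b_continuous: "f \<in> Lip_b \<Longrightarrow> continuous_on UNIV f"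
  unfolding Lip_b_def using lipschitz_on_continuous_on by blast

lemma Lip_b_subset_C_weighted: "f \<in> Lip_b \<Longrightarrow> f \<in> C_weighted \<kappa>"
  by (intro bounded_in_C_weighted Lip_b_continuous) (auto simp: Lip_b_def)

lemma Cb_infinity_subset_C_weighted: "f \<in> Cb_infinity \<Longrightarrow> f \<in> C_weighted \<kappa>"
  using Cb_infinity_subset_Lip_b Lip_b_subset_C_weighted by blast

text \<open>Nonnegative sequences that converge to zero in the mixed topology. They serve as error terms.\<close>

definition mixed_null :: "(nat \<Rightarrow> 'n fn) \<Rightarrow> bool" where
  "mixed_null w \<longleftrightarrow> (\<forall>n. w n \<in> C_weighted \<kappa>) \<and> (\<forall>n x. 0 \<le> w n x) \<and>
     (\<exists>R. \<forall>n x. w n x \<le> R / \<kappa> x) \<and> (\<forall>K. compact K \<longrightarrow> uniform_limit K w (\<lambda>_. 0) sequentially)"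

lemma mixed_nullD:
  assumes "mixed_null w"
  shows "w n \<in> C_weighted \<kappa>" "0 \<le> w n x"
  using assms by (auto simp: mixed_null_def)

lemma mixed_null_bound: "mixed_null w \<Longrightarrow> \<exists>R. \<forall>n x. w n x \<le> R / \<kappa> x"
  by (simp add: mixed_null_def)

lemma mixed_null_uniform_limit:
  "mixed_null w \<Longrightarrow> compact K \<Longrightarrow> uniform_limit K w (\<lambda>_. 0) sequentially"
  by (simp add: mixed_null_def)

lemma mixed_nullI:
  assumes "\<And>n. w n \<in> C_weighted \<kappa>" "\<And>n x. 0 \<le> w n x" "\<And>n x. w n x \<le> R / \<kappa> x"
    "\<And>K. compact K \<Longrightarrow> uniform_limit K w (\<lambda>_. 0) sequentially"
  shows "mixed_null w"
  unfolding mixed_null_def using assms by (intro conjI allI impI exI[of _ R])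

lemma mixed_null_add:
  assumes "mixed_null v" "mixed_null w"
  shows "mixed_null (\<lambda>n x. v n x + w n x)"
proof -
  obtain Q R where Q: "\<And>n x. v n x \<le> Q / \<kappa> x" and R: "\<And>n x. w n x \<le> R / \<kappa> x"
    using mixed_null_bound[OF assms(1)] mixed_null_bound[OF assms(2)] by blast
  have "uniform_limit K (\<lambda>n x. v n x + w n x) (\<lambda>_. 0) sequentially" if "compact K" for K
  proof -
    have "uniform_limit K v (\<lambda>_. 0) sequentially" "uniform_limit K w (\<lambda>_. 0) sequentially"
      using assms that mixed_null_uniform_limit by simp_all
    from uniform_limit_add[OF this] show ?thesis
      by simp
  qed
  moreover have "v n x + w n x \<le> (Q + R) / \<kappa> x" for n x
    using Q[of n x] R[of n x] by (simp add: add_divide_distrib)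
  ultimately show ?thesis
    using mixed_nullD[OF assms(1)] mixed_nullD[OF assms(2)]
    by (intro mixed_nullI C_weighted_add add_nonneg_nonneg)
qed

lemma mixed_null_scale:
  assumes "mixed_null w" "0 \<le> a"
  shows "mixed_null (\<lambda>n x. a * w n x)"
proof -
  obtain R where R: "\<And>n x. w n x \<le> R / \<kappa> x"
    using mixed_null_bound[OF assms(1)] by blast
  have "uniform_limit K (\<lambda>n x. a * w n x) (\<lambda>_. 0) sequentially" if "compact K" for K
  proof -
    have "uniform_limit K w (\<lambda>_. 0) sequentially"
      using assms that mixed_null_uniform_limit by simp_all
    from bounded_linear.uniform_limit[OF bounded_linear_mult_right this, of a] show ?thesis
      by simp
  qed
  moreover have "a * w n x \<le> (a * R) / \<kappa> x" for n x
    using mult_left_mono[OF R[of n x] \<open>0 \<le> a\<close>] by simp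
  ultimately show ?thesis
    using mixed_nullD[OF assms(1)] \<open>0 \<le> a\<close>
    by (intro mixed_nullI C_weighted_scale mult_nonneg_nonneg)
qed

text \<open>A decreasing sequence each of whose members eventually dominates any given null sequence with
weighted norm at most \<open>R\<close>: small inside the ball of radius \<open>m\<close>, of maximal admissible size outside the ball of radius
\<open>m + 1\<close>. Domination reduces mixed convergence to the monotone convergence for which continuity
from above is assumed.\<close>

definition tail :: "real \<Rightarrow> nat \<Rightarrow> 'n fn" where
  "tail R m x = 1 / real (Suc m) + R / \<kappa> x * min 1 (max 0 (norm x - real m))"

lemma tail_in_C_weighted:
  assumes "0 \<le> R"
  shows "tail R m \<in> C_weighted \<kappa>"
proof -
  let ?g = "\<lambda>x :: real ^ 'n. min 1 (max 0 (norm x - real m))"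
  have g: "0 \<le> ?g x" "?g x \<le> 1" for x
    by auto
  have "(\<lambda>x. R / \<kappa> x * ?g x) \<in> C_weighted \<kappa>"
  proof (rule C_weightedI)
    show "continuous_on UNIV (\<lambda>x. R / \<kappa> x * ?g x)"
      by (rule continuous_on_mult[OF C_weighted_continuous[OF C_weighted_inverse_weight]])
        (intro continuous_intros)
    fix x
    have frac: "0 \<le> R / \<kappa> x"
      using assms weight_pos[of x] by simp
    have "R / \<kappa> x * ?g x \<le> R / \<kappa> x * 1"
      by (rule mult_left_mono[OF g(2) frac])
    moreover have "0 \<le> R / \<kappa> x * ?g x"
      by (rule mult_nonneg_nonneg[OF frac g(1)])
    ultimately show "\<bar>R / \<kappa> x * ?g x\<bar> \<le> R / \<kappa> x"
      by (simp only: abs_of_nonneg mult_1_right)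
  qed
  moreover have "(\<lambda>_. 1 / real (Suc m)) \<in> C_weighted \<kappa>"
    by (rule bounded_in_C_weighted) auto
  ultimately show ?thesis
    unfolding tail_def[abs_def] by (intro C_weighted_add)
qed

lemma decreases_to_zero_tail:
  assumes "0 \<le> R"
  shows "decreases_to_zero (tail R)"
  unfolding decreases_to_zero_def
proof (intro allI conjI)
  fix x
  have nonneg: "0 \<le> R / \<kappa> x"
    using assms weight_pos[of x] by simp
  show "decseq (\<lambda>m. tail R m x)"
    unfolding tail_def
    by (intro decseq_SucI add_mono mult_left_mono[OF _ nonneg] frac_le min.mono max.mono) auto
  have "(\<lambda>m. 1 / real (Suc m)) \<longlonglongrightarrow> 0"
    using LIMSEQ_inverse_real_of_nat by (simp add: inverse_eq_divide)
  moreover have "\<forall>\<^sub>F m in sequentially. 1 / real (Suc m) = tail R m x"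
    using eventually_ge_at_top[of "nat \<lceil>norm x\<rceil>"] by eventually_elim (simp add: tail_def)
  ultimately show "(\<lambda>m. tail R m x) \<longlonglongrightarrow> 0"
    by (rule Lim_transform_eventually)
qed

lemma mixed_null_le_tail:
  assumes "mixed_null w"
  obtains R where "0 \<le> R" "\<And>m. \<forall>\<^sub>F n in sequentially. \<forall>x. w n x \<le> tail R m x"
proof -
  obtain R where R: "\<And>n x. w n x \<le> R / \<kappa> x"
    using mixed_null_bound[OF assms] by blast
  have "0 \<le> R / \<kappa> 0"
    using R[of 0 0] mixed_nullD(2)[OF assms, of 0 0] by linarith
  then have "0 \<le> R"
    using weight_pos[of 0] by (simp add: zero_le_divide_iff not_le)
  moreover have "\<forall>\<^sub>F n in sequentially. \<forall>x. w n x \<le> tail R m x" for m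
  proof -
    have "uniform_limit (cball 0 (real (Suc m))) w (\<lambda>_. 0) sequentially"
      by (rule mixed_null_uniform_limit[OF assms compact_cball])
    from uniform_limitD[OF this, of "1 / real (Suc m)"]
    have "\<forall>\<^sub>F n in sequentially. \<forall>x\<in>cball 0 (real (Suc m)). dist (w n x) 0 < 1 / real (Suc m)"
      by simp
    then show ?thesis
    proof eventually_elim
      case (elim n)
      show ?case
      proof
        fix x
        have nonneg: "0 \<le> R / \<kappa> x"
          using \<open>0 \<le> R\<close> weight_pos[of x] by simp
        show "w n x \<le> tail R m x"
        proof (cases "norm x \<le> real (Suc m)")
          case True
          then have "w n x < 1 / real (Suc m)"
            using elim[rule_format, of x] mixed_nullD(2)[OF assms, of n x] by (simp add: dist_real_def)
          moreover have "0 \<le> R / \<kappa> x * min 1 (max 0 (norm x - real m))"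
            using nonneg by (rule mult_nonneg_nonneg) simp
          ultimately show ?thesis
            unfolding tail_def by linarith
        next
          case False
          then have "min 1 (max 0 (norm x - real m)) = 1"
            by simp
          then show ?thesis
            using R[of n x] by (simp add: tail_def add_increasing)
        qed
      qed
    qed
  qed
  ultimately show ?thesis
    using that by blast
qed

lemma tail_mixed_null:
  assumes "0 \<le> R"
  shows "mixed_null (tail R)"
proof -
  have nonneg: "0 \<le> R / \<kappa> x" for x
    using assms weight_pos[of x] by simp
  obtain K where K: "\<And>x. 1 \<le> K / \<kappa> x"
  proof -
    obtain K where "\<And>a x. 0 \<le> a \<Longrightarrow> a \<le> a * K / \<kappa> x"
      using weight_bound by blast
    from that[of K] this[of 1] show thesis
      by simp
  qed
  have bound: "tail R m x \<le> (K + R) / \<kappa> x" for m x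
  proof -
    have "R / \<kappa> x * min 1 (max 0 (norm x - real m)) \<le> R / \<kappa> x * 1"
      by (rule mult_left_mono[OF _ nonneg]) simp
    moreover have "1 / real (Suc m) \<le> K / \<kappa> x"
      by (rule order_trans[OF _ K]) simp
    ultimately show ?thesis
      by (simp add: tail_def add_divide_distrib)
  qed
  have "uniform_limit A (tail R) (\<lambda>_. 0) sequentially" if A: "compact A" for A
  proof (rule uniform_limitI)
    fix e :: real assume "0 < e"
    obtain B where B: "\<And>x. x \<in> A \<Longrightarrow> norm x \<le> B"
      using compact_imp_bounded[OF A] by (auto simp: bounded_iff)
    have "(\<lambda>m. 1 / real (Suc m)) \<longlonglongrightarrow> 0"
      using LIMSEQ_inverse_real_of_nat by (simp add: inverse_eq_divide)
    then have "\<forall>\<^sub>F m in sequentially. 1 / real (Suc m) < e"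
      using \<open>0 < e\<close> by (rule order_tendstoD(2))
    then show "\<forall>\<^sub>F m in sequentially. \<forall>x\<in>A. dist (tail R m x) 0 < e"
      using eventually_ge_at_top[of "nat \<lceil>B\<rceil>"]
    proof eventually_elim
      case (elim m)
      then have "B \<le> real m"
        by linarith
      then have "norm x - real m \<le> 0" if "x \<in> A" for x
        using B[OF that] by simp
      then show ?case
        using elim(1) by (auto simp: tail_def)
    qed
  qed
  moreover have "0 \<le> tail R m x" for m x
    unfolding tail_def by (intro add_nonneg_nonneg mult_nonneg_nonneg nonneg) auto
  ultimately show ?thesis
    using tail_in_C_weighted[OF assms] bound by (intro mixed_nullI)
qed

end

section \<open>Continuity of convex monotone semigroups\<close>

locale weighted_semigroup = weight \<kappa> + convex_monotone_semigroup \<kappa> S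
  for \<kappa> :: "'n::finite fn" and S :: "real \<Rightarrow> 'n fn \<Rightarrow> 'n fn"
begin

lemma semigroup_mono:
  assumes "0 \<le> t" "f \<in> C_weighted \<kappa>" "g \<in> C_weighted \<kappa>" "\<And>x. f x \<le> g x"
  shows "S t f x \<le> S t g x"
  using monotone[OF assms(1-3)] assms(4) by (simp add: le_fun_def)

lemma semigroup_convex:
  assumes "0 \<le> t" "f \<in> C_weighted \<kappa>" "g \<in> C_weighted \<kappa>" "0 \<le> c" "c \<le> 1"
  shows "S t (\<lambda>x. c * f x + (1 - c) * g x) x \<le> c * S t f x + (1 - c) * S t g x"
  using convex[OF assms] by (simp add: le_fun_def)

text \<open>The constant sequence of zero functions decreases to zero, and so does its image.\<close>

lemma semigroup_zero:
  assumes "0 \<le> t"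
  shows "S t (\<lambda>_. 0) x = 0"
proof -
  have "(\<lambda>_. 0) \<in> C_weighted \<kappa>"
    by (rule bounded_in_C_weighted) auto
  then have "decreases_to_zero (\<lambda>n :: nat. S t (\<lambda>_. 0))"
    using assms by (intro continuous_from_above) (auto simp: decreases_to_zero_def)
  then have "(\<lambda>n :: nat. S t (\<lambda>_. 0) x) \<longlonglongrightarrow> 0"
    by (simp add: decreases_to_zero_def)
  then show ?thesis
    by (simp add: LIMSEQ_const_iff)
qed

text \<open>The upper bound is monotonicity. The lower bound comes from convexity: since \<open>0\<close> is the midpoint
of \<open>v\<close> and \<open>- v\<close>, the sum of the images is nonnegative.\<close>

lemma semigroup_bound:
  assumes "0 \<le> r" "0 \<le> T"
  obtains C where "0 \<le> C" "\<And>t v x. t \<in> {0..T} \<Longrightarrow> v \<in> C_weighted \<kappa> \<Longrightarrow> (\<And>y. \<bar>v y\<bar> \<le> r / \<kappa> y) \<Longrightarrow> \<bar>S t v x\<bar> \<le> C / \<kappa> x"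
proof -
  have "(SUP t\<in>{0..T}. wnorm \<kappa> (S t (\<lambda>x. r / \<kappa> x))) < \<infinity>"
    by (rule locally_bounded[OF assms])
  then obtain C where C: "0 \<le> C" "(SUP t\<in>{0..T}. wnorm \<kappa> (S t (\<lambda>x. r / \<kappa> x))) = ennreal C"
    by (cases "SUP t\<in>{0..T}. wnorm \<kappa> (S t (\<lambda>x. r / \<kappa> x))") auto
  have up: "\<bar>S t (\<lambda>x. r / \<kappa> x) x\<bar> \<le> C / \<kappa> x" if "t \<in> {0..T}" for t x
  proof -
    have "wnorm \<kappa> (S t (\<lambda>x. r / \<kappa> x)) \<le> ennreal C"
      unfolding C(2)[symmetric] using that by (rule SUP_upper)
    then show ?thesis
      using C(1) by (simp add: wnorm_le_iff)
  qed
  show ?thesis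
  proof (rule that[OF C(1)])
    fix t v x
    assume t: "t \<in> {0..T}" and v: "v \<in> C_weighted \<kappa>" "\<And>y. \<bar>v y\<bar> \<le> r / \<kappa> y"
    have le: "S t u x \<le> C / \<kappa> x" if "u \<in> C_weighted \<kappa>" "\<And>y. \<bar>u y\<bar> \<le> r / \<kappa> y" for u
    proof -
      have "S t u x \<le> S t (\<lambda>x. r / \<kappa> x) x"
        using t that by (intro semigroup_mono C_weighted_inverse_weight) (auto intro: order_trans[OF abs_ge_self])
      then show ?thesis
        using up[OF t, of x] by linarith
    qed
    have neg: "(\<lambda>x. - v x) \<in> C_weighted \<kappa>"
      using C_weighted_scale[OF v(1), of "-1"] by simp
    have "S t (\<lambda>x. 1/2 * v x + (1 - 1/2) * - v x) x \<le> 1/2 * S t v x + (1 - 1/2) * S t (\<lambda>x. - v x) x"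
      using t v neg by (intro semigroup_convex) auto
    then have "0 \<le> S t v x + S t (\<lambda>x. - v x) x"
      using semigroup_zero[of t x] t by simp
    with le[OF v] le[OF neg] v(2) show "\<bar>S t v x\<bar> \<le> C / \<kappa> x"
      by simp
  qed
qed

text \<open>A one-sided Lipschitz estimate on bounded sets of the weighted space, uniform for times up to
\<open>T\<close>. The explicit radius \<open>r\<close> and step bound \<open>D\<close> make visible which data the constant depends on:
in the comparison below it must not depend on the mollifier.\<close>

definition lipschitz_constant :: "real \<Rightarrow> real \<Rightarrow> real \<Rightarrow> real \<Rightarrow> bool" where
  "lipschitz_constant T r D L \<longleftrightarrow> 0 \<le> L \<and> (\<forall>t\<in>{0..T}. \<forall>v\<in>C_weighted \<kappa>. \<forall>w\<in>C_weighted \<kappa>. \<forall>d.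
     (\<forall>x. \<bar>w x\<bar> \<le> r / \<kappa> x) \<longrightarrow> 0 \<le> d \<longrightarrow> d \<le> D \<longrightarrow> (\<forall>x. v x \<le> w x + d / \<kappa> x) \<longrightarrow>
     (\<forall>x. S t v x \<le> S t w x + d * L / \<kappa> x))"

lemma lipschitz_constantD:
  assumes "lipschitz_constant T r D L" "t \<in> {0..T}" "v \<in> C_weighted \<kappa>" "w \<in> C_weighted \<kappa>"
    "\<And>x. \<bar>w x\<bar> \<le> r / \<kappa> x" "0 \<le> d" "d \<le> D" "\<And>x. v x \<le> w x + d / \<kappa> x"
  shows "S t v x \<le> S t w x + d * L / \<kappa> x"
  using assms unfolding lipschitz_constant_def by blast

text \<open>Convex functions that are bounded on a larger ball are Lipschitz on a smaller one:
\<open>w + d / \<kappa>\<close> is a convex combination of \<open>w\<close> and \<open>w + D / \<kappa>\<close> with weight \<open>d / D\<close>.\<close>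

lemma lipschitz_constant_exists:
  assumes "0 \<le> T" "0 \<le> r" "0 < D"
  obtains L where "lipschitz_constant T r D L"
proof -
  obtain C where C: "0 \<le> C" "\<And>t v x. t \<in> {0..T} \<Longrightarrow> v \<in> C_weighted \<kappa> \<Longrightarrow>
      (\<And>y. \<bar>v y\<bar> \<le> (r + D) / \<kappa> y) \<Longrightarrow> \<bar>S t v x\<bar> \<le> C / \<kappa> x"
    by (rule semigroup_bound[of "r + D" T]) (use assms in auto)
  have "S t v x \<le> S t w x + d * (2 * C / D) / \<kappa> x"
    if t: "t \<in> {0..T}" and vw: "v \<in> C_weighted \<kappa>" "w \<in> C_weighted \<kappa>" and w: "\<And>x. \<bar>w x\<bar> \<le> r / \<kappa> x"
      and d: "0 \<le> d" "d \<le> D" and le: "\<And>x. v x \<le> w x + d / \<kappa> x" for t v w d x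
  proof -
    define \<theta> where "\<theta> = d / D"
    have \<theta>: "0 \<le> \<theta>" "\<theta> \<le> 1" "\<theta> * D = d"
      using d assms by (auto simp: \<theta>_def)
    define z where "z = (\<lambda>x. w x + D / \<kappa> x)"
    have z: "z \<in> C_weighted \<kappa>"
      unfolding z_def by (intro C_weighted_add vw C_weighted_inverse_weight)
    have frac: "0 \<le> D / \<kappa> y" for y
      using assms weight_pos[of y] by simp
    have "\<bar>z y\<bar> \<le> (r + D) / \<kappa> y" "\<bar>w y\<bar> \<le> (r + D) / \<kappa> y" for y
      using w[of y] frac[of y] by (auto simp: z_def add_divide_distrib)
    then have bounds: "\<bar>S t z x\<bar> \<le> C / \<kappa> x" "\<bar>S t w x\<bar> \<le> C / \<kappa> x"
      using C(2)[OF t] z vw by blast+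
    have "v y \<le> \<theta> * z y + (1 - \<theta>) * w y" for y
    proof -
      have "\<theta> * z y + (1 - \<theta>) * w y = w y + \<theta> * D / \<kappa> y"
        by (simp add: z_def algebra_simps)
      then show ?thesis
        using le[of y] \<theta>(3) by simp
    qed
    then have "S t v x \<le> S t (\<lambda>y. \<theta> * z y + (1 - \<theta>) * w y) x"
      using t vw z by (intro semigroup_mono C_weighted_add C_weighted_scale) auto
    also have "\<dots> \<le> \<theta> * S t z x + (1 - \<theta>) * S t w x"
      using t vw z \<theta> by (intro semigroup_convex) auto
    also have "\<dots> = S t w x + \<theta> * (S t z x - S t w x)"
      by (simp add: algebra_simps)
    also have "\<dots> \<le> S t w x + \<theta> * (2 * (C / \<kappa> x))"
      using bounds \<theta>(1) by (intro add_left_mono mult_left_mono) auto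
    finally show ?thesis
      by (simp add: \<theta>_def mult_ac)
  qed
  then have "lipschitz_constant T r D (2 * C / D)"
    using C(1) assms unfolding lipschitz_constant_def by (auto intro!: divide_nonneg_pos)
  then show ?thesis ..
qed

text \<open>Dini's theorem for the functions \<open>t \<mapsto> S t (V m) x\<close>, which decrease pointwise to zero and are
upper semicontinuous; for upper semicontinuous functions that is enough on a compact interval.\<close>

lemma decreasing_uniformly_small:
  assumes "0 \<le> T" "\<And>m. V m \<in> C_weighted \<kappa>" "decreases_to_zero V" "0 < e"
  obtains m where "\<And>t. t \<in> {0..T} \<Longrightarrow> S t (V m) x < e"
proof (rule ccontr)
  assume "\<not> thesis"
  then have "\<forall>m. \<exists>t\<in>{0..T}. e \<le> S t (V m) x"
    using that by (meson not_le)
  then obtain t where t: "\<And>m. t m \<in> {0..T}" "\<And>m. e \<le> S (t m) (V m) x"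
    by metis
  obtain l k where l: "l \<in> {0..T}" and k: "strict_mono k" and lim: "(t \<circ> k) \<longlonglongrightarrow> l"
    using compact_Icc[of 0 T] t(1) unfolding compact_def by metis
  have mono: "V n y \<le> V m y" if "m \<le> n" for m n y
    using assms(3) that by (auto simp: decreases_to_zero_def decseq_def)
  have "e \<le> S l (V m) x" for m
  proof -
    have "limsup (\<lambda>n. ereal (S ((t \<circ> k) n) (V m) x)) \<le> ereal (S l (V m) x)"
      using t(1) l by (intro upper_semicontinuous assms lim tendsto_const) (auto simp: o_def)
    moreover have "\<forall>\<^sub>F n in sequentially. ereal e \<le> ereal (S ((t \<circ> k) n) (V m) x)"
      using eventually_ge_at_top[of m]
    proof eventually_elim
      case (elim n)
      then have "m \<le> k n"
        using seq_suble[OF k, of n] by linarith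
      have "S (t (k n)) (V (k n)) x \<le> S (t (k n)) (V m) x"
        using t(1)[of "k n"] by (intro semigroup_mono assms(2) mono \<open>m \<le> k n\<close>) auto
      then show ?case
        using t(2)[of "k n"] by simp
    qed
    then have "ereal e \<le> limsup (\<lambda>n. ereal (S ((t \<circ> k) n) (V m) x))"
      by (intro le_Limsup) auto
    ultimately have "ereal e \<le> ereal (S l (V m) x)"
      by (rule order_trans[rotated])
    then show ?thesis
      by simp
  qed
  moreover have "(\<lambda>m. S l (V m) x) \<longlonglongrightarrow> 0"
    using continuous_from_above[OF _ assms(2,3), of l] l by (simp add: decreases_to_zero_def)
  ultimately have "e \<le> 0"
    by (intro LIMSEQ_le_const) auto
  with \<open>0 < e\<close> show False
    by simp
qed

lemma mixed_null_uniformly_small: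
  assumes "0 \<le> T" "mixed_null w" "0 < e"
  shows "\<forall>\<^sub>F n in sequentially. \<forall>t\<in>{0..T}. S t (w n) x < e"
proof -
  obtain R where R: "0 \<le> R" "\<And>m. \<forall>\<^sub>F n in sequentially. \<forall>x. w n x \<le> tail R m x"
    using mixed_null_le_tail[OF assms(2)] by blast
  obtain m where m: "\<And>t. t \<in> {0..T} \<Longrightarrow> S t (tail R m) x < e"
    using decreasing_uniformly_small[OF assms(1) tail_in_C_weighted[OF R(1)] decreases_to_zero_tail[OF R(1)] assms(3)]
    by blast
  from R(2)[of m] show ?thesis
  proof eventually_elim
    case (elim n)
    show ?case
    proof
      fix t assume t: "t \<in> {0..T}"
      have "S t (w n) x \<le> S t (tail R m) x"
        using t elim by (intro semigroup_mono mixed_nullD[OF assms(2)] tail_in_C_weighted R) auto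
      with m[OF t] show "S t (w n) x < e"
        by simp
    qed
  qed
qed

text \<open>A mixed null sequence added to a bounded sequence changes the image little. Smallness is known
only for images of null sequences, so the error is split off by convexity:
\<open>p + w = (1 - \<theta>) (p / (1 - \<theta>)) + \<theta> (w / \<theta>)\<close> with a small fixed \<open>\<theta>\<close>. The first summand
differs from \<open>p\<close> by \<open>O(\<theta>)\<close> in the weighted norm, and \<open>w / \<theta>\<close> is still a null sequence.\<close>

lemma mixed_perturbation:
  assumes T: "0 \<le> T" and L: "lipschitz_constant T r D L" and c: "0 \<le> c" "c < D" and r: "0 \<le> r"
    and q: "\<And>n. q n \<in> C_weighted \<kappa>" "\<And>n x. \<bar>q n x\<bar> \<le> r / \<kappa> x"
    and w: "mixed_null w" and e: "0 < e"
  shows "\<forall>\<^sub>F n in sequentially. \<forall>t\<in>{0..T}. S t (\<lambda>y. q n y + (c / \<kappa> y + w n y)) x \<le> S t (q n) x + c * L / \<kappa> x + e"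
proof -
  have L0: "0 \<le> L"
    using L by (simp add: lipschitz_constant_def)
  obtain C where C: "0 \<le> C" "\<And>t v x. t \<in> {0..T} \<Longrightarrow> v \<in> C_weighted \<kappa> \<Longrightarrow>
      (\<And>y. \<bar>v y\<bar> \<le> r / \<kappa> y) \<Longrightarrow> \<bar>S t v x\<bar> \<le> C / \<kappa> x"
    using semigroup_bound[OF r T] by blast
  define B where "B = 2 * (r + c) * L / \<kappa> x + C / \<kappa> x"
  have B: "0 \<le> B"
    using r c L0 C(1) weight_pos[of x] by (simp add: B_def)
  \<comment> \<open>The second bound on \<open>\<theta>\<close> keeps the step \<open>d\<close> below within \<open>D\<close>; the other two keep the sum of the errors below \<open>e\<close>.\<close>
  define \<theta> where "\<theta> = min (1 / 2) (min ((D - c) / (2 * (r + c) + 1)) (e / (2 * B + 2)))"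
  have \<theta>: "0 < \<theta>" "\<theta> \<le> 1 / 2" "\<theta> * (2 * (r + c)) \<le> D - c" "\<theta> * B \<le> e / 2"
  proof -
    show "0 < \<theta>"
      using r c e B by (simp add: \<theta>_def)
    show "\<theta> \<le> 1 / 2"
      unfolding \<theta>_def by (rule min.cobounded1)
    have "\<theta> * (2 * (r + c)) \<le> (D - c) / (2 * (r + c) + 1) * (2 * (r + c) + 1)"
      using r c by (intro mult_mono) (auto simp: \<theta>_def)
    then show "\<theta> * (2 * (r + c)) \<le> D - c"
      using r c by simp
    have "\<theta> * B \<le> e / (2 * B + 2) * (B + 1)"
      using B e by (intro mult_mono) (auto simp: \<theta>_def)
    also have "\<dots> = e / 2"
      using B by (simp add: field_simps)
    finally show "\<theta> * B \<le> e / 2" .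
  qed
  define d where "d = c + \<theta> * (2 * (r + c))"
  have d: "0 \<le> d" "d \<le> D"
    using \<theta> r c by (auto simp: d_def)
  have "\<forall>\<^sub>F n in sequentially. \<forall>t\<in>{0..T}. S t (\<lambda>y. 1 / \<theta> * w n y) x < e"
    using \<theta>(1) by (intro mixed_null_uniformly_small T e mixed_null_scale w) auto
  then show ?thesis
  proof eventually_elim
    case (elim n)
    show ?case
    proof
      fix t assume t: "t \<in> {0..T}"
      define p where "p = (\<lambda>y. 1 / (1 - \<theta>) * (q n y + c / \<kappa> y))"
      define u where "u = (\<lambda>y. 1 / \<theta> * w n y)"
      have p: "p \<in> C_weighted \<kappa>"
        unfolding p_def by (intro C_weighted_scale C_weighted_add q C_weighted_inverse_weight)
      have u: "u \<in> C_weighted \<kappa>"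
        unfolding u_def by (intro C_weighted_scale mixed_nullD[OF w])
      have "(\<lambda>y. q n y + (c / \<kappa> y + w n y)) = (\<lambda>y. \<theta> * u y + (1 - \<theta>) * p y)"
        using \<theta>(1,2) by (intro ext) (simp add: p_def u_def)
      then have "S t (\<lambda>y. q n y + (c / \<kappa> y + w n y)) x \<le> \<theta> * S t u x + (1 - \<theta>) * S t p x"
        using semigroup_convex[OF _ u p, of t \<theta> x] t \<theta> by simp
      also have "\<dots> \<le> \<theta> * e + (1 - \<theta>) * (S t (q n) x + d * L / \<kappa> x)"
      proof (intro add_mono mult_left_mono)
        show "S t u x \<le> e"
          using elim[rule_format, OF t] unfolding u_def by (rule less_imp_le)
        show "S t p x \<le> S t (q n) x + d * L / \<kappa> x"
        proof (rule lipschitz_constantD[OF L t p q(1) q(2) d])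
          fix y
          have "p y - (q n y + c / \<kappa> y) = \<theta> / (1 - \<theta>) * (q n y + c / \<kappa> y)"
          proof -
            have "1 / (1 - \<theta>) * z - z = \<theta> / (1 - \<theta>) * z" for z
              using \<theta>(2) by (simp add: field_simps)
            then show ?thesis
              unfolding p_def .
          qed
          also have "\<dots> \<le> 2 * \<theta> * (r / \<kappa> y + c / \<kappa> y)"
          proof -
            have "\<theta> / (1 - \<theta>) \<le> 2 * \<theta>"
              using \<theta>(1,2) by (simp add: field_simps)
            moreover have "0 \<le> r / \<kappa> y + c / \<kappa> y"
              using r c weight_pos[of y] by simp
            moreover have "q n y \<le> r / \<kappa> y"
              using q(2)[of n y] by linarith
            ultimately show ?thesis
              using \<theta>(1,2) mult_right_mono[of "\<theta> / (1 - \<theta>)" "2 * \<theta>" "r / \<kappa> y + c / \<kappa> y"]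
                mult_left_mono[of "q n y + c / \<kappa> y" "r / \<kappa> y + c / \<kappa> y" "\<theta> / (1 - \<theta>)"] by auto
          qed
          finally show "p y \<le> q n y + d / \<kappa> y"
            by (simp add: d_def add_divide_distrib algebra_simps)
        qed
      qed (use \<theta> in auto)
      also have "\<dots> \<le> S t (q n) x + c * L / \<kappa> x + e"
      proof -
        have "- (S t (q n) x) \<le> C / \<kappa> x"
          using C(2)[OF t q] by (simp add: abs_le_iff)
        then have "\<theta> * - S t (q n) x \<le> \<theta> * (C / \<kappa> x)"
          using \<theta>(1) by (intro mult_left_mono) auto
        moreover have "(1 - \<theta>) * (d * L / \<kappa> x) \<le> 1 * (d * L / \<kappa> x)"
          using \<theta> d L0 weight_pos[of x] by (intro mult_right_mono) auto
        moreover have "\<theta> * e \<le> 1 / 2 * e"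
          using \<theta> e by (intro mult_right_mono) auto
        moreover have "d * L / \<kappa> x + \<theta> * (C / \<kappa> x) = c * L / \<kappa> x + \<theta> * B"
          by (simp add: d_def B_def algebra_simps add_divide_distrib)
        ultimately show ?thesis
          using \<theta>(4) by (simp add: algebra_simps)
      qed
      finally show "S t (\<lambda>y. q n y + (c / \<kappa> y + w n y)) x \<le> S t (q n) x + c * L / \<kappa> x + e" .
    qed
  qed
qed

text \<open>By convexity the increment over a step \<open>h \<le> 1\<close> is at most \<open>h\<close> times the increment over a full
step, and a full step is covered by the preceding lemma.\<close>

lemma first_order_perturbation:
  assumes T: "0 \<le> T" and L: "lipschitz_constant T r D L" and c: "0 \<le> c" "c < D" and r: "0 \<le> r"
    and q: "\<And>n. q n \<in> C_weighted \<kappa>" "\<And>n x. \<bar>q n x\<bar> \<le> r / \<kappa> x"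
    and w: "mixed_null w" and e: "0 < e"
    and h: "\<And>n. 0 \<le> h n" "h \<longlonglongrightarrow> 0" and t: "\<And>n. t n \<in> {0..T}"
  shows "\<forall>\<^sub>F n in sequentially. S (t n) (\<lambda>y. q n y + h n * (c / \<kappa> y + w n y)) x
      \<le> S (t n) (q n) x + h n * (c * L / \<kappa> x + e)"
proof -
  have "\<forall>\<^sub>F n in sequentially. h n < 1"
    using h(2) by (rule order_tendstoD) simp
  moreover have "\<forall>\<^sub>F n in sequentially. \<forall>t\<in>{0..T}. S t (\<lambda>y. q n y + (c / \<kappa> y + w n y)) x
      \<le> S t (q n) x + c * L / \<kappa> x + e"
    by (rule mixed_perturbation[OF T L c r q w e])
  ultimately show ?thesis
  proof eventually_elim
    case (elim n)
    let ?p = "\<lambda>y. q n y + (c / \<kappa> y + w n y)"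
    have p: "?p \<in> C_weighted \<kappa>"
      by (intro C_weighted_add q C_weighted_inverse_weight mixed_nullD[OF w])
    have "(\<lambda>y. q n y + h n * (c / \<kappa> y + w n y)) = (\<lambda>y. h n * ?p y + (1 - h n) * q n y)"
      by (simp add: algebra_simps)
    then have "S (t n) (\<lambda>y. q n y + h n * (c / \<kappa> y + w n y)) x \<le> h n * S (t n) ?p x + (1 - h n) * S (t n) (q n) x"
      using semigroup_convex[OF _ p q(1), of "t n" "h n" n x] t[of n] h(1)[of n] elim(1) by simp
    also have "\<dots> \<le> h n * (S (t n) (q n) x + c * L / \<kappa> x + e) + (1 - h n) * S (t n) (q n) x"
      using elim(2) t[of n] h(1)[of n] by (intro add_right_mono mult_left_mono) auto
    finally show ?case
      by (simp add: algebra_simps)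
  qed
qed

end

section \<open>Real induction along a closed set of times\<close>

text \<open>A mean value inequality for a function that is controlled only on a closed set \<open>E\<close>: its lower
right growth rate is at least \<open>- c\<close> at points of \<open>E\<close>, and it loses at most \<open>M\<close> per unit of time across
a gap of \<open>E\<close>. The total loss in the gaps is governed by the measure of the complement. The last
point of \<open>E\<close> at which the estimate holds exists because \<open>\<phi>\<close> does not jump down at a point of \<open>E\<close>
that is approached from the left within \<open>E\<close>. It can be pushed further to the right, either across a gap or to a
nearby point of \<open>E\<close>, unless it is \<open>b\<close>.\<close>

lemma growth_on_closed_set:
  fixes \<phi> :: "real \<Rightarrow> real" and E :: "real set"
  assumes E: "closed E" "E \<subseteq> {a..b}" "a \<in> E" "b \<in> E" and c: "0 \<le> c" and M: "0 \<le> M"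
    and left: "\<And>s e. s \<in> E \<Longrightarrow> 0 < e \<Longrightarrow> \<exists>\<delta>>0. \<forall>u\<in>E. s - \<delta> < u \<and> u < s \<longrightarrow> \<phi> u \<le> \<phi> s + e"
    and gap: "\<And>u s. u \<in> E \<Longrightarrow> s \<in> E \<Longrightarrow> u < s \<Longrightarrow> {u<..<s} \<inter> E = {} \<Longrightarrow> \<phi> u \<le> \<phi> s + M * (s - u)"
    and right: "\<And>s e. s \<in> E \<Longrightarrow> s < b \<Longrightarrow> 0 < e \<Longrightarrow>
        \<exists>\<delta>>0. \<forall>u\<in>E. s < u \<and> u < s + \<delta> \<longrightarrow> \<phi> s \<le> \<phi> u + (c + e) * (u - s)"
  shows "\<phi> a \<le> \<phi> b + c * (b - a) + M * measure lborel ({a..b} - E)"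
proof -
  define m where "m s = measure lborel ({a..s} - E)" for s
  have fin: "{a..s} - E \<in> fmeasurable lborel" for s
  proof (rule fmeasurable_Diff)
    show "{a..s} \<in> fmeasurable lborel"
      using fmeasurable_cbox[of a s] by (simp add: cbox_interval)
    show "E \<in> sets lborel"
      using E(1) by simp
  qed
  have m_mono: "m u \<le> m s" if "u \<le> s" for u s
    unfolding m_def using that by (intro measure_mono_fmeasurable fmeasurableD fin) auto
  have m_gap: "m u + (s - u) \<le> m s" if us: "u \<in> E" "u < s" "{u<..<s} \<inter> E = {}" for u s
  proof -
    have "m u + (s - u) = measure lborel (({a..u} - E) \<union> {u<..<s})"
    proof -
      have "{u<..<s} \<in> fmeasurable lborel"
        using fmeasurable_box[of u s] by (simp add: box_real)
      then have "measure lborel (({a..u} - E) \<union> {u<..<s}) = m u + measure lborel {u<..<s}"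
        unfolding m_def using fin[of u] by (intro measure_Union) (auto dest: fmeasurableD2 fmeasurableD)
      then show ?thesis
        using us(2) by simp
    qed
    also have "\<dots> \<le> m s"
      unfolding m_def using us E(2) fmeasurableD[OF fin[of u]]
      by (intro measure_mono_fmeasurable fin) auto
    finally show ?thesis .
  qed
  have "\<phi> a \<le> \<phi> b + (c + e) * (b - a) + M * m b" if e: "0 < e" for e
  proof -
    define P where "P = {s \<in> E. \<phi> a \<le> \<phi> s + (c + e) * (s - a) + M * m s}"
    have ab: "a \<le> b"
      using E(2,3) by auto
    have "a \<in> P"
      using E(3) M by (simp add: P_def m_def)
    have P_E: "P \<subseteq> E"
      by (auto simp: P_def)
    then have P_bdd: "bdd_above P"
      using E(2) by (meson bdd_above_Icc bdd_above_mono order_trans)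
    define \<sigma> where "\<sigma> = Sup P"
    have upper: "s \<le> \<sigma>" if "s \<in> P" for s
      unfolding \<sigma>_def using that P_bdd by (rule cSup_upper)
    have "\<sigma> \<in> closure P"
      unfolding \<sigma>_def using \<open>a \<in> P\<close> P_bdd by (intro closure_contains_Sup) auto
    then have "\<sigma> \<in> E"
      using closure_minimal[OF P_E E(1)] by blast
    have "\<sigma> \<in> P"
    proof -
      have "\<phi> a \<le> (\<phi> \<sigma> + (c + e) * (\<sigma> - a) + M * m \<sigma>) + d" if d: "0 < d" for d
      proof -
        obtain \<delta> where \<delta>: "0 < \<delta>" "\<And>u. u \<in> E \<Longrightarrow> \<sigma> - \<delta> < u \<Longrightarrow> u < \<sigma> \<Longrightarrow> \<phi> u \<le> \<phi> \<sigma> + d"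
          using left[OF \<open>\<sigma> \<in> E\<close> d] by auto
        obtain u where u: "u \<in> P" "\<sigma> - \<delta> < u"
          using less_cSupD[of P "\<sigma> - \<delta>"] \<open>a \<in> P\<close> \<delta>(1) unfolding \<sigma>_def by fastforce
        have "u \<le> \<sigma>"
          using upper u(1) .
        then have "\<phi> u \<le> \<phi> \<sigma> + d"
          using \<delta>(2)[of u] u P_E d by (cases "u = \<sigma>") auto
        moreover have "(c + e) * (u - a) \<le> (c + e) * (\<sigma> - a)" "M * m u \<le> M * m \<sigma>"
          using \<open>u \<le> \<sigma>\<close> c e M m_mono by (auto intro!: mult_left_mono)
        moreover have "\<phi> a \<le> \<phi> u + (c + e) * (u - a) + M * m u"
          using u(1) by (simp add: P_def)
        ultimately show ?thesis
          by linarith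
      qed
      then have "\<phi> a \<le> \<phi> \<sigma> + (c + e) * (\<sigma> - a) + M * m \<sigma>"
        by (rule field_le_epsilon)
      with \<open>\<sigma> \<in> E\<close> show ?thesis
        by (simp add: P_def)
    qed
    then have P\<sigma>: "\<phi> a \<le> \<phi> \<sigma> + (c + e) * (\<sigma> - a) + M * m \<sigma>"
      by (simp add: P_def)
    have "\<sigma> = b"
    proof (rule ccontr)
      assume "\<sigma> \<noteq> b"
      then have "\<sigma> < b"
        using \<open>\<sigma> \<in> E\<close> E(2) by fastforce
      obtain \<delta> where \<delta>: "0 < \<delta>" "\<And>u. u \<in> E \<Longrightarrow> \<sigma> < u \<Longrightarrow> u < \<sigma> + \<delta> \<Longrightarrow> \<phi> \<sigma> \<le> \<phi> u + (c + e) * (u - \<sigma>)"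
        using right[OF \<open>\<sigma> \<in> E\<close> \<open>\<sigma> < b\<close> e] by auto
      show False
      proof (cases "\<exists>u\<in>E. \<sigma> < u \<and> u < \<sigma> + \<delta>")
        case True
        then obtain u where u: "u \<in> E" "\<sigma> < u" "u < \<sigma> + \<delta>"
          by blast
        have "\<phi> \<sigma> \<le> \<phi> u + (c + e) * (u - \<sigma>)"
          using \<delta>(2) u by blast
        moreover have "M * m \<sigma> \<le> M * m u"
          using u(2) M m_mono by (auto intro!: mult_left_mono)
        ultimately have "\<phi> a \<le> \<phi> u + (c + e) * (u - a) + M * m u"
          using P\<sigma> by (simp add: algebra_simps)
        then have "u \<in> P"
          using u(1) by (simp add: P_def)
        then show False
          using upper[of u] u(2) by simp
      next
        case False
        \<comment> \<open>No point of \<open>E\<close> follows closely, so \<open>\<sigma>\<close> is the left end of a gap; its right end is the infimum of \<open>F\<close>.\<close>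
        define F where "F = E \<inter> {\<sigma> + \<delta>..}"
        define u where "u = Inf F"
        have "b \<in> F"
          using False \<open>\<sigma> < b\<close> E(4) by (auto simp: F_def not_less)
        have F_bdd: "bdd_below F"
          unfolding F_def by (meson bdd_below_Ici bdd_below_Int2)
        have "closed F"
          unfolding F_def using E(1) by (intro closed_Int) auto
        then have "u \<in> F"
          unfolding u_def using \<open>b \<in> F\<close> F_bdd closed_contains_Inf by blast
        then have u: "u \<in> E" "\<sigma> < u"
          using \<delta>(1) by (auto simp: F_def)
        have no: "{\<sigma><..<u} \<inter> E = {}"
        proof -
          have "s \<notin> E" if "\<sigma> < s" "s < u" for s
          proof
            assume "s \<in> E"
            with False that(1) have "s \<in> F"
              by (auto simp: F_def not_less)
            then have "u \<le> s"
              unfolding u_def using F_bdd by (rule cInf_lower)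
            with that(2) show False
              by simp
          qed
          then show ?thesis
            by auto
        qed
        have "\<phi> \<sigma> \<le> \<phi> u + M * (u - \<sigma>)"
          using gap[OF \<open>\<sigma> \<in> E\<close> u no] .
        moreover have "M * (m \<sigma> + (u - \<sigma>)) \<le> M * m u"
          using m_gap[OF \<open>\<sigma> \<in> E\<close> u(2) no] M by (rule mult_left_mono)
        moreover have "(c + e) * (\<sigma> - a) \<le> (c + e) * (u - a)"
          using u(2) c e by (intro mult_left_mono) auto
        ultimately have "\<phi> a \<le> \<phi> u + (c + e) * (u - a) + M * m u"
          using P\<sigma> by (simp add: distrib_left)
        then have "u \<in> P"
          using u(1) by (simp add: P_def)
        then show False
          using upper[of u] u(2) by simp
      qed
    qed
    then show ?thesis
      using P\<sigma> by simp
  qed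
  note main = this
  have ab: "a \<le> b"
    using E(2,3) by auto
  have "\<phi> a \<le> (\<phi> b + c * (b - a) + M * m b) + d" if d: "0 < d" for d
  proof -
    define e where "e = d / (b - a + 1)"
    have e: "0 < e" "e * (b - a) \<le> d"
      using d ab by (auto simp: e_def field_simps)
    then show ?thesis
      using main[OF e(1)] by (simp add: distrib_right)
  qed
  then show ?thesis
    unfolding m_def by (rule field_le_epsilon)
qed

section \<open>Generators and Lipschitz sets\<close>

context weighted_semigroup
begin

lemma generator_remainder:
  assumes v: "v \<in> C_weighted \<kappa>" and g: "is_generator_limit \<kappa> S v g" and h: "\<And>n. 0 < h n" "h \<longlonglongrightarrow> 0"
  obtains w where "mixed_null w" "\<And>n x. \<bar>S (h n) v x - v x - h n * g x\<bar> = h n * w n x"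
proof -
  define f where "f = (\<lambda>n x. (S (h n) v x - v x) / h n)"
  define w where "w = (\<lambda>n x. \<bar>f n x + -1 * g x\<bar>)"
  have mixed: "mixed_limit \<kappa> f g"
    unfolding f_def by (rule generator_limit_sequence[OF g h])
  have gC: "g \<in> C_weighted \<kappa>"
    using g by (simp add: is_generator_limit_def)
  have fC: "f n \<in> C_weighted \<kappa>" for n
  proof -
    have "(\<lambda>x. (1 / h n) * (S (h n) v x + -1 * v x)) \<in> C_weighted \<kappa>"
      using h(1)[of n] by (intro C_weighted_scale C_weighted_add maps_into v) simp
    then show ?thesis
      by (simp add: f_def)
  qed
  have "(SUP n. wnorm \<kappa> (f n)) < \<infinity>"
    using mixed by (simp add: mixed_limit_def)
  then obtain Q where Q: "0 \<le> Q" "(SUP n. wnorm \<kappa> (f n)) = ennreal Q"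
    by (cases "SUP n. wnorm \<kappa> (f n)") auto
  have fQ: "\<bar>f n x\<bar> \<le> Q / \<kappa> x" for n x
  proof -
    have "wnorm \<kappa> (f n) \<le> ennreal Q"
      unfolding Q(2)[symmetric] by (rule SUP_upper) simp
    then show ?thesis
      using wnorm_le_iff[OF Q(1)] by simp
  qed
  obtain G where G: "\<And>x. \<bar>g x\<bar> \<le> G / \<kappa> x"
    using C_weighted_bound[OF gC] by blast
  have "mixed_null w"
  proof (rule mixed_nullI)
    show "w n \<in> C_weighted \<kappa>" for n
      unfolding w_def by (intro C_weighted_abs C_weighted_add C_weighted_scale fC gC)
    show "0 \<le> w n x" for n x
      by (simp add: w_def)
    show "w n x \<le> (Q + G) / \<kappa> x" for n x
      using fQ[of n x] G[of x] unfolding w_def add_divide_distrib by linarith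
    show "uniform_limit K w (\<lambda>_. 0) sequentially" if "compact K" for K
    proof -
      have "uniform_limit K f g sequentially"
        using mixed that by (simp add: mixed_limit_def)
      then show ?thesis
        unfolding uniform_limit_iff w_def by (simp add: dist_real_def)
    qed
  qed
  moreover have "\<bar>S (h n) v x - v x - h n * g x\<bar> = h n * w n x" for n x
  proof -
    have "S (h n) v x - v x - h n * g x = h n * (f n x + -1 * g x)"
      using h(1)[of n] by (simp add: f_def field_simps)
    then show ?thesis
      using h(1)[of n] by (simp add: w_def abs_mult)
  qed
  ultimately show thesis
    by (rule that)
qed

text \<open>An upper bound \<open>C / \<kappa>\<close> on the generator at \<open>v\<close> bounds the growth of the orbit of \<open>v\<close> with the rate
\<open>C L\<close>, whatever the speed at which the difference quotients converge. The proof integrates the bound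
on the right derivative of \<open>s \<mapsto> S (u + k - s) v x\<close>.\<close>

lemma semigroup_growth:
  assumes v: "v \<in> C_weighted \<kappa>" "\<And>x. \<bar>v x\<bar> \<le> r / \<kappa> x" and g: "is_generator_limit \<kappa> S v g"
    and gC: "\<And>y. g y \<le> C / \<kappa> y" and C: "0 \<le> C" "C < D" and r: "0 \<le> r"
    and L: "lipschitz_constant T r D L" and u: "0 \<le> u" and k: "0 \<le> k" and uk: "u + k \<le> T"
  shows "S (u + k) v x \<le> S u v x + C * L / \<kappa> x * k"
proof -
  define A where "A = C * L / \<kappa> x"
  have A: "0 \<le> A"
    using C L weight_pos[of x] by (simp add: A_def lipschitz_constant_def)
  have T: "0 \<le> T"
    using u k uk by linarith
  have small: "\<exists>\<delta>>0. \<forall>t h. 0 \<le> t \<longrightarrow> 0 < h \<longrightarrow> h < \<delta> \<longrightarrow> t + h \<le> T \<longrightarrow> S (t + h) v x \<le> S t v x + h * (A + e)"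
    if e: "0 < e" for e
  proof (rule ccontr)
    assume contra: "\<not> ?thesis"
    have "\<exists>t h. 0 \<le> t \<and> 0 < h \<and> h < 1 / real (Suc n) \<and> t + h \<le> T \<and> \<not> S (t + h) v x \<le> S t v x + h * (A + e)" for n
    proof -
      have "0 < 1 / real (Suc n)"
        by simp
      with contra show ?thesis
        by blast
    qed
    then obtain t h where th: "\<And>n. 0 \<le> t n" "\<And>n. 0 < h n" "\<And>n. h n < 1 / real (Suc n)" "\<And>n. t n + h n \<le> T"
      and bad: "\<And>n. \<not> S (t n + h n) v x \<le> S (t n) v x + h n * (A + e)"
      by metis
    have h0: "h \<longlonglongrightarrow> 0"
    proof (rule tendsto_sandwich[OF _ _ tendsto_const])
      show "(\<lambda>n. 1 / real (Suc n)) \<longlonglongrightarrow> 0"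
        using LIMSEQ_inverse_real_of_nat by (simp add: inverse_eq_divide)
    qed (use th(2,3) in \<open>auto intro!: always_eventually less_imp_le\<close>)
    obtain w where w: "mixed_null w" "\<And>n y. \<bar>S (h n) v y - v y - h n * g y\<bar> = h n * w n y"
      using generator_remainder[OF v(1) g th(2) h0] by blast
    have tT: "t n \<in> {0..T}" for n
      using th(1)[of n] th(2)[of n] th(4)[of n] by simp
    have "\<forall>\<^sub>F n in sequentially. S (t n) (\<lambda>y. v y + h n * (C / \<kappa> y + w n y)) x \<le> S (t n) v x + h n * (C * L / \<kappa> x + e)"
      using th(2) by (intro first_order_perturbation[OF T L C r v w(1) e _ h0 tT]) (simp add: less_imp_le)
    then obtain n where n: "S (t n) (\<lambda>y. v y + h n * (C / \<kappa> y + w n y)) x \<le> S (t n) v x + h n * (A + e)"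
      unfolding A_def eventually_sequentially by blast
    have "S (t n + h n) v x = S (t n) (S (h n) v) x"
      using semigroup[of "t n" "h n" v] th(1,2)[of n] v(1) by simp
    also have "\<dots> \<le> S (t n) (\<lambda>y. v y + h n * (C / \<kappa> y + w n y)) x"
    proof (rule semigroup_mono)
      show "S (h n) v \<in> C_weighted \<kappa>"
        using th(2)[of n] v(1) by (intro maps_into) auto
      show "(\<lambda>y. v y + h n * (C / \<kappa> y + w n y)) \<in> C_weighted \<kappa>"
        by (intro C_weighted_add C_weighted_scale v C_weighted_inverse_weight mixed_nullD[OF w(1)])
      show "S (h n) v y \<le> v y + h n * (C / \<kappa> y + w n y)" for y
      proof -
        have "h n * g y \<le> h n * (C / \<kappa> y)"
          using gC[of y] th(2)[of n] by (intro mult_left_mono) auto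
        moreover have "S (h n) v y - v y - h n * g y \<le> h n * w n y"
          using w(2)[of n y] by linarith
        ultimately show ?thesis
          unfolding distrib_left by linarith
      qed
    qed (rule th(1))
    finally show False
      using n bad[of n] by linarith
  qed
  define \<phi> where "\<phi> s = S (u + k - s) v x" for s
  have step: "\<exists>\<delta>>0. \<forall>s s'. 0 \<le> s \<longrightarrow> s < s' \<longrightarrow> s' < s + \<delta> \<longrightarrow> s' \<le> k \<longrightarrow> \<phi> s \<le> \<phi> s' + (A + e) * (s' - s)"
    if e: "0 < e" for e
  proof -
    obtain \<delta> where \<delta>: "0 < \<delta>" "\<And>t h. 0 \<le> t \<Longrightarrow> 0 < h \<Longrightarrow> h < \<delta> \<Longrightarrow> t + h \<le> T \<Longrightarrow> S (t + h) v x \<le> S t v x + h * (A + e)"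
      using small[OF e] by blast
    have "\<phi> s \<le> \<phi> s' + (A + e) * (s' - s)" if "0 \<le> s" "s < s'" "s' < s + \<delta>" "s' \<le> k" for s s'
    proof -
      have "S (u + k - s' + (s' - s)) v x \<le> S (u + k - s') v x + (s' - s) * (A + e)"
        using that u uk by (intro \<delta>(2)) auto
      moreover have "u + k - s' + (s' - s) = u + k - s"
        by simp
      ultimately show ?thesis
        by (simp only: \<phi>_def mult.commute)
    qed
    with \<delta>(1) show ?thesis
      by blast
  qed
  have "\<phi> 0 \<le> \<phi> k + A * (k - 0) + 0 * measure lborel ({0..k} - {0..k})"
  proof (rule growth_on_closed_set)
    fix s e :: real assume s: "s \<in> {0..k}" and e: "0 < e"
    obtain \<delta> where \<delta>: "0 < \<delta>" "\<And>s s'. 0 \<le> s \<Longrightarrow> s < s' \<Longrightarrow> s' < s + \<delta> \<Longrightarrow> s' \<le> k \<Longrightarrow> \<phi> s \<le> \<phi> s' + (A + e) * (s' - s)"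
      using step[OF e] by blast
    have "\<phi> q \<le> \<phi> s + e" if "0 \<le> q" "s - min \<delta> (e / (A + e)) < q" "q < s" for q
    proof -
      have "\<phi> q \<le> \<phi> s + (A + e) * (s - q)"
        using \<delta>(2)[of q s] that s by simp
      also have "(A + e) * (s - q) \<le> (A + e) * (e / (A + e))"
        using that A e by (intro mult_left_mono) auto
      also have "(A + e) * (e / (A + e)) = e"
        using A e by simp
      finally show ?thesis
        by simp
    qed
    moreover have "0 < min \<delta> (e / (A + e))"
      using \<delta>(1) A e by simp
    ultimately show "\<exists>\<delta>>0. \<forall>q\<in>{0..k}. s - \<delta> < q \<and> q < s \<longrightarrow> \<phi> q \<le> \<phi> s + e"
      by (intro exI[of _ "min \<delta> (e / (A + e))"]) simp
    show "\<exists>\<delta>>0. \<forall>q\<in>{0..k}. s < q \<and> q < s + \<delta> \<longrightarrow> \<phi> s \<le> \<phi> q + (A + e) * (q - s)"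
      using \<delta>(1) \<delta>(2)[of s] s by (intro exI[of _ \<delta>]) simp
  next
    fix p q assume pq: "p \<in> {0..k}" "q \<in> {0..k}" "p < q" and empty: "{p<..<q} \<inter> {0..k} = {}"
    have "(p + q) / 2 \<in> {p<..<q} \<inter> {0..k}"
      using pq by auto
    then show "\<phi> p \<le> \<phi> q + 0 * (q - p)"
      unfolding empty by simp
  qed (use k A in auto)
  then show ?thesis
    by (simp add: \<phi>_def A_def)
qed

lemma convex_combination:
  assumes t: "0 \<le> t" and I: "finite I" "\<And>i. i \<in> I \<Longrightarrow> 0 \<le> a i" "sum a I = 1"
    and f: "\<And>i. i \<in> I \<Longrightarrow> f i \<in> C_weighted \<kappa>"
  shows "S t (\<lambda>y. \<Sum>i\<in>I. a i * f i y) x \<le> (\<Sum>i\<in>I. a i * S t (f i) x)"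
    and "(\<lambda>y. \<Sum>i\<in>I. a i * f i y) \<in> C_weighted \<kappa>"
proof -
  have zero: "(\<lambda>_. 0) \<in> C_weighted \<kappa>"
    by (rule bounded_in_C_weighted) auto
  have sum_C: "(\<lambda>y. \<Sum>i\<in>J. b i * f i y) \<in> C_weighted \<kappa>" if "finite J" "J \<subseteq> I" for J and b :: "_ \<Rightarrow> real"
    using that by induction (auto intro!: zero C_weighted_add C_weighted_scale f)
  show "(\<lambda>y. \<Sum>i\<in>I. a i * f i y) \<in> C_weighted \<kappa>"
    by (rule sum_C[OF I(1) subset_refl])
  have "S t (\<lambda>y. \<Sum>i\<in>J. b i * f i y) x \<le> (\<Sum>i\<in>J. b i * S t (f i) x)"
    if "finite J" "J \<subseteq> I" "\<And>i. i \<in> J \<Longrightarrow> 0 \<le> b i" "sum b J = 1" for J and b :: "_ \<Rightarrow> real"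
    using that
  proof (induction J arbitrary: b)
    case empty
    then show ?case by simp
  next
    case (insert j J)
    show ?case
    proof (cases "b j = 1")
      case True
      then have "sum b J = 0"
        using insert by simp
      then have "b i = 0" if "i \<in> J" for i
        using sum_nonneg_eq_0_iff[of J b] insert that by auto
      then show ?thesis
        using insert True by simp
    next
      case False
      have bj: "0 \<le> b j" "b j \<le> 1"
        using insert sum_nonneg[of J b] by auto
      with False have pos: "0 < 1 - b j"
        by simp
      define d where "d i = b i / (1 - b j)" for i
      have "sum d J = 1"
        using insert pos by (simp add: d_def flip: sum_divide_distrib)
      then have IH: "S t (\<lambda>y. \<Sum>i\<in>J. d i * f i y) x \<le> (\<Sum>i\<in>J. d i * S t (f i) x)"
        using insert pos by (intro insert.IH) (auto simp: d_def)
      have split: "(\<Sum>i\<in>insert j J. b i * F i) = b j * F j + (1 - b j) * (\<Sum>i\<in>J. d i * F i)" for F :: "_ \<Rightarrow> real"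
        using insert pos by (simp add: d_def sum_distrib_left)
      have "S t (\<lambda>y. \<Sum>i\<in>insert j J. b i * f i y) x \<le> b j * S t (f j) x + (1 - b j) * S t (\<lambda>y. \<Sum>i\<in>J. d i * f i y) x"
        unfolding split using insert bj t by (intro semigroup_convex f sum_C) auto
      also have "\<dots> \<le> b j * S t (f j) x + (1 - b j) * (\<Sum>i\<in>J. d i * S t (f i) x)"
        using IH pos by (intro add_left_mono mult_left_mono) auto
      finally show ?thesis
        unfolding split .
    qed
  qed
  from this[OF I(1) subset_refl I(2,3)]
  show "S t (\<lambda>y. \<Sum>i\<in>I. a i * f i y) x \<le> (\<Sum>i\<in>I. a i * S t (f i) x)" .
qed

lemma lipschitz_constant_abs:
  assumes "lipschitz_constant T r D L" "t \<in> {0..T}" "v \<in> C_weighted \<kappa>" "w \<in> C_weighted \<kappa>"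
    "\<And>x. \<bar>v x\<bar> \<le> r / \<kappa> x" "\<And>x. \<bar>w x\<bar> \<le> r / \<kappa> x" "0 \<le> d" "d \<le> D" "\<And>x. \<bar>v x - w x\<bar> \<le> d / \<kappa> x"
  shows "\<bar>S t v x - S t w x\<bar> \<le> d * L / \<kappa> x"
proof -
  have "v y \<le> w y + d / \<kappa> y" "w y \<le> v y + d / \<kappa> y" for y
    using assms(9)[of y] by linarith+
  then have "S t v x \<le> S t w x + d * L / \<kappa> x" "S t w x \<le> S t v x + d * L / \<kappa> x"
    using assms by (auto intro: lipschitz_constantD)
  then show ?thesis
    by linarith
qed

lemma Lipschitz_setI:
  assumes "f \<in> C_weighted \<kappa>" "0 < h0" "0 \<le> C" "\<And>h x. 0 < h \<Longrightarrow> h < h0 \<Longrightarrow> \<bar>S h f x - f x\<bar> \<le> C * h / \<kappa> x"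
  shows "f \<in> Lipschitz_set \<kappa> S"
proof -
  have "\<forall>\<^sub>F h in at_right 0. wnorm \<kappa> (\<lambda>x. (S h f x - f x) / h) \<le> ennreal C"
    using eventually_at_right_less[of 0] eventually_at_right_real[OF assms(2)]
  proof eventually_elim
    case (elim h)
    have "\<bar>(S h f x - f x) / h\<bar> \<le> C / \<kappa> x" for x
      using assms(4)[of h x] elim by (simp add: abs_divide pos_divide_le_eq)
    then show ?case
      using wnorm_le_iff[OF assms(3)] by simp
  qed
  then have "Limsup (at_right 0) (\<lambda>h. wnorm \<kappa> (\<lambda>x. (S h f x - f x) / h)) \<le> ennreal C"
    by (rule Limsup_bounded)
  also have "\<dots> < \<infinity>"
    by simp
  finally show ?thesis
    using assms(1) by (simp add: Lipschitz_set_def)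
qed

lemma Lipschitz_setD:
  assumes "f \<in> Lipschitz_set \<kappa> S"
  shows "\<exists>C\<ge>0. \<exists>h0>0. \<forall>h x. 0 < h \<longrightarrow> h < h0 \<longrightarrow> \<bar>S h f x - f x\<bar> \<le> C * h / \<kappa> x"
proof -
  have "Limsup (at_right 0) (\<lambda>h. wnorm \<kappa> (\<lambda>x. (S h f x - f x) / h)) < top"
    using assms by (simp add: Lipschitz_set_def infinity_ennreal_def)
  then obtain B where B: "Limsup (at_right 0) (\<lambda>h. wnorm \<kappa> (\<lambda>x. (S h f x - f x) / h)) < B" "B < top"
    using dense by blast
  obtain C where C: "0 \<le> C" "B = ennreal C"
    using B(2) by (cases B) auto
  have "\<forall>\<^sub>F h in at_right 0. wnorm \<kappa> (\<lambda>x. (S h f x - f x) / h) < B"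
    using B(1) by (rule Limsup_lessD)
  then obtain h0 where h0: "0 < h0" "\<And>h. 0 < h \<Longrightarrow> h < h0 \<Longrightarrow> wnorm \<kappa> (\<lambda>x. (S h f x - f x) / h) < B"
    unfolding eventually_at_right_field by auto
  have "\<bar>S h f x - f x\<bar> \<le> C * h / \<kappa> x" if "0 < h" "h < h0" for h x
  proof -
    have "wnorm \<kappa> (\<lambda>x. (S h f x - f x) / h) \<le> ennreal C"
      using h0(2)[OF that] C(2) by simp
    then have "\<bar>(S h f x - f x) / h\<bar> \<le> C / \<kappa> x"
      using wnorm_le_iff[OF C(1)] by simp
    then show ?thesis
      using that(1) by (simp add: abs_divide pos_divide_le_eq)
  qed
  with C(1) h0(1) show ?thesis
    by blast
qed

text \<open>Difference quotients at time zero are controlled for small steps by the Lipschitz set and for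
large steps by boundedness of the orbit; the semigroup law and the local Lipschitz estimate carry
the control to later times.\<close>

lemma orbit_lipschitz:
  assumes f: "f \<in> Lipschitz_set \<kappa> S" and T: "0 \<le> T"
  shows "\<exists>C\<ge>0. \<forall>s\<in>{0..T}. \<forall>u\<in>{0..T}. \<forall>x. \<bar>S s f x - S u f x\<bar> \<le> C * \<bar>s - u\<bar> / \<kappa> x"
proof -
  have fC: "f \<in> C_weighted \<kappa>"
    using f by (simp add: Lipschitz_set_def)
  obtain r where r: "0 \<le> r" "\<And>x. \<bar>f x\<bar> \<le> r / \<kappa> x"
    using C_weighted_bound[OF fC] by blast
  obtain R where R0: "0 \<le> R" "\<And>t v x. t \<in> {0..T} \<Longrightarrow> v \<in> C_weighted \<kappa> \<Longrightarrow>
      (\<And>y. \<bar>v y\<bar> \<le> r / \<kappa> y) \<Longrightarrow> \<bar>S t v x\<bar> \<le> R / \<kappa> x"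
    using semigroup_bound[OF r(1) T] by blast
  note R = R0(1) R0(2)[OF _ fC r(2)]
  obtain C h0 where C: "0 \<le> C" "0 < h0" "\<And>h x. 0 < h \<Longrightarrow> h < h0 \<Longrightarrow> \<bar>S h f x - f x\<bar> \<le> C * h / \<kappa> x"
    using Lipschitz_setD[OF f] by blast
  \<comment> \<open>The second summand handles steps \<open>h \<ge> h0\<close>, for which \<open>R + r \<le> (R + r) / h0 * h\<close>.\<close>
  define A where "A = C + (R + r) / h0"
  have A: "0 \<le> A"
    using C R(1) r(1) by (simp add: A_def)
  have start: "\<bar>S h f x - f x\<bar> \<le> A * h / \<kappa> x" if h: "h \<in> {0..T}" for h x
  proof -
    consider "h = 0" | "0 < h" "h < h0" | "h0 \<le> h"
      using h by force
    then show ?thesis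
    proof cases
      case 1
      then show ?thesis
        using at_zero[OF fC] by simp
    next
      case 2
      have "C * h / \<kappa> x \<le> A * h / \<kappa> x"
        using 2 C(2) R(1) r(1) weight_pos[of x] by (intro divide_right_mono mult_right_mono) (auto simp: A_def)
      then show ?thesis
        using C(3)[OF 2, of x] by linarith
    next
      case 3
      have "R + r \<le> (R + r) / h0 * h"
      proof -
        have "(R + r) * 1 \<le> (R + r) * (h / h0)"
          using 3 C(2) R(1) r(1) by (intro mult_left_mono) auto
        then show ?thesis
          by simp
      qed
      also have "\<dots> \<le> A * h"
        using 3 C by (intro mult_right_mono) (auto simp: A_def)
      finally have "(R + r) / \<kappa> x \<le> A * h / \<kappa> x"
        using weight_pos[of x] by (intro divide_right_mono) auto
      moreover have "\<bar>S h f x - f x\<bar> \<le> (R + r) / \<kappa> x"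
        using R(2)[OF h, of x] r(2)[of x] by (simp add: add_divide_distrib)
      ultimately show ?thesis
        by linarith
    qed
  qed
  obtain L where L: "lipschitz_constant T (R + r) (A * T + 1) L"
    by (rule lipschitz_constant_exists[of T "R + r" "A * T + 1"]) (use T R(1) r(1) A in \<open>auto intro!: add_nonneg_pos\<close>)
  have L0: "0 \<le> L"
    using L by (simp add: lipschitz_constant_def)
  have later: "\<bar>S s f x - S u f x\<bar> \<le> A * L * \<bar>s - u\<bar> / \<kappa> x" if s: "s \<in> {0..T}" "u \<in> {0..T}" "u \<le> s" for s u x
  proof -
    define h where "h = s - u"
    have h: "h \<in> {0..T}" "s = u + h" "0 \<le> h"
      using s by (auto simp: h_def)
    have "A * h \<le> A * T"
      using h A by (intro mult_left_mono) auto
    have frac: "R / \<kappa> y \<le> (R + r) / \<kappa> y" "r / \<kappa> y \<le> (R + r) / \<kappa> y" for y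
      using R(1) r(1) weight_pos[of y] by (auto intro!: divide_right_mono)
    have "\<bar>S u (S h f) x - S u f x\<bar> \<le> A * h * L / \<kappa> x"
    proof (rule lipschitz_constant_abs[OF L s(2)])
      show "S h f \<in> C_weighted \<kappa>"
        using h(3) fC by (rule maps_into)
      show "\<bar>S h f y\<bar> \<le> (R + r) / \<kappa> y" "\<bar>f y\<bar> \<le> (R + r) / \<kappa> y" for y
        using R(2)[OF h(1), of y] r(2)[of y] frac[of y] by linarith+
      show "\<bar>S h f y - f y\<bar> \<le> A * h / \<kappa> y" for y
        by (rule start[OF h(1)])
    qed (use fC A h \<open>A * h \<le> A * T\<close> in auto)
    moreover have "S u (S h f) = S s f"
      using semigroup[of u h f] s h fC by simp
    ultimately show ?thesis
      using h by (simp add: mult_ac)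
  qed
  have "\<bar>S s f x - S u f x\<bar> \<le> A * L * \<bar>s - u\<bar> / \<kappa> x" if "s \<in> {0..T}" "u \<in> {0..T}" for s u x
    using later[OF that, of x] later[OF that(2,1), of x] by (cases "u \<le> s") (auto simp: abs_minus_commute)
  then show ?thesis
    using A L0 by (intro exI[of _ "A * L"]) auto
qed

lemma orbit_in_Lipschitz_set:
  assumes f: "f \<in> Lipschitz_set \<kappa> S" and s: "0 \<le> s"
  shows "S s f \<in> Lipschitz_set \<kappa> S"
proof -
  have fC: "f \<in> C_weighted \<kappa>"
    using f by (simp add: Lipschitz_set_def)
  obtain C where C: "0 \<le> C" "\<And>p q x. p \<in> {0..s + 1} \<Longrightarrow> q \<in> {0..s + 1} \<Longrightarrow> \<bar>S p f x - S q f x\<bar> \<le> C * \<bar>p - q\<bar> / \<kappa> x"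
    using orbit_lipschitz[OF f, of "s + 1"] s by auto
  show ?thesis
  proof (rule Lipschitz_setI[OF maps_into[OF s fC] zero_less_one C(1)])
    fix h x :: _ assume h: "0 < h" "h < (1 :: real)"
    have "S h (S s f) = S (h + s) f"
      using semigroup[of h s f] h s fC by simp
    then show "\<bar>S h (S s f) x - S s f x\<bar> \<le> C * h / \<kappa> x"
      using C(2)[of "h + s" s x] h s by simp
  qed
qed

text \<open>The generator limit is taken along sequences. If no bound on the difference quotients were
uniform in the step size, some sequence of steps would violate the bounds \<open>0, 1, 2, \<dots>\<close> one after
the other.\<close>

lemma generator_domain_subset_Lipschitz_set:
  assumes "f \<in> generator_domain \<kappa> S"
  shows "f \<in> Lipschitz_set \<kappa> S"
proof (rule ccontr)
  assume contra: "f \<notin> Lipschitz_set \<kappa> S"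
  obtain g where fC: "f \<in> C_weighted \<kappa>" and g: "is_generator_limit \<kappa> S f g"
    using assms by (auto simp: generator_domain_def)
  have "\<exists>h. 0 < h \<and> h < 1 / real (Suc n) \<and> (\<exists>x. \<not> \<bar>S h f x - f x\<bar> \<le> real n * h / \<kappa> x)" for n
  proof (rule ccontr)
    assume "\<not> ?thesis"
    then have "\<And>h x. 0 < h \<Longrightarrow> h < 1 / real (Suc n) \<Longrightarrow> \<bar>S h f x - f x\<bar> \<le> real n * h / \<kappa> x"
      by blast
    then have "f \<in> Lipschitz_set \<kappa> S"
      by (intro Lipschitz_setI[OF fC, of "1 / real (Suc n)" "real n"]) auto
    with contra show False ..
  qed
  then obtain h where h: "\<And>n. 0 < h n" "\<And>n. h n < 1 / real (Suc n)"
      "\<And>n. \<exists>x. \<not> \<bar>S (h n) f x - f x\<bar> \<le> real n * h n / \<kappa> x"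
    by metis
  have h0: "h \<longlonglongrightarrow> 0"
  proof (rule tendsto_sandwich[OF _ _ tendsto_const])
    show "(\<lambda>n. 1 / real (Suc n)) \<longlonglongrightarrow> 0"
      using LIMSEQ_inverse_real_of_nat by (simp add: inverse_eq_divide)
  qed (use h(1,2) in \<open>auto intro!: always_eventually less_imp_le\<close>)
  obtain w where w: "mixed_null w" "\<And>n x. \<bar>S (h n) f x - f x - h n * g x\<bar> = h n * w n x"
    using generator_remainder[OF fC g h(1) h0] by blast
  obtain R where R: "\<And>n x. w n x \<le> R / \<kappa> x"
    using mixed_null_bound[OF w(1)] by blast
  have "g \<in> C_weighted \<kappa>"
    using g by (simp add: is_generator_limit_def)
  then obtain G where G: "\<And>x. \<bar>g x\<bar> \<le> G / \<kappa> x"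
    using C_weighted_bound by blast
  obtain n where n: "R + G \<le> real n"
    using real_arch_simple by blast
  have "\<bar>S (h n) f x - f x\<bar> \<le> real n * h n / \<kappa> x" for x
  proof -
    have "\<bar>S (h n) f x - f x\<bar> \<le> h n * w n x + h n * \<bar>g x\<bar>"
      using w(2)[of n x] h(1)[of n] abs_mult[of "h n" "g x"] by linarith
    also have "\<dots> \<le> h n * (R / \<kappa> x) + h n * (G / \<kappa> x)"
      using R[of n x] G[of x] h(1)[of n] by (intro add_mono mult_left_mono) auto
    also have "\<dots> = h n * (R + G) / \<kappa> x"
      by (simp add: distrib_left add_divide_distrib)
    also have "\<dots> \<le> h n * real n / \<kappa> x"
      using n h(1)[of n] weight_pos[of x] by (intro divide_right_mono mult_left_mono) auto
    finally show ?thesis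
      by (simp add: mult.commute)
  qed
  with h(3)[of n] show False
    by blast
qed

end

section \<open>Mollified orbits\<close>

lemma shift_in_Lip_b:
  assumes "g \<in> Lip_b"
  shows "shift z g \<in> Lip_b"
proof -
  obtain L where L: "L-lipschitz_on UNIV g" and bnd: "bounded (range g)"
    using assms by (auto simp: Lip_b_def)
  have "L-lipschitz_on UNIV (shift z g)"
  proof (rule lipschitz_onI)
    show "dist (shift z g x) (shift z g y) \<le> L * dist x y" for x y
      using lipschitz_onD[OF L, of "z + x" "z + y"] by (simp add: shift_def)
  qed (rule lipschitz_on_nonneg[OF L])
  moreover have "bounded (range (shift z g))"
    using bnd by (rule bounded_subset) (auto simp: shift_def)
  ultimately show ?thesis
    by (auto simp: Lip_b_def)
qed

text \<open>Jensen's inequality for the average of shifts \<open>mollify c g\<close>. It holds for finite convex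
combinations, and both sides depend continuously on the uniform norm.\<close>

lemma (in weighted_semigroup) semigroup_mollify_le:
  assumes k: "0 \<le> k" and c: "0 < c" and g: "g \<in> Lip_b" and Sg: "S k g \<in> Lip_b"
    and shifted: "\<And>z y. z \<in> cube c \<Longrightarrow> S k (shift z g) y \<le> S k g (z + y) + a / \<kappa> y"
  shows "S k (mollify c g) y \<le> mollify c (S k g) y + a / \<kappa> y"
proof -
  obtain Lg where Lg: "Lg-lipschitz_on UNIV g"
    using g by (auto simp: Lip_b_def)
  obtain Lk where Lk: "Lk-lipschitz_on UNIV (S k g)"
    using Sg by (auto simp: Lip_b_def)
  have Lg0: "0 \<le> Lg" and Lk0: "0 \<le> Lk"
    using Lg Lk lipschitz_on_nonneg by blast+
  have "bounded (range g)"
    using g by (simp add: Lip_b_def)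
  then obtain B where B: "\<And>x. \<bar>g x\<bar> \<le> B"
    by (auto simp: bounded_iff)
  have B0: "0 \<le> B"
    using B[of 0] by linarith
  obtain K where K: "0 < K" "\<And>b x. 0 \<le> b \<Longrightarrow> b \<le> b * K / \<kappa> x"
    using weight_bound by blast
  have D: "0 < Lg * K + 1"
    using Lg0 K(1) by (intro add_nonneg_pos) auto
  have BK: "0 \<le> B * K"
    using B0 K(1) by simp
  obtain L where L: "lipschitz_constant k (B * K) (Lg * K + 1) L"
    using lipschitz_constant_exists[OF k BK D] by blast
  have L0: "0 \<le> L"
    using L by (simp add: lipschitz_constant_def)
  define Z where "Z = Lg * K * L / \<kappa> y + Lk"
  have Z: "0 \<le> Z"
    using Lg0 K(1) L0 Lk0 weight_pos[of y] by (simp add: Z_def)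
  have approx: "S k (mollify c g) y \<le> mollify c (S k g) y + a / \<kappa> y + e * Z" if e: "0 < e" "e \<le> 1" for e
  proof -
    obtain I :: "((real ^ 'n) \<times> (real ^ 'n) set) set" and w
      where I: "finite I" "\<And>i. i \<in> I \<Longrightarrow> 0 \<le> w i" "sum w I = 1" "\<And>i. i \<in> I \<Longrightarrow> fst i \<in> cube c"
        and approx: "\<And>L f x. L-lipschitz_on UNIV f \<Longrightarrow> \<bar>mollify c f x - (\<Sum>i\<in>I. w i * f (x + fst i))\<bar> \<le> L * e"
      using mollify_convex_combination[OF c e(1)] by blast
    define p where "p = (\<lambda>x. \<Sum>i\<in>I. w i * shift (fst i) g x)"
    have shiftC: "shift z g \<in> C_weighted \<kappa>" for z
      by (intro Lip_b_subset_C_weighted shift_in_Lip_b g)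
    have pC: "p \<in> C_weighted \<kappa>"
      unfolding p_def by (rule convex_combination(2)[OF k I(1-3) shiftC])
    have p_bound: "\<bar>p x\<bar> \<le> B * K / \<kappa> x" for x
    proof -
      have "\<bar>p x\<bar> \<le> (\<Sum>i\<in>I. \<bar>w i * shift (fst i) g x\<bar>)"
        unfolding p_def by (rule sum_abs)
      also have "\<dots> \<le> (\<Sum>i\<in>I. w i * B)"
        using I(2) B by (intro sum_mono) (auto simp: abs_mult shift_def intro!: mult_left_mono)
      also have "\<dots> = B"
        by (simp add: I(3) flip: sum_distrib_right)
      also have "B \<le> B * K / \<kappa> x"
        by (rule K(2)[OF B0])
      finally show ?thesis .
    qed
    have mC: "mollify c g \<in> C_weighted \<kappa>"
      using g by (intro Cb_infinity_subset_C_weighted mollify_in_Cb_infinity c Lip_b_continuous) (auto simp: Lip_b_def)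
    have "S k (mollify c g) y \<le> S k p y + Lg * e * K * L / \<kappa> y"
    proof (rule lipschitz_constantD[OF L _ mC pC p_bound])
      show "0 \<le> Lg * e * K"
        using Lg0 e K(1) by simp
      have "Lg * K * e \<le> Lg * K * 1"
        using Lg0 e K(1) by (intro mult_left_mono) auto
      then show "Lg * e * K \<le> Lg * K + 1"
        by (simp add: mult_ac)
      fix x
      have "mollify c g x \<le> p x + Lg * e"
        using approx[OF Lg, of x] by (simp add: p_def shift_def add.commute)
      also have "Lg * e \<le> Lg * e * K / \<kappa> x"
        using Lg0 e by (intro K(2)) auto
      finally show "mollify c g x \<le> p x + Lg * e * K / \<kappa> x"
        by simp
    qed (use k in auto)
    also have "S k p y \<le> (\<Sum>i\<in>I. w i * S k (shift (fst i) g) y)"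
      unfolding p_def by (rule convex_combination(1)[OF k I(1-3) shiftC])
    also have "\<dots> \<le> (\<Sum>i\<in>I. w i * (S k g (y + fst i) + a / \<kappa> y))"
      using I(2) shifted[OF I(4)] by (intro sum_mono mult_left_mono) (auto simp: add.commute)
    also have "\<dots> = (\<Sum>i\<in>I. w i * S k g (y + fst i)) + a / \<kappa> y"
      by (simp only: distrib_left sum.distrib sum_distrib_right[symmetric] I(3) mult_1)
    also have "(\<Sum>i\<in>I. w i * S k g (y + fst i)) \<le> mollify c (S k g) y + Lk * e"
      using approx[OF Lk, of y] by linarith
    finally show ?thesis
      by (simp add: Z_def algebra_simps)
  qed
  have "S k (mollify c g) y \<le> (mollify c (S k g) y + a / \<kappa> y) + d" if d: "0 < d" for d
  proof -
    define e where "e = min 1 (d / (Z + 1))"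
    have e: "0 < e" "e \<le> 1"
      using d Z by (auto simp: e_def)
    have "e * Z \<le> d / (Z + 1) * (Z + 1)"
      using d Z by (intro mult_mono) (auto simp: e_def)
    also have "\<dots> = d"
      using Z by simp
    finally show ?thesis
      using approx[OF e] by linarith
  qed
  then show ?thesis
    by (rule field_le_epsilon)
qed

locale semigroup_comparison =
  S: weighted_semigroup \<kappa> S + T: weighted_semigroup \<kappa> T
  for \<kappa> :: "'n::finite fn" and S T :: "real \<Rightarrow> 'n fn \<Rightarrow> 'n fn" +
  fixes M :: real
  assumes M_nonneg: "0 \<le> M"
    and weight_shift: "\<And>x y. norm y \<le> 1 \<Longrightarrow> 1 / \<kappa> (x + y) \<le> M / \<kappa> x"
    and almost_translation_invariant: "\<And>f \<epsilon>. f \<in> Lipschitz_set \<kappa> T \<inter> Lip_b \<Longrightarrow> 0 < \<epsilon> \<Longrightarrow>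
           \<exists>\<delta>>0. \<exists>t\<^sub>0>0. \<forall>t\<in>{0..t\<^sub>0}. \<forall>x. norm x \<le> \<delta> \<longrightarrow>
             T t (shift x f) \<le> (\<lambda>y. shift x (T t f) y + \<epsilon> * t / \<kappa> y)"
    and Lip_b_invariant: "\<And>t f. 0 \<le> t \<Longrightarrow> f \<in> Lip_b \<Longrightarrow> T t f \<in> Lip_b"
    and smooth_in_domains: "Cb_infinity \<subseteq> generator_domain \<kappa> S \<inter> generator_domain \<kappa> T"
    and generators_ordered: "\<And>f. f \<in> Cb_infinity \<Longrightarrow> generator \<kappa> S f \<le> generator \<kappa> T f"
begin

lemma weight_shift_scaled:
  assumes "norm y \<le> 1" "0 \<le> a"
  shows "a / \<kappa> (x + y) \<le> M * a / \<kappa> x"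
  using mult_left_mono[OF weight_shift[OF assms(1), of x] assms(2)] by (simp add: mult.commute)

lemma smooth_generators:
  assumes "v \<in> Cb_infinity"
  shows "is_generator_limit \<kappa> S v (generator \<kappa> S v)" "is_generator_limit \<kappa> T v (generator \<kappa> T v)"
proof -
  obtain g where "is_generator_limit \<kappa> S v g"
    using assms smooth_in_domains by (auto simp: generator_domain_def)
  then show "is_generator_limit \<kappa> S v (generator \<kappa> S v)"
    using generator_eqI by metis
  obtain g where "is_generator_limit \<kappa> T v g"
    using assms smooth_in_domains by (auto simp: generator_domain_def)
  then show "is_generator_limit \<kappa> T v (generator \<kappa> T v)"
    using generator_eqI by metis
qed

end

text \<open>A fixed orbit of \<open>T\<close> with its Lipschitz constant \<open>C\<close> and its bound \<open>R\<close>. The time horizon is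
\<open>t + 1\<close> because difference quotients at times up to \<open>t\<close> look slightly beyond \<open>t\<close>.\<close>

locale orbit_comparison = semigroup_comparison \<kappa> S T M
  for \<kappa> :: "'n::finite fn" and S T :: "real \<Rightarrow> 'n fn \<Rightarrow> 'n fn" and M +
  fixes f :: "'n fn" and t C R :: real
  assumes initial: "f \<in> Lipschitz_set \<kappa> T" "f \<in> Lip_b"
    and t_nonneg: "0 \<le> t" and C_nonneg: "0 \<le> C" and R_nonneg: "0 \<le> R"
    and orbit_lip: "\<And>s u x. s \<in> {0..t + 1} \<Longrightarrow> u \<in> {0..t + 1} \<Longrightarrow> \<bar>T s f x - T u f x\<bar> \<le> C * \<bar>s - u\<bar> / \<kappa> x"
    and orbit_bound: "\<And>s x. s \<in> {0..t + 1} \<Longrightarrow> \<bar>T s f x\<bar> \<le> R / \<kappa> x"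
begin

lemma f_in_C: "f \<in> C_weighted \<kappa>"
  using initial(1) by (simp add: Lipschitz_set_def)

lemma orbit_in_Lip_b: "0 \<le> s \<Longrightarrow> T s f \<in> Lip_b"
  using Lip_b_invariant initial(2) by blast

lemma orbit_continuous: "0 \<le> s \<Longrightarrow> continuous_on UNIV (T s f)"
  by (rule S.Lip_b_continuous[OF orbit_in_Lip_b])

text \<open>The times \<open>s\<close> at which almost translation invariance of \<open>T s f\<close> with error rate \<open>\<epsilon>\<close> holds with
radius and time horizon \<open>1 / (n + 1)\<close>.\<close>

definition good :: "real \<Rightarrow> nat \<Rightarrow> real set" where
  "good \<epsilon> n = {s \<in> {0..t}. \<forall>k z y. 0 \<le> k \<longrightarrow> k \<le> 1 / real (Suc n) \<longrightarrow> norm z \<le> 1 / real (Suc n) \<longrightarrow>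
     T k (shift z (T s f)) y \<le> T k (T s f) (z + y) + \<epsilon> * k / \<kappa> y}"

lemma goodD:
  assumes "s \<in> good \<epsilon> n" "0 \<le> k" "k \<le> 1 / real (Suc n)" "norm z \<le> 1 / real (Suc n)"
  shows "T k (shift z (T s f)) y \<le> T k (T s f) (z + y) + \<epsilon> * k / \<kappa> y"
  using assms by (simp add: good_def)

lemma good_subset: "good \<epsilon> n \<subseteq> {0..t}"
  by (auto simp: good_def)

lemma good_mono:
  assumes "n \<le> m"
  shows "good \<epsilon> n \<subseteq> good \<epsilon> m"
proof -
  have "1 / real (Suc m) \<le> 1 / real (Suc n)"
    using assms by (intro divide_left_mono) auto
  then show ?thesis
    unfolding good_def by (auto intro: order_trans)
qed

lemma good_exhausts:
  assumes "s \<in> {0..t}" "0 < \<epsilon>"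
  shows "\<exists>n. s \<in> good \<epsilon> n"
proof -
  have "T s f \<in> Lipschitz_set \<kappa> T \<inter> Lip_b"
    using assms initial(1) T.orbit_in_Lipschitz_set orbit_in_Lip_b by auto
  then obtain \<delta> t0 where \<delta>: "0 < \<delta>" "0 < t0"
      "\<And>k z. k \<in> {0..t0} \<Longrightarrow> norm z \<le> \<delta> \<Longrightarrow> T k (shift z (T s f)) \<le> (\<lambda>y. shift z (T k (T s f)) y + \<epsilon> * k / \<kappa> y)"
    using almost_translation_invariant[OF _ assms(2)] by blast
  obtain n where n: "1 / real (Suc n) < min \<delta> t0"
    using nat_approx_posE[of "min \<delta> t0"] \<delta>(1,2) by auto
  have "T k (shift z (T s f)) y \<le> T k (T s f) (z + y) + \<epsilon> * k / \<kappa> y"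
    if "0 \<le> k" "k \<le> 1 / real (Suc n)" "norm z \<le> 1 / real (Suc n)" for k z y
    using \<delta>(3)[of k z] that n by (simp add: le_fun_def shift_def)
  then have "s \<in> good \<epsilon> n"
    using assms(1) by (simp add: good_def)
  then show ?thesis ..
qed

text \<open>For fixed \<open>k\<close>, \<open>z\<close> and \<open>y\<close> both sides of the defining inequality are Lipschitz in \<open>s\<close>: the left
one because shifts by at most \<open>1\<close> distort the weighted norm by at most the factor \<open>M\<close>, the right
one because \<open>T k (T s f) = T (k + s) f\<close>.\<close>

lemma closed_good: "closed (good \<epsilon> n)"
  unfolding closed_sequential_limits
proof (intro allI impI)
  fix s l assume "(\<forall>i. s i \<in> good \<epsilon> n) \<and> s \<longlonglongrightarrow> l"
  then have s: "\<And>i. s i \<in> good \<epsilon> n" and lim: "s \<longlonglongrightarrow> l"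
    by auto
  have s_t: "s i \<in> {0..t}" for i
    using s good_subset by blast
  then have l: "l \<in> {0..t}"
    using closed_sequentially[OF closed_atLeastAtMost _ lim] by blast
  have D: "0 < M * C * t + 1"
    using M_nonneg C_nonneg t_nonneg by (intro add_nonneg_pos) auto
  have MR: "0 \<le> M * R"
    using M_nonneg R_nonneg by simp
  obtain L where L: "T.lipschitz_constant 1 (M * R) (M * C * t + 1) L"
    using T.lipschitz_constant_exists[OF zero_le_one MR D] by blast
  have "T k (shift z (T l f)) y \<le> T k (T l f) (z + y) + \<epsilon> * k / \<kappa> y"
    if k: "0 \<le> k" "k \<le> 1 / real (Suc n)" and z: "norm z \<le> 1 / real (Suc n)" for k z y
  proof -
    have "1 / real (Suc n) \<le> 1"
      by simp
    then have "k \<le> 1" and z1: "norm z \<le> 1"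
      using k z by linarith+
    then have k1: "k \<in> {0..1}"
      using k(1) by simp
    define Z where "Z = M * C * L / \<kappa> y + C / \<kappa> (z + y)"
    have bound: "\<bar>shift z (T u f) x\<bar> \<le> M * R / \<kappa> x" if "u \<in> {0..t}" for u x
      using orbit_bound[of u "x + z"] weight_shift_scaled[OF z1 R_nonneg, of x] that
      by (simp add: shift_def add.commute)
    have step: "T k (shift z (T l f)) y \<le> T k (T l f) (z + y) + \<epsilon> * k / \<kappa> y + \<bar>s i - l\<bar> * Z" for i
    proof -
      have d: "\<bar>l - s i\<bar> \<le> t"
        using l s_t[of i] by auto
      have "\<bar>T k (shift z (T l f)) y - T k (shift z (T (s i) f)) y\<bar> \<le> M * C * \<bar>l - s i\<bar> * L / \<kappa> y"
      proof (rule T.lipschitz_constant_abs[OF L k1])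
        show "shift z (T l f) \<in> C_weighted \<kappa>" "shift z (T (s i) f) \<in> C_weighted \<kappa>"
          using l s_t[of i] by (auto intro!: S.Lip_b_subset_C_weighted shift_in_Lip_b orbit_in_Lip_b)
        show "\<bar>shift z (T l f) x\<bar> \<le> M * R / \<kappa> x" "\<bar>shift z (T (s i) f) x\<bar> \<le> M * R / \<kappa> x" for x
          using bound l s_t by blast+
        show "0 \<le> M * C * \<bar>l - s i\<bar>"
          using M_nonneg C_nonneg by simp
        have "M * C * \<bar>l - s i\<bar> \<le> M * C * t"
          using M_nonneg C_nonneg d by (intro mult_left_mono) auto
        then show "M * C * \<bar>l - s i\<bar> \<le> M * C * t + 1"
          by simp
        show "\<bar>shift z (T l f) x - shift z (T (s i) f) x\<bar> \<le> M * C * \<bar>l - s i\<bar> / \<kappa> x" for x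
        proof -
          have "\<bar>T l f (x + z) - T (s i) f (x + z)\<bar> \<le> C * \<bar>l - s i\<bar> / \<kappa> (x + z)"
            using l s_t[of i] by (intro orbit_lip) auto
          also have "\<dots> \<le> M * (C * \<bar>l - s i\<bar>) / \<kappa> x"
            using C_nonneg by (intro weight_shift_scaled z1) auto
          finally show ?thesis
            by (simp add: shift_def add.commute mult.assoc)
        qed
      qed
      moreover have "\<bar>T k (T l f) (z + y) - T k (T (s i) f) (z + y)\<bar> \<le> C * \<bar>l - s i\<bar> / \<kappa> (z + y)"
      proof -
        have "T k (T l f) = T (k + l) f" "T k (T (s i) f) = T (k + s i) f"
          using T.semigroup[of k l f] T.semigroup[of k "s i" f] k l s_t[of i] f_in_C by auto
        then show ?thesis
          using orbit_lip[of "k + l" "k + s i" "z + y"] k1 l s_t[of i] by simp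
      qed
      moreover have "T k (shift z (T (s i) f)) y \<le> T k (T (s i) f) (z + y) + \<epsilon> * k / \<kappa> y"
        by (rule goodD[OF s k z])
      moreover have "\<bar>s i - l\<bar> * Z = M * C * \<bar>l - s i\<bar> * L / \<kappa> y + C * \<bar>l - s i\<bar> / \<kappa> (z + y)"
        by (simp add: Z_def algebra_simps abs_minus_commute)
      ultimately show ?thesis
        by linarith
    qed
    have "(\<lambda>i. T k (T l f) (z + y) + \<epsilon> * k / \<kappa> y + \<bar>s i - l\<bar> * Z) \<longlonglongrightarrow> T k (T l f) (z + y) + \<epsilon> * k / \<kappa> y + \<bar>l - l\<bar> * Z"
      by (intro tendsto_intros lim)
    then show ?thesis
      using LIMSEQ_le_const[of _ _ "T k (shift z (T l f)) y"] step by auto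
  qed
  then show "l \<in> good \<epsilon> n"
    using l by (simp add: good_def)
qed

lemma measure_bad_tendsto_0:
  assumes "0 < \<epsilon>"
  shows "(\<lambda>n. measure lborel ({0..t} - good \<epsilon> n)) \<longlonglongrightarrow> 0"
proof -
  let ?A = "\<lambda>n. {0..t} - good \<epsilon> n"
  have "(\<lambda>n. measure lborel (?A n)) \<longlonglongrightarrow> measure lborel (\<Inter>n. ?A n)"
  proof (rule Lim_measure_decseq)
    show "range ?A \<subseteq> sets lborel"
      using closed_good by auto
    show "decseq ?A"
      unfolding decseq_def using good_mono by blast
    fix n
    have "emeasure lborel (?A n) \<le> emeasure lborel {0..t}"
      by (rule emeasure_mono) auto
    also have "\<dots> < \<infinity>"
      using t_nonneg by simp
    finally show "emeasure lborel (?A n) \<noteq> \<infinity>"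
      by simp
  qed
  moreover have "(\<Inter>n. ?A n) = {}"
    using good_exhausts[OF _ assms] by fastforce
  ultimately show ?thesis
    by (simp only: measure_empty)
qed

definition smooth_orbit :: "real \<Rightarrow> real \<Rightarrow> 'n fn" where
  "smooth_orbit c s = mollify c (T s f)"

context
  fixes n :: nat and c \<epsilon> :: real
  assumes c: "0 < c" "real CARD('n) * c \<le> 1 / real (Suc n)" and \<epsilon>: "0 < \<epsilon>" "\<epsilon> \<le> 1"
begin

lemma cube_small: "z \<in> cube c \<Longrightarrow> norm z \<le> 1 / real (Suc n)" for z :: "real ^ 'n"
  using norm_cube[of z c] c(2) by linarith

lemma cube_small_1: "norm z \<le> 1" if "z \<in> cube c" for z :: "real ^ 'n"
proof -
  have "1 / real (Suc n) \<le> 1"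
    by simp
  then show ?thesis
    using cube_small[OF that] by linarith
qed

lemma smooth_orbit_smooth: "0 \<le> s \<Longrightarrow> smooth_orbit c s \<in> Cb_infinity"
  unfolding smooth_orbit_def using orbit_in_Lip_b[of s]
  by (intro mollify_in_Cb_infinity c orbit_continuous) (auto simp: Lip_b_def)

lemma smooth_orbit_in_C: "0 \<le> s \<Longrightarrow> smooth_orbit c s \<in> C_weighted \<kappa>"
  by (intro S.Cb_infinity_subset_C_weighted smooth_orbit_smooth)

lemma smooth_orbit_bound:
  assumes "s \<in> {0..t + 1}"
  shows "\<bar>smooth_orbit c s x\<bar> \<le> M * R / \<kappa> x"
proof -
  have "\<bar>mollify c (T s f) x - 0\<bar> \<le> M * R / \<kappa> x"
  proof (rule mollify_near_const[OF c(1)])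
    fix y :: "real ^ 'n" assume "y \<in> cube c"
    then show "\<bar>T s f (x + y) - 0\<bar> \<le> M * R / \<kappa> x"
      using orbit_bound[OF assms, of "x + y"] weight_shift_scaled[OF cube_small_1 R_nonneg, of y x] by simp
  qed (use assms orbit_continuous in auto)
  then show ?thesis
    by (simp add: smooth_orbit_def)
qed

lemma smooth_orbit_lip:
  assumes "s \<in> {0..t + 1}" "u \<in> {0..t + 1}"
  shows "\<bar>smooth_orbit c s x - smooth_orbit c u x\<bar> \<le> M * C * \<bar>s - u\<bar> / \<kappa> x"
  unfolding smooth_orbit_def
proof (rule mollify_diff_le[OF c(1)])
  fix y :: "real ^ 'n" assume y: "y \<in> cube c"
  have "\<bar>T s f (x + y) - T u f (x + y)\<bar> \<le> C * \<bar>s - u\<bar> / \<kappa> (x + y)"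
    using assms by (rule orbit_lip)
  also have "\<dots> \<le> M * (C * \<bar>s - u\<bar>) / \<kappa> x"
    using C_nonneg by (intro weight_shift_scaled cube_small_1 y) auto
  finally show "\<bar>T s f (x + y) - T u f (x + y)\<bar> \<le> M * C * \<bar>s - u\<bar> / \<kappa> x"
    by (simp add: mult.assoc)
qed (use assms orbit_continuous in auto)

lemma T_smooth_orbit_le:
  assumes s: "s \<in> good \<epsilon> n" and k: "0 \<le> k" "k \<le> 1 / real (Suc n)"
  shows "T k (smooth_orbit c s) y \<le> smooth_orbit c (s + k) y + \<epsilon> * k / \<kappa> y"
proof -
  have s0: "0 \<le> s"
    using s good_subset by fastforce
  have "T k (mollify c (T s f)) y \<le> mollify c (T k (T s f)) y + \<epsilon> * k / \<kappa> y"
  proof (rule T.semigroup_mollify_le[OF k(1) c(1)])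
    show "T s f \<in> Lip_b" "T k (T s f) \<in> Lip_b"
      using orbit_in_Lip_b[OF s0] Lip_b_invariant k(1) by auto
    show "T k (shift z (T s f)) y \<le> T k (T s f) (z + y) + \<epsilon> * k / \<kappa> y" if "z \<in> cube c" for z y
      by (rule goodD[OF s k cube_small[OF that]])
  qed
  moreover have "T k (T s f) = T (s + k) f"
    using T.semigroup[of k s f] k(1) s0 f_in_C by (simp add: add.commute)
  ultimately show ?thesis
    by (simp add: smooth_orbit_def)
qed

text \<open>The difference quotients of \<open>T\<close> at the mollified function are at most the mollified difference
quotients of the orbit, up to \<open>\<epsilon> / \<kappa>\<close>, and the latter are bounded by the Lipschitz constant of the
orbit. This bound does not deteriorate when the support of the bump shrinks.\<close>

lemma generator_smooth_orbit_le:
  assumes s: "s \<in> good \<epsilon> n"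
  shows "generator \<kappa> S (smooth_orbit c s) y \<le> (M * C + \<epsilon>) / \<kappa> y"
proof -
  have s_t: "s \<in> {0..t}"
    using s good_subset by blast
  define h where "h m = 1 / real (Suc (m + n))" for m
  have h: "0 < h m" "h m \<le> 1 / real (Suc n)" "h m \<le> 1" for m
  proof -
    show "0 < h m"
      by (simp add: h_def)
    show "h m \<le> 1 / real (Suc n)"
      unfolding h_def by (intro divide_left_mono) auto
    also have "1 / real (Suc n) \<le> 1"
      by simp
    finally show "h m \<le> 1" .
  qed
  have "(\<lambda>m. 1 / real (Suc m)) \<longlonglongrightarrow> 0"
    using LIMSEQ_inverse_real_of_nat by (simp add: inverse_eq_divide)
  then have h0: "h \<longlonglongrightarrow> 0"
    unfolding h_def[abs_def] by (rule LIMSEQ_ignore_initial_segment)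
  let ?v = "smooth_orbit c s"
  have v: "?v \<in> Cb_infinity"
    using s_t by (intro smooth_orbit_smooth) auto
  have "mixed_limit \<kappa> (\<lambda>m x. (T (h m) ?v x - ?v x) / h m) (generator \<kappa> T ?v)"
    by (rule generator_limit_sequence[OF smooth_generators(2)[OF v] h(1) h0])
  then have "uniform_limit {y} (\<lambda>m x. (T (h m) ?v x - ?v x) / h m) (generator \<kappa> T ?v) sequentially"
    unfolding mixed_limit_def using compact_sing by blast
  then have lim: "(\<lambda>m. (T (h m) ?v y - ?v y) / h m) \<longlonglongrightarrow> generator \<kappa> T ?v y"
    by (simp add: uniform_limit_singleton)
  have "(T (h m) ?v y - ?v y) / h m \<le> (M * C + \<epsilon>) / \<kappa> y" for m
  proof -
    have "T (h m) ?v y \<le> smooth_orbit c (s + h m) y + \<epsilon> * h m / \<kappa> y"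
      using h(1)[of m] by (intro T_smooth_orbit_le s h(2)) simp
    moreover have "\<bar>smooth_orbit c (s + h m) y - ?v y\<bar> \<le> M * C * \<bar>s + h m - s\<bar> / \<kappa> y"
      using s_t h(1,3)[of m] by (intro smooth_orbit_lip) auto
    ultimately have "T (h m) ?v y - ?v y \<le> M * C * h m / \<kappa> y + \<epsilon> * h m / \<kappa> y"
      using h(1)[of m] by simp
    also have "\<dots> = (M * C + \<epsilon>) / \<kappa> y * h m"
      by (simp add: distrib_right add_divide_distrib)
    finally show ?thesis
      using h(1)[of m] by (simp add: pos_divide_le_eq)
  qed
  then have "generator \<kappa> T ?v y \<le> (M * C + \<epsilon>) / \<kappa> y"
    by (intro LIMSEQ_le_const2[OF lim]) auto
  then show ?thesis
    using le_funD[OF generators_ordered[OF v], of y] by linarith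
qed

text \<open>The bound across gaps: keep the function \<open>smooth_orbit c s\<close> while \<open>S\<close> runs for the time \<open>u - s\<close>,
then replace it by \<open>smooth_orbit c u\<close>. Only the left end \<open>s\<close> has to be good.\<close>

lemma interpolation_crude:
  assumes L: "S.lipschitz_constant t (M * R) (M * C + 2) L"
    and L': "S.lipschitz_constant t (M * R) (M * C * t + 1) L'"
    and s: "s \<in> good \<epsilon> n" and u: "s \<le> u" "u \<le> t"
  shows "S (t - s) (smooth_orbit c s) x \<le> S (t - u) (smooth_orbit c u) x + ((M * C + 1) * L + M * C * L') / \<kappa> x * (u - s)"
proof -
  have s_t: "s \<in> {0..t}"
    using s good_subset by blast
  have MC: "0 \<le> M * C"
    using M_nonneg C_nonneg by simp
  have MR: "0 \<le> M * R"
    using M_nonneg R_nonneg by simp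
  have L0: "0 \<le> L"
    using L by (simp add: S.lipschitz_constant_def)
  have "S ((t - u) + (u - s)) (smooth_orbit c s) x \<le> S (t - u) (smooth_orbit c s) x + (M * C + \<epsilon>) * L / \<kappa> x * (u - s)"
  proof (rule S.semigroup_growth)
    show "smooth_orbit c s \<in> C_weighted \<kappa>"
      using s_t by (intro smooth_orbit_in_C) auto
    show "\<bar>smooth_orbit c s x\<bar> \<le> M * R / \<kappa> x" for x
      using s_t by (intro smooth_orbit_bound) auto
    show "is_generator_limit \<kappa> S (smooth_orbit c s) (generator \<kappa> S (smooth_orbit c s))"
      using s_t by (intro smooth_generators smooth_orbit_smooth) auto
    show "generator \<kappa> S (smooth_orbit c s) y \<le> (M * C + \<epsilon>) / \<kappa> y" for y
      by (rule generator_smooth_orbit_le[OF s])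
    show "S.lipschitz_constant t (M * R) (M * C + 2) L"
      by (rule L)
  qed (use MC MR \<epsilon> u s_t in auto)
  moreover have "(M * C + \<epsilon>) * L / \<kappa> x * (u - s) \<le> (M * C + 1) * L / \<kappa> x * (u - s)"
    using \<epsilon> L0 u S.weight_pos[of x] by (intro mult_right_mono divide_right_mono) auto
  moreover have "S (t - u) (smooth_orbit c s) x \<le> S (t - u) (smooth_orbit c u) x + M * C * (u - s) * L' / \<kappa> x"
  proof (rule S.lipschitz_constantD[OF L'])
    show "t - u \<in> {0..t}" "smooth_orbit c s \<in> C_weighted \<kappa>" "smooth_orbit c u \<in> C_weighted \<kappa>"
      using s_t u by (auto intro!: smooth_orbit_in_C)
    show "\<bar>smooth_orbit c u x\<bar> \<le> M * R / \<kappa> x" for x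
      using s_t u by (intro smooth_orbit_bound) auto
    show "0 \<le> M * C * (u - s)"
      using MC u by simp
    have "M * C * (u - s) \<le> M * C * t"
      using MC u s_t by (intro mult_left_mono) auto
    then show "M * C * (u - s) \<le> M * C * t + 1"
      by simp
    show "smooth_orbit c s x \<le> smooth_orbit c u x + M * C * (u - s) / \<kappa> x" for x
      using smooth_orbit_lip[of s u x] s_t u by (simp add: abs_le_iff)
  qed
  ultimately show ?thesis
    by (simp add: add_divide_distrib distrib_right) (simp add: mult_ac)
qed

text \<open>Over a short time \<open>h\<close> the mollified function moves by \<open>h\<close> times its generator up to a null
sequence, for \<open>S\<close> as for \<open>T\<close>. So the ordering of the generators replaces \<open>S h\<close> by \<open>T h\<close>, and Jensen's
inequality replaces \<open>T h\<close> of the mollified function by the mollified function at time \<open>s + h\<close>.\<close>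

lemma interpolation_derivative:
  assumes L: "S.lipschitz_constant t (M * R) (M * C + 2) L"
    and s: "s \<in> good \<epsilon> n" "s < t" and e: "0 < e"
  shows "\<exists>\<delta>>0. \<forall>u\<in>{0..t}. s < u \<and> u < s + \<delta> \<longrightarrow>
      S (t - s) (smooth_orbit c s) x \<le> S (t - u) (smooth_orbit c u) x + (\<epsilon> * L / \<kappa> x + e) * (u - s)"
proof (rule ccontr)
  assume contra: "\<not> ?thesis"
  have s_t: "s \<in> {0..t}"
    using s good_subset by blast
  have "\<exists>u\<in>{0..t}. s < u \<and> u < s + 1 / real (Suc (m + n)) \<and>
      \<not> S (t - s) (smooth_orbit c s) x \<le> S (t - u) (smooth_orbit c u) x + (\<epsilon> * L / \<kappa> x + e) * (u - s)" for m
  proof -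
    have "0 < 1 / real (Suc (m + n))"
      by simp
    with contra show ?thesis
      by blast
  qed
  then obtain u where u: "\<And>m. u m \<in> {0..t}" "\<And>m. s < u m" "\<And>m. u m < s + 1 / real (Suc (m + n))"
    and bad: "\<And>m. \<not> S (t - s) (smooth_orbit c s) x \<le> S (t - u m) (smooth_orbit c (u m)) x + (\<epsilon> * L / \<kappa> x + e) * (u m - s)"
    by metis
  define h where "h m = u m - s" for m
  have h_pos: "0 < h m" for m
    using u(2)[of m] by (simp add: h_def)
  have h_small: "h m \<le> 1 / real (Suc (m + n))" for m
    using u(3)[of m] by (simp add: h_def)
  have h_n: "h m \<le> 1 / real (Suc n)" for m
  proof -
    have "1 / real (Suc (m + n)) \<le> 1 / real (Suc n)"
      by (intro divide_left_mono) auto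
    then show ?thesis
      using h_small[of m] by linarith
  qed
  have h0: "h \<longlonglongrightarrow> 0"
  proof (rule tendsto_sandwich[OF _ _ tendsto_const])
    have "(\<lambda>m. 1 / real (Suc m)) \<longlonglongrightarrow> 0"
      using LIMSEQ_inverse_real_of_nat by (simp add: inverse_eq_divide)
    then show "(\<lambda>m. 1 / real (Suc (m + n))) \<longlonglongrightarrow> 0"
      by (rule LIMSEQ_ignore_initial_segment)
  qed (use h_pos h_small in \<open>auto intro!: always_eventually less_imp_le\<close>)
  let ?v = "smooth_orbit c s"
  have v: "?v \<in> Cb_infinity" and vC: "?v \<in> C_weighted \<kappa>"
    using s_t by (auto intro!: smooth_orbit_smooth smooth_orbit_in_C)
  obtain w where w: "S.mixed_null w"
      "\<And>m y. \<bar>S (h m) ?v y - ?v y - h m * generator \<kappa> S ?v y\<bar> = h m * w m y"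
    using S.generator_remainder[OF vC smooth_generators(1)[OF v] h_pos h0] by blast
  obtain w' where w': "S.mixed_null w'"
      "\<And>m y. \<bar>T (h m) ?v y - ?v y - h m * generator \<kappa> T ?v y\<bar> = h m * w' m y"
    using T.generator_remainder[OF vC smooth_generators(2)[OF v] h_pos h0] by blast
  define W where "W = (\<lambda>m y. w m y + w' m y)"
  have W: "S.mixed_null W"
    unfolding W_def by (rule S.mixed_null_add[OF w(1) w'(1)])
  have step: "S (h m) ?v y \<le> smooth_orbit c (u m) y + h m * (\<epsilon> / \<kappa> y + W m y)" for m y
  proof -
    have "h m * generator \<kappa> S ?v y \<le> h m * generator \<kappa> T ?v y"
      using generators_ordered[OF v] h_pos[of m] by (intro mult_left_mono) (auto simp: le_fun_def)
    moreover have "S (h m) ?v y - ?v y - h m * generator \<kappa> S ?v y \<le> h m * w m y"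
      using w(2)[of m y] by linarith
    moreover have "- (T (h m) ?v y - ?v y - h m * generator \<kappa> T ?v y) \<le> h m * w' m y"
      using w'(2)[of m y] by linarith
    moreover have "T (h m) ?v y \<le> smooth_orbit c (s + h m) y + \<epsilon> * h m / \<kappa> y"
      using h_pos[of m] by (intro T_smooth_orbit_le s h_n) simp
    moreover have "s + h m = u m"
      by (simp add: h_def)
    moreover have "h m * (\<epsilon> / \<kappa> y + W m y) = \<epsilon> * h m / \<kappa> y + (h m * w m y + h m * w' m y)"
      by (simp add: W_def distrib_left mult.commute)
    ultimately show ?thesis
      by simp
  qed
  have "\<forall>\<^sub>F m in sequentially. S (t - u m) (\<lambda>y. smooth_orbit c (u m) y + h m * (\<epsilon> / \<kappa> y + W m y)) x
      \<le> S (t - u m) (smooth_orbit c (u m)) x + h m * (\<epsilon> * L / \<kappa> x + e)"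
  proof (rule S.first_order_perturbation[OF t_nonneg L _ _ _ _ _ W e _ h0])
    have "0 \<le> M * C"
      using M_nonneg C_nonneg by simp
    then show "\<epsilon> < M * C + 2"
      using \<epsilon> by linarith
    show "0 \<le> \<epsilon>" "0 \<le> M * R"
      using \<epsilon> M_nonneg R_nonneg by auto
    show "smooth_orbit c (u m) \<in> C_weighted \<kappa>" for m
      using u(1)[of m] by (intro smooth_orbit_in_C) auto
    show "\<bar>smooth_orbit c (u m) y\<bar> \<le> M * R / \<kappa> y" for m y
      using u(1)[of m] by (intro smooth_orbit_bound) auto
    show "0 \<le> h m" for m
      using h_pos[of m] by simp
    show "t - u m \<in> {0..t}" for m
      using u(1)[of m] by auto
  qed
  then obtain m where m: "S (t - u m) (\<lambda>y. smooth_orbit c (u m) y + h m * (\<epsilon> / \<kappa> y + W m y)) x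
      \<le> S (t - u m) (smooth_orbit c (u m)) x + h m * (\<epsilon> * L / \<kappa> x + e)"
    unfolding eventually_sequentially by blast
  have "S (t - u m + h m) ?v = S (t - u m) (S (h m) ?v)"
    using u(1)[of m] h_pos[of m] vC by (intro S.semigroup) auto
  moreover have "t - u m + h m = t - s"
    by (simp add: h_def)
  ultimately have "S (t - s) ?v x = S (t - u m) (S (h m) ?v) x"
    by (simp only:)
  also have "\<dots> \<le> S (t - u m) (\<lambda>y. smooth_orbit c (u m) y + h m * (\<epsilon> / \<kappa> y + W m y)) x"
  proof (rule S.semigroup_mono[OF _ _ _ step])
    show "0 \<le> t - u m"
      using u(1)[of m] by simp
    show "S (h m) ?v \<in> C_weighted \<kappa>"
      using h_pos[of m] vC by (intro S.maps_into) auto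
    show "(\<lambda>y. smooth_orbit c (u m) y + h m * (\<epsilon> / \<kappa> y + W m y)) \<in> C_weighted \<kappa>"
      using u(1)[of m] by (intro S.C_weighted_add S.C_weighted_scale smooth_orbit_in_C
          S.C_weighted_inverse_weight S.mixed_nullD[OF W]) auto
  qed
  finally show False
    using m bad[of m] by (simp add: h_def mult.commute)
qed

lemma smooth_orbit_comparison:
  assumes L: "S.lipschitz_constant t (M * R) (M * C + 2) L"
    and L': "S.lipschitz_constant t (M * R) (M * C * t + 1) L'"
    and ends: "0 \<in> good \<epsilon> n" "t \<in> good \<epsilon> n"
  shows "S t (smooth_orbit c 0) x \<le> smooth_orbit c t x + \<epsilon> * L / \<kappa> x * t
      + ((M * C + 1) * L + M * C * L') / \<kappa> x * measure lborel ({0..t} - good \<epsilon> n)"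
proof -
  define \<phi> where "\<phi> s = S (t - s) (smooth_orbit c s) x" for s
  define B where "B = ((M * C + 1) * L + M * C * L') / \<kappa> x"
  have L0: "0 \<le> L" "0 \<le> L'"
    using L L' by (simp_all add: S.lipschitz_constant_def)
  have MC: "0 \<le> M * C"
    using M_nonneg C_nonneg by simp
  have B: "0 \<le> B"
    using MC L0 S.weight_pos[of x] by (simp add: B_def)
  have crude: "\<phi> s \<le> \<phi> u + B * (u - s)" if "s \<in> good \<epsilon> n" "u \<in> good \<epsilon> n" "s < u" for s u
    unfolding \<phi>_def B_def using that good_subset[of \<epsilon> n] by (intro interpolation_crude L L') auto
  have "\<phi> 0 \<le> \<phi> t + \<epsilon> * L / \<kappa> x * (t - 0) + B * measure lborel ({0..t} - good \<epsilon> n)"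
  proof (rule growth_on_closed_set[OF closed_good good_subset ends _ B])
    show "0 \<le> \<epsilon> * L / \<kappa> x"
      using \<epsilon> L0 S.weight_pos[of x] by simp
    fix s e :: real assume s: "s \<in> good \<epsilon> n" and e: "0 < e"
    have "\<phi> u \<le> \<phi> s + e" if u: "u \<in> good \<epsilon> n" "s - e / (B + 1) < u" "u < s" for u
    proof -
      have "\<phi> u \<le> \<phi> s + B * (s - u)"
        by (rule crude[OF u(1) s u(3)])
      also have "B * (s - u) \<le> (B + 1) * (e / (B + 1))"
        using u B e by (intro mult_mono) auto
      also have "\<dots> = e"
        using B by simp
      finally show ?thesis
        by simp
    qed
    moreover have "0 < e / (B + 1)"
      using e B by simp
    ultimately show "\<exists>\<delta>>0. \<forall>u\<in>good \<epsilon> n. s - \<delta> < u \<and> u < s \<longrightarrow> \<phi> u \<le> \<phi> s + e"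
      by blast
    assume "s < t"
    from interpolation_derivative[OF L s this e, of x] good_subset
    show "\<exists>\<delta>>0. \<forall>u\<in>good \<epsilon> n. s < u \<and> u < s + \<delta> \<longrightarrow> \<phi> s \<le> \<phi> u + (\<epsilon> * L / \<kappa> x + e) * (u - s)"
      unfolding \<phi>_def by blast
  next
    fix u s assume "u \<in> good \<epsilon> n" "s \<in> good \<epsilon> n" "u < s"
    then show "\<phi> u \<le> \<phi> s + B * (s - u)"
      by (rule crude)
  qed
  moreover have "\<phi> t = smooth_orbit c t x"
    using S.at_zero[OF smooth_orbit_in_C[OF t_nonneg]] by (simp add: \<phi>_def)
  ultimately show ?thesis
    by (simp add: \<phi>_def B_def)
qed

end

end

section \<open>Comparison of the semigroups\<close>

context semigroup_comparison
begin

lemma comparison_on_Lipschitz_functions: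
  assumes f: "f \<in> Lipschitz_set \<kappa> T" "f \<in> Lip_b" and t: "0 \<le> t"
  shows "S t f x \<le> T t f x"
proof -
  have fC: "f \<in> C_weighted \<kappa>"
    using f(1) by (simp add: Lipschitz_set_def)
  obtain C where C: "0 \<le> C" "\<And>s u y. s \<in> {0..t + 1} \<Longrightarrow> u \<in> {0..t + 1} \<Longrightarrow>
      \<bar>T s f y - T u f y\<bar> \<le> C * \<bar>s - u\<bar> / \<kappa> y"
    using T.orbit_lipschitz[OF f(1), of "t + 1"] t by auto
  obtain r where r: "0 \<le> r" "\<And>y. \<bar>f y\<bar> \<le> r / \<kappa> y"
    using S.C_weighted_bound[OF fC] by blast
  have t1: "0 \<le> t + 1"
    using t by simp
  obtain R where R: "0 \<le> R" "\<And>s v y. s \<in> {0..t + 1} \<Longrightarrow> v \<in> C_weighted \<kappa> \<Longrightarrow>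
      (\<And>z. \<bar>v z\<bar> \<le> r / \<kappa> z) \<Longrightarrow> \<bar>T s v y\<bar> \<le> R / \<kappa> y"
    using T.semigroup_bound[OF r(1) t1] by blast
  interpret orbit_comparison \<kappa> S T M f t C R
    using f t C R(1) R(2)[OF _ fC r(2)] by unfold_locales
  have MC: "0 \<le> M * C" and MR: "0 \<le> M * R" and MCt: "0 < M * C * t + 1" and MC2: "0 < M * C + 2"
    using M_nonneg C(1) R(1) t by (auto intro!: add_nonneg_pos)
  obtain L where L: "S.lipschitz_constant t (M * R) (M * C + 2) L"
    using S.lipschitz_constant_exists[OF t MR MC2] by blast
  obtain L' where L': "S.lipschitz_constant t (M * R) (M * C * t + 1) L'"
    using S.lipschitz_constant_exists[OF t MR MCt] by blast
  have L0: "0 \<le> L" "0 \<le> L'"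
    using L L' by (simp_all add: S.lipschitz_constant_def)
  obtain K where K: "0 < K" "\<And>b y. 0 \<le> b \<Longrightarrow> b \<le> b * K / \<kappa> y"
    using S.weight_bound by blast
  obtain Q where Q: "Q-lipschitz_on UNIV f"
    using f(2) by (auto simp: Lip_b_def)
  obtain Q' where Q': "Q'-lipschitz_on UNIV (T t f)"
    using orbit_in_Lip_b[OF t] by (auto simp: Lip_b_def)
  have Q0: "0 \<le> Q" "0 \<le> Q'"
    using Q Q' lipschitz_on_nonneg by blast+
  define B where "B = ((M * C + 1) * L + M * C * L') / \<kappa> x"
  have B: "0 \<le> B"
    using MC L0 S.weight_pos[of x] by (simp add: B_def)
  define Z where "Z = L / \<kappa> x + L / \<kappa> x * t + B + 1"
  have Z: "0 < Z"
    using L0 B t S.weight_pos[of x] by (simp add: Z_def add_nonneg_pos)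
  have approx: "S t f x \<le> T t f x + \<epsilon> * Z" if \<epsilon>: "0 < \<epsilon>" "\<epsilon> \<le> 1" for \<epsilon>
  proof -
    have "\<forall>\<^sub>F n in sequentially. measure lborel ({0..t} - good \<epsilon> n) < \<epsilon>"
      using measure_bad_tendsto_0[OF \<epsilon>(1)] \<epsilon>(1) by (rule order_tendstoD(2))
    then obtain n1 where n1: "\<And>n. n1 \<le> n \<Longrightarrow> measure lborel ({0..t} - good \<epsilon> n) < \<epsilon>"
      unfolding eventually_sequentially by blast
    obtain n2 where n2: "0 \<in> good \<epsilon> n2"
      using good_exhausts[of 0 \<epsilon>] t \<epsilon>(1) by auto
    obtain n3 where n3: "t \<in> good \<epsilon> n3"
      using good_exhausts[of t \<epsilon>] t \<epsilon>(1) by auto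
    define n where "n = max n1 (max n2 n3)"
    have ends: "0 \<in> good \<epsilon> n" "t \<in> good \<epsilon> n"
      using n2 n3 good_mono[of n2 n \<epsilon>] good_mono[of n3 n \<epsilon>] unfolding n_def by force+
    have bad: "measure lborel ({0..t} - good \<epsilon> n) \<le> \<epsilon>"
      using n1[of n] by (simp add: n_def)
    \<comment> \<open>The cube has points of norm up to \<open>\<rho>\<close>. They must be admissible shifts for \<open>good \<epsilon> n\<close>, and mollification at this scale must move \<open>f\<close> and \<open>T t f\<close> by at most \<open>\<epsilon>\<close>.\<close>
    define \<rho> where "\<rho> = min (1 / real (Suc n)) (\<epsilon> / (Q * K + Q' + 1))"
    have den: "0 < Q * K + Q' + 1"
      using Q0 K(1) by (intro add_nonneg_pos add_nonneg_nonneg) auto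
    have \<rho>: "0 < \<rho>" "\<rho> \<le> 1 / real (Suc n)" "(Q * K + Q' + 1) * \<rho> \<le> \<epsilon>"
    proof -
      show "0 < \<rho>" "\<rho> \<le> 1 / real (Suc n)"
        using \<epsilon>(1) den by (auto simp: \<rho>_def)
      have "(Q * K + Q' + 1) * \<rho> \<le> (Q * K + Q' + 1) * (\<epsilon> / (Q * K + Q' + 1))"
        using den by (intro mult_left_mono) (auto simp: \<rho>_def)
      then show "(Q * K + Q' + 1) * \<rho> \<le> \<epsilon>"
        using den by simp
    qed
    have QK\<rho>: "0 \<le> Q * K * \<rho>" "0 \<le> Q' * \<rho>"
      using Q0 K(1) \<rho>(1) by auto
    have sum\<rho>: "Q * K * \<rho> + Q' * \<rho> + \<rho> \<le> \<epsilon>"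
      using \<rho>(3) by (simp add: distrib_right)
    define c where "c = \<rho> / real CARD('n)"
    have card: "0 < real CARD('n)"
      by simp
    have c: "0 < c" "real CARD('n) * c = \<rho>"
      using \<rho>(1) card by (auto simp: c_def)
    have c': "real CARD('n) * c \<le> 1 / real (Suc n)"
      using c(2) \<rho>(2) by simp
    have near: "\<bar>mollify c g y - g y\<bar> \<le> q * \<rho>" if g: "q-lipschitz_on UNIV g" for g :: "'n fn" and q y
    proof (rule mollify_near_const[OF c(1)])
      show "continuous_on UNIV g"
        using g by (rule lipschitz_on_continuous_on)
      fix z :: "real ^ 'n" assume "z \<in> cube c"
      then have "norm z \<le> \<rho>"
        using norm_cube[of z c] c(2) by simp
      then have "q * norm z \<le> q * \<rho>"
        using lipschitz_on_nonneg[OF g] by (rule mult_left_mono)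
      then show "\<bar>g (y + z) - g y\<bar> \<le> q * \<rho>"
        using lipschitz_onD[OF g, of "y + z" y] by (simp add: dist_norm)
    qed
    have f0: "smooth_orbit c 0 = mollify c f"
      using T.at_zero[OF fC] by (simp add: smooth_orbit_def)
    have "S t f x \<le> S t (smooth_orbit c 0) x + Q * K * \<rho> * L / \<kappa> x"
    proof (rule S.lipschitz_constantD[OF L _ fC])
      show "smooth_orbit c 0 \<in> C_weighted \<kappa>"
        by (rule smooth_orbit_in_C[OF c(1) c' \<epsilon>]) simp
      show "\<bar>smooth_orbit c 0 y\<bar> \<le> M * R / \<kappa> y" for y
        by (rule smooth_orbit_bound[OF c(1) c' \<epsilon>]) (use t in auto)
      show "Q * K * \<rho> \<le> M * C + 2"
        using sum\<rho> QK\<rho> \<rho>(1) \<epsilon>(2) MC by linarith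
      fix y
      have "f y \<le> smooth_orbit c 0 y + Q * \<rho>"
        unfolding f0 using near[OF Q, of y] by (simp add: abs_le_iff)
      also have "Q * \<rho> \<le> Q * \<rho> * K / \<kappa> y"
        using Q0 \<rho>(1) by (intro K(2)) auto
      finally show "f y \<le> smooth_orbit c 0 y + Q * K * \<rho> / \<kappa> y"
        by (simp add: mult_ac)
    qed (use t QK\<rho> in auto)
    moreover have "Q * K * \<rho> * L / \<kappa> x \<le> \<epsilon> * L / \<kappa> x"
      using sum\<rho> QK\<rho> \<rho>(1) L0 S.weight_pos[of x] by (intro divide_right_mono mult_right_mono) auto
    moreover have "S t (smooth_orbit c 0) x \<le> smooth_orbit c t x + \<epsilon> * L / \<kappa> x * t
        + B * measure lborel ({0..t} - good \<epsilon> n)"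
      unfolding B_def by (rule smooth_orbit_comparison[OF c(1) c' \<epsilon> L L' ends])
    moreover have "B * measure lborel ({0..t} - good \<epsilon> n) \<le> B * \<epsilon>"
      using bad B by (rule mult_left_mono)
    moreover have "smooth_orbit c t x \<le> T t f x + \<epsilon>"
      unfolding smooth_orbit_def using near[OF Q', of x] sum\<rho> QK\<rho> \<rho>(1) by (simp add: abs_le_iff)
    moreover have "\<epsilon> * Z = \<epsilon> * L / \<kappa> x + \<epsilon> * L / \<kappa> x * t + B * \<epsilon> + \<epsilon>"
      by (simp add: Z_def algebra_simps)
    ultimately show ?thesis
      by linarith
  qed
  have "S t f x \<le> T t f x + d" if d: "0 < d" for d
  proof -
    define \<epsilon> where "\<epsilon> = min 1 (d / Z)"
    have \<epsilon>: "0 < \<epsilon>" "\<epsilon> \<le> 1"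
      using d Z by (auto simp: \<epsilon>_def)
    have "\<epsilon> * Z \<le> d / Z * Z"
      using Z by (intro mult_right_mono) (auto simp: \<epsilon>_def)
    also have "\<dots> = d"
      using Z by simp
    finally show ?thesis
      using approx[OF \<epsilon>] by linarith
  qed
  then show ?thesis
    by (rule field_le_epsilon)
qed

end

lemma mollify_compact_support:
  fixes g :: "real ^ 'n::finite \<Rightarrow> real"
  assumes g: "continuous_on UNIV g" and support: "\<And>x. r \<le> norm x \<Longrightarrow> g x = 0" and e: "0 < e"
  shows "\<exists>v\<in>Cb_infinity. \<forall>x. \<bar>v x - g x\<bar> \<le> e"
proof -
  have "uniformly_continuous_on (cball 0 (r + 1)) g"
    by (intro compact_uniformly_continuous continuous_on_subset[OF g]) auto
  then obtain d where d: "0 < d" "\<And>x y. x \<in> cball 0 (r + 1) \<Longrightarrow> y \<in> cball 0 (r + 1) \<Longrightarrow> dist y x < d \<Longrightarrow> dist (g y) (g x) < e"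
    unfolding uniformly_continuous_on_def using e by blast
  have close: "\<bar>g (x + z) - g x\<bar> \<le> e" if z: "norm z < min 1 d" for x z
  proof (cases "norm x \<le> r + 1 \<and> norm (x + z) \<le> r + 1")
    case True
    then have "x \<in> cball 0 (r + 1)" "x + z \<in> cball 0 (r + 1)"
      by simp_all
    then have "dist (g (x + z)) (g x) < e"
      using z by (intro d(2)) (auto simp: dist_norm)
    then show ?thesis
      by (simp add: dist_real_def)
  next
    case False
    have "norm x \<le> norm (x + z) + norm z" "norm (x + z) \<le> norm x + norm z"
      using norm_triangle_ineq4[of "x + z" z] norm_triangle_ineq[of x z] by auto
    then have "r \<le> norm x" "r \<le> norm (x + z)"
      using False z by auto
    then show ?thesis
      using support e by simp
  qed
  have "compact (g ` cball 0 (max r 0))"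
    by (intro compact_continuous_image continuous_on_subset[OF g]) auto
  then obtain B where B: "\<And>x. x \<in> cball 0 (max r 0) \<Longrightarrow> \<bar>g x\<bar> \<le> B"
    using compact_imp_bounded bounded_iff by (metis imageI real_norm_def)
  have "\<bar>g x\<bar> \<le> max B 0" for x
    using B[of x] support[of x] by (cases "r \<le> norm x") (auto simp: le_max_iff_disj)
  then have bnd: "bounded (range g)"
    by (intro boundedI[where B = "max B 0"]) auto
  define c where "c = min 1 d / (2 * real CARD('n))"
  have c: "0 < c"
    using d(1) by (simp add: c_def)
  have c_card: "real CARD('n) * c = min 1 d / 2"
    by (simp add: c_def)
  show ?thesis
  proof (intro bexI[of _ "mollify c g"] allI)
    show "mollify c g \<in> Cb_infinity"
      using c g bnd by (rule mollify_in_Cb_infinity)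
    show "\<bar>mollify c g x - g x\<bar> \<le> e" for x
    proof (rule mollify_near_const[OF c g])
      fix z :: "real ^ 'n" assume "z \<in> cube c"
      then have "norm z < min 1 d"
        using norm_cube[of z c] c_card d(1) by simp
      then show "\<bar>g (x + z) - g x\<bar> \<le> e"
        by (rule close)
    qed
  qed
qed

text \<open>Cutting \<open>f\<close> off between the radii \<open>n\<close> and \<open>n + 1\<close> leaves a uniformly continuous function, which can
be mollified with a uniform error. The cutoff and the error are exactly the two summands of \<open>tail\<close>.\<close>

lemma (in weight) smooth_approximation:
  assumes f: "f \<in> C_weighted \<kappa>"
  obtains R v where "0 \<le> R" "\<And>n. v n \<in> Cb_infinity" "\<And>n x. \<bar>v n x - f x\<bar> \<le> tail R n x"
proof -
  obtain R where R: "0 \<le> R" "\<And>x. \<bar>f x\<bar> \<le> R / \<kappa> x"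
    using C_weighted_bound[OF f] by blast
  have "\<exists>v\<in>Cb_infinity. \<forall>x. \<bar>v x - f x\<bar> \<le> tail R n x" for n
  proof -
    define \<zeta> where "\<zeta> = (\<lambda>x :: real ^ 'n. min 1 (max 0 (norm x - real n)))"
    have "continuous_on UNIV (\<lambda>x. f x * (1 - \<zeta> x))"
      unfolding \<zeta>_def by (intro continuous_on_mult C_weighted_continuous[OF f] continuous_intros)
    moreover have "\<And>x. real n + 1 \<le> norm x \<Longrightarrow> f x * (1 - \<zeta> x) = 0"
      by (simp add: \<zeta>_def)
    moreover have "0 < 1 / real (Suc n)"
      by simp
    ultimately have "\<exists>v\<in>Cb_infinity. \<forall>x. \<bar>v x - f x * (1 - \<zeta> x)\<bar> \<le> 1 / real (Suc n)"
      by (rule mollify_compact_support)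
    then obtain v where v: "v \<in> Cb_infinity" "\<And>x. \<bar>v x - f x * (1 - \<zeta> x)\<bar> \<le> 1 / real (Suc n)"
      by blast
    have "\<bar>v x - f x\<bar> \<le> tail R n x" for x
    proof -
      have \<zeta>: "0 \<le> \<zeta> x"
        by (simp add: \<zeta>_def)
      have "\<bar>f x * \<zeta> x\<bar> \<le> R / \<kappa> x * \<zeta> x"
        using mult_right_mono[OF R(2)[of x] \<zeta>] \<zeta> by (simp add: abs_mult)
      moreover have "v x - f x = (v x - f x * (1 - \<zeta> x)) - f x * \<zeta> x"
        by (simp add: algebra_simps)
      ultimately show ?thesis
        using v(2)[of x] unfolding tail_def \<zeta>_def by linarith
    qed
    with v(1) show ?thesis
      by blast
  qed
  then obtain v where "\<And>n. v n \<in> Cb_infinity" "\<And>n x. \<bar>v n x - f x\<bar> \<le> tail R n x"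
    by metis
  with R(1) show thesis
    by (rule that)
qed

text \<open>For smooth \<open>v n\<close> close to \<open>f\<close> the chain is
\<open>S t f \<le> S t (v n + tail R n) \<approx> S t (v n) \<le> T t (v n) \<le> T t (f + tail R n) \<approx> T t f\<close>.\<close>

lemma (in semigroup_comparison) comparison:
  assumes f: "f \<in> C_weighted \<kappa>" and t: "0 \<le> t"
  shows "S t f x \<le> T t f x"
proof -
  obtain R v where R: "0 \<le> R" and v: "\<And>n. v n \<in> Cb_infinity" and near: "\<And>n x. \<bar>v n x - f x\<bar> \<le> S.tail R n x"
    by (rule S.smooth_approximation[OF f]) blast
  have w: "S.mixed_null (S.tail R)"
    by (rule S.tail_mixed_null[OF R])
  have vC: "v n \<in> C_weighted \<kappa>" for n
    using v by (rule S.Cb_infinity_subset_C_weighted)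
  have wC: "S.tail R n \<in> C_weighted \<kappa>" for n
    by (rule S.tail_in_C_weighted[OF R])
  obtain F where F: "0 \<le> F" "\<And>x. \<bar>f x\<bar> \<le> F / \<kappa> x"
    using S.C_weighted_bound[OF f] by blast
  obtain W where W: "\<And>n x. S.tail R n x \<le> W / \<kappa> x"
    using S.mixed_null_bound[OF w] by blast
  have v_bound: "\<bar>v n x\<bar> \<le> (F + \<bar>W\<bar>) / \<kappa> x" for n x
  proof -
    have "\<bar>v n x\<bar> \<le> F / \<kappa> x + W / \<kappa> x"
      using near[of n x] F(2)[of x] W[of n x] by linarith
    also have "\<dots> \<le> F / \<kappa> x + \<bar>W\<bar> / \<kappa> x"
      using S.weight_pos[of x] by (intro add_left_mono divide_right_mono) auto
    finally show ?thesis
      by (simp add: add_divide_distrib)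
  qed
  have FW: "0 \<le> F + \<bar>W\<bar>"
    using F(1) by simp
  obtain LS where LS: "S.lipschitz_constant t (F + \<bar>W\<bar>) 1 LS"
    using S.lipschitz_constant_exists[OF t FW zero_less_one] by blast
  obtain LT where LT: "T.lipschitz_constant t F 1 LT"
    using T.lipschitz_constant_exists[OF t F(1) zero_less_one] by blast
  have "S t f x \<le> T t f x + d" if d: "0 < d" for d
  proof -
    have e: "0 < d / 2"
      using d by simp
    have "\<forall>\<^sub>F n in sequentially. \<forall>s\<in>{0..t}. S s (\<lambda>y. v n y + (0 / \<kappa> y + S.tail R n y)) x \<le> S s (v n) x + 0 * LS / \<kappa> x + d / 2"
      by (rule S.mixed_perturbation[OF t LS order_refl zero_less_one FW vC v_bound w e])
    moreover have "\<forall>\<^sub>F n in sequentially. \<forall>s\<in>{0..t}. T s (\<lambda>y. f y + (0 / \<kappa> y + S.tail R n y)) x \<le> T s f x + 0 * LT / \<kappa> x + d / 2"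
      by (rule T.mixed_perturbation[OF t LT order_refl zero_less_one F(1) f F(2) w e])
    ultimately have "\<forall>\<^sub>F n in sequentially. S t f x \<le> T t f x + d"
    proof eventually_elim
      case (elim n)
      have "f y \<le> v n y + S.tail R n y" "v n y \<le> f y + S.tail R n y" for y
        using near[of n y] by linarith+
      then have "S t f x \<le> S t (\<lambda>y. v n y + S.tail R n y) x" "T t (v n) x \<le> T t (\<lambda>y. f y + S.tail R n y) x"
        using t f vC wC by (auto intro!: S.semigroup_mono T.semigroup_mono S.C_weighted_add)
      moreover have "S t (v n) x \<le> T t (v n) x"
      proof (rule comparison_on_Lipschitz_functions[OF _ _ t])
        show "v n \<in> Lipschitz_set \<kappa> T"
          using v smooth_in_domains by (intro T.generator_domain_subset_Lipschitz_set) blast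
        show "v n \<in> Lip_b"
          using v Cb_infinity_subset_Lip_b by blast
      qed
      ultimately show ?case
        using elim t by (auto dest!: bspec[of _ _ t])
    qed
    then show ?thesis
      by simp
  qed
  then show ?thesis
    by (rule field_le_epsilon)
qed

text \<open>The reflection \<open>y \<mapsto> - y\<close> turns the assumption on the weight into the form in which shifts are
estimated.\<close>

lemma shift_quotient_bound:
  fixes \<kappa> :: "real ^ 'n::finite \<Rightarrow> real"
  assumes pos: "\<And>x. 0 < \<kappa> x"
    and quot: "(SUP x. SUP y\<in>{y. norm y \<le> 1}. ennreal (\<kappa> x / \<kappa> (x - y))) < \<infinity>"
  obtains M where "0 \<le> M" "\<And>x y. norm y \<le> 1 \<Longrightarrow> 1 / \<kappa> (x + y) \<le> M / \<kappa> x"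
proof -
  obtain M where M: "0 \<le> M" "(SUP x. SUP y\<in>{y. norm y \<le> 1}. ennreal (\<kappa> x / \<kappa> (x - y))) = ennreal M"
    using quot by (cases "SUP x. SUP y\<in>{y. norm y \<le> 1}. ennreal (\<kappa> x / \<kappa> (x - y))") auto
  have "1 / \<kappa> (x + y) \<le> M / \<kappa> x" if "norm y \<le> 1" for x y
  proof -
    have "ennreal (\<kappa> x / \<kappa> (x - (- y))) \<le> (SUP y\<in>{y. norm y \<le> 1}. ennreal (\<kappa> x / \<kappa> (x - y)))"
      using that by (intro SUP_upper) auto
    also have "\<dots> \<le> ennreal M"
      unfolding M(2)[symmetric] by (rule SUP_upper) simp
    finally have "\<kappa> x / \<kappa> (x + y) \<le> M"
      using M(1) by (simp add: ennreal_le_iff)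
    then show ?thesis
      using pos[of x] by (simp add: pos_le_divide_eq mult.commute)
  qed
  with M(1) show thesis
    by (rule that)
qed

theorem theorem4p7:
  fixes \<kappa> :: "real ^ 'n::finite \<Rightarrow> real"
    and S T :: "real \<Rightarrow> (real ^ 'n \<Rightarrow> real) \<Rightarrow> (real ^ 'n \<Rightarrow> real)"
  assumes "\<And>x. 0 < \<kappa> x" and "bounded (range \<kappa>)" and "continuous_on UNIV \<kappa>"
    and "(SUP x. SUP y\<in>{y. norm y \<le> 1}. ennreal (\<kappa> x / \<kappa> (x - y))) < \<infinity>"
    and "convex_monotone_semigroup \<kappa> S" and "convex_monotone_semigroup \<kappa> T"
    and "\<And>f \<epsilon>. f \<in> Lipschitz_set \<kappa> T \<inter> Lip_b \<Longrightarrow> 0 < \<epsilon> \<Longrightarrow>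
           \<exists>\<delta>>0. \<exists>t\<^sub>0>0. \<forall>t\<in>{0..t\<^sub>0}. \<forall>x. norm x \<le> \<delta> \<longrightarrow>
             T t (shift x f) \<le> (\<lambda>y. shift x (T t f) y + \<epsilon> * t / \<kappa> y)"
    and "\<And>t f. 0 \<le> t \<Longrightarrow> f \<in> Lip_b \<Longrightarrow> T t f \<in> Lip_b"
    and "Cb_infinity \<subseteq> generator_domain \<kappa> S \<inter> generator_domain \<kappa> T"
    and "\<And>f. f \<in> Cb_infinity \<Longrightarrow> generator \<kappa> S f \<le> generator \<kappa> T f"
  shows "\<forall>t\<ge>0. \<forall>f\<in>C_weighted \<kappa>. S t f \<le> T t f"
proof -
  obtain M where M: "0 \<le> M" "\<And>x y. norm y \<le> 1 \<Longrightarrow> 1 / \<kappa> (x + y) \<le> M / \<kappa> x"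
    using shift_quotient_bound[of \<kappa>, OF assms(1,4)] by blast
  have weight: "weight \<kappa>"
    using assms(1-3) by unfold_locales
  interpret semigroup_comparison \<kappa> S T M
    by (intro semigroup_comparison.intro weighted_semigroup.intro semigroup_comparison_axioms.intro)
      (fact weight assms M)+
  show ?thesis
    using comparison by (simp add: le_fun_def)
qed

end
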